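(* Let $\mathbb{N}=\{0,1,2,\ldots\}$. The set $$\mathcal{S}_4=\{b_1^2+b_2^2+2^{n^2}:\ b_1,b_2,n\in\mathbb{N}\}$$ has a positive lower density, i.e. $\liminf_{N\to\infty}\frac1N|\mathcal{S}_4\cap[1,N]|>0$. Conversely, there also exist an odd positive integer $M$ and an integer $\alpha$ such that the residue class $\{x\in\mathbb{Z}:\ x\equiv\alpha\pmod{M}\}$ contains no integer of the form $b_1^2+b_2^2+2^{n^2}$ with $b_1,b_2,n\in\mathbb{N}$.
   Context: The lower density of a set $S$ of non-negative integers is $\liminf_{N\to\infty}|S\cap[1,N]|/N$. *)

theory Defs
  imports Complex_Main "HOL-Library.Extended_Real" "HOL-Number_Theory.Cong"
begin

(* The limit inferior is taken in the complete lattice ereal; every term of the sequence is a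
   real number in [0, 1] (the term for N = 0 is 0 / 0 = 0). *)
definition lower_density :: "nat set \<Rightarrow> ereal" where
  "lower_density S = liminf (\<lambda>N. ereal (real (card (S \<inter> {1..N})) / real N))"

definition S4 :: "nat set" where
  "S4 = {b1\<^sup>2 + b2\<^sup>2 + 2 ^ (n\<^sup>2) | b1 b2 n. True}"

end

(* Density: let A be the set of integers with no prime factor congruent to 3 mod 4; all of them are
   sums of two squares. By Mertens' theorem mod 4, A has at least c H / sqrt(log H) elements up to H,
   so the pairs (a, n) with a in A, a <= H and 2^(n^2) <= H number at least a constant times H. By
   Cauchy-Schwarz it suffices that only O(H) pairs of such pairs have the same value a + 2^(n^2).
   Selberg's sieve bounds the number of a <= H with a and a + h in A by a constant times
   (H / log H) times the product of 1 + 4/p over the primes p = 3 (mod 4) dividing h. For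
   h = 2^(n^2) - 2^(k^2) these are the p for which the order of 2 mod p divides n^2 - k^2, and the
   product is bounded on average over k < n, as in Romanoff's theorem.

   Residue class: if p = 3 (mod 4) divides a sum of two squares, then so does p^2. Choose x = 2^s
   modulo p^2 with s = -1 (mod p). If n^2 = s modulo the order of 2 mod p, then x - 2^(n^2) is
   divisible by p, but not by p^2, since n^2 = -1 (mod p) is impossible. The primes 3, 7, 31, 11, 151,
   for which 2 has order 2, 3, 5, 10, 15, cover all n. *)
theory Submission
  imports Defs "HOL-Number_Theory.Number_Theory" "HOL-Library.Discrete_Functions"
    "HOL-Analysis.Summation_Tests" "HOL-Analysis.Convex"
begin

section \<open>Selberg's upper bound sieve\<close>

text \<open>The sizes balance exactly: admissible \<open>a\<close> up to \<open>H\<close> have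
  density about \<open>1 / sqrt (log H)\<close>, and about \<open>sqrt (log H)\<close> exponents
  \<open>n\<close> fit below \<open>H\<close>. So a value is hit boundedly often on average, and
  only constant factors may be lost: each of the roughly \<open>log H\<close> pairs
  \<open>k < n\<close> may cost no more than \<open>H / log H\<close>. The sieve reaches this
  because \<open>a\<close> and \<open>a + h\<close> avoid two residue classes modulo about half of
  the primes; its denominator is bounded below by the square of a reciprocal sum of size
  \<open>sqrt (log H)\<close>. In Romanoff's average the exponents are
  \<open>n\<^sup>2 - k\<^sup>2 = (n - k) (n + k)\<close>: splitting a modulus \<open>e\<close>
  between the two factors costs a divisor count, which weakens the weight \<open>1 / e\<close> to
  \<open>1 / sqrt e\<close>, still enough for convergence. For the residue class,
  \<open>p\<^sup>2\<close> is excluded because none of the five primes is a Wieferich prime: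
  \<open>p\<close> then divides the order of 2 modulo \<open>p\<^sup>2\<close>, so that agreement of
  \<open>2 ^ n\<^sup>2\<close> and \<open>2 ^ s\<close> modulo \<open>p\<^sup>2\<close> would force
  \<open>n\<^sup>2 = s = -1\<close> modulo \<open>p\<close>.\<close>

lemma sum_alternating_between:
  assumes "finite M" "K \<subseteq> M"
  shows "(\<Sum>I | K \<subseteq> I \<and> I \<subseteq> M. (-1::real) ^ card I) = (if K = M then (-1) ^ card K else 0)"
proof -
  have fK: "finite K" using assms finite_subset by blast
  have "(\<Sum>I | K \<subseteq> I \<and> I \<subseteq> M. (-1::real) ^ card I) = (\<Sum>J\<in>Pow (M - K). (-1) ^ card (K \<union> J))"
    using assms by (intro sum.reindex_bij_witness[of _ "\<lambda>J. K \<union> J" "\<lambda>I. I - K"])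
      (auto simp: Un_absorb1)
  also have "\<dots> = (\<Sum>J\<in>Pow (M - K). (-1) ^ card K * (-1) ^ card J)"
  proof (rule sum.cong[OF refl])
    fix J assume "J \<in> Pow (M - K)"
    hence "card (K \<union> J) = card K + card J"
      using assms fK by (intro card_Un_disjoint) (auto intro: finite_subset)
    thus "(-1) ^ card (K \<union> J) = (-1::real) ^ card K * (-1) ^ card J" by (simp add: power_add)
  qed
  also have "\<dots> = (-1) ^ card K * (\<Sum>J\<in>Pow (M - K). (\<Prod>x\<in>J. -1) * (\<Prod>x\<in>(M - K) - J. 1))"
    by (simp add: sum_distrib_left)
  also have "(\<Sum>J\<in>Pow (M - K). (\<Prod>x\<in>J. -1::real) * (\<Prod>x\<in>(M - K) - J. 1)) = (\<Prod>x\<in>M - K. -1 + 1)"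
    using assms by (intro prod_add[symmetric]) auto
  also have "\<dots> = (if K = M then 1 else 0)"
    using assms by (auto simp: card_gt_0_iff power_0_left)
  finally show ?thesis by simp
qed

text \<open>Square-free moduli are encoded as finite sets of primes, so that greatest common divisors and
  least common multiples become intersections and unions.\<close>
lemma selberg_sieve:
  fixes X :: "'a set" and D :: "'p set set" and w :: "'p \<Rightarrow> real" and hits :: "'p \<Rightarrow> 'a \<Rightarrow> bool"
  assumes finX: "finite X" and finD: "finite D" and finI: "\<And>I. I \<in> D \<Longrightarrow> finite I"
    and down: "\<And>I J. I \<in> D \<Longrightarrow> J \<subseteq> I \<Longrightarrow> J \<in> D" and empty: "{} \<in> D"
    and w: "\<And>p I. I \<in> D \<Longrightarrow> p \<in> I \<Longrightarrow> 0 < w p \<and> w p < 1"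
    and dens: "\<And>I J. I \<in> D \<Longrightarrow> J \<in> D \<Longrightarrow>
      \<bar>real (card {a \<in> X. \<forall>p\<in>I \<union> J. hits p a}) - N * (\<Prod>p\<in>I \<union> J. w p)\<bar> \<le> r"
  shows "real (card {a \<in> X. \<forall>p\<in>\<Union>D. \<not> hits p a}) \<le>
     N / (\<Sum>I\<in>D. \<Prod>p\<in>I. w p / (1 - w p)) + r * (\<Sum>I\<in>D. \<Prod>p\<in>I. 1 / (1 - w p))\<^sup>2"
proof -
  define h where "h = (\<lambda>I. \<Prod>p\<in>I. w p / (1 - w p))"
  define W where "W = (\<lambda>I. \<Prod>p\<in>I. w p)"
  define G where "G = (\<Sum>I\<in>D. h I)"
  \<comment> \<open>Selberg's optimal weights: they come from minimising the quadratic form in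
    \<open>quad\<close> under the constraint \<open>lam {} = 1\<close>, and \<open>1 / G\<close> is
    the minimum.\<close>
  define lam where "lam = (\<lambda>I. (-1) ^ card I * (\<Sum>M\<in>{M\<in>D. I \<subseteq> M}. h M) / (W I * G))"
  define Q where "Q = (\<lambda>a. \<Sum>I\<in>{I\<in>D. \<forall>p\<in>I. hits p a}. lam I)"
  have hpos: "h I > 0" and Wpos: "W I > 0" if "I \<in> D" for I
    unfolding h_def W_def using w[OF that] by (auto intro!: prod_pos)
  have Wnz: "W I \<noteq> 0" if "I \<in> D" for I using Wpos[OF that] by simp
  have "h {} \<le> G" unfolding G_def using finD empty hpos by (intro member_le_sum) (auto intro: less_imp_le)
  hence Gpos: "G > 0" by (simp add: h_def)
  have lam_empty: "lam {} = 1" using Gpos by (simp add: lam_def W_def G_def)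
  have r0: "r \<ge> 0" using dens[OF empty empty] by linarith

  have lam_bound: "\<bar>lam I\<bar> \<le> (\<Prod>p\<in>I. 1 / (1 - w p))" if I: "I \<in> D" for I
  proof -
    \<comment> \<open>Stripping \<open>I\<close> from \<open>M\<close> factors out
      \<open>h I\<close>, and the sets \<open>M - I\<close> are distinct members of \<open>D\<close>
      by downward closure, so together they account for at most \<open>G\<close>.\<close>
    have "(\<Sum>M\<in>{M\<in>D. I \<subseteq> M}. h M) = (\<Sum>M\<in>{M\<in>D. I \<subseteq> M}. h I * h (M - I))"
    proof (rule sum.cong[OF refl])
      fix M assume M: "M \<in> {M\<in>D. I \<subseteq> M}"
      have "h (I \<union> (M - I)) = h I * h (M - I)"
        unfolding h_def using finI M I by (intro prod.union_disjoint) auto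
      thus "h M = h I * h (M - I)" using M by (simp add: Un_absorb1)
    qed
    also have "\<dots> = h I * (\<Sum>M\<in>(\<lambda>M. M - I) ` {M\<in>D. I \<subseteq> M}. h M)"
      unfolding sum_distrib_left[symmetric]
      by (subst sum.reindex) (auto simp: inj_on_def o_def)
    also have "(\<Sum>M\<in>(\<lambda>M. M - I) ` {M\<in>D. I \<subseteq> M}. h M) \<le> G"
      unfolding G_def using finD hpos down by (intro sum_mono2) (auto intro: less_imp_le)
    hence "h I * (\<Sum>M\<in>(\<lambda>M. M - I) ` {M\<in>D. I \<subseteq> M}. h M) \<le> h I * G"
      using hpos[OF I] by (intro mult_left_mono) auto
    finally have le: "(\<Sum>M\<in>{M\<in>D. I \<subseteq> M}. h M) \<le> h I * G" .
    have nn: "(\<Sum>M\<in>{M\<in>D. I \<subseteq> M}. h M) \<ge> 0" using hpos by (intro sum_nonneg) (auto intro: less_imp_le)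
    have "\<bar>lam I\<bar> = (\<Sum>M\<in>{M\<in>D. I \<subseteq> M}. h M) / (W I * G)"
      using nn Wpos[OF I] Gpos by (simp add: lam_def abs_mult power_abs)
    also have "\<dots> \<le> h I * G / (W I * G)"
      using le Wpos[OF I] Gpos by (intro divide_right_mono) auto
    also have "\<dots> = h I / W I" using Gpos by simp
    also have "\<dots> = (\<Prod>p\<in>I. w p / (1 - w p) / w p)"
      unfolding h_def W_def by (rule prod_dividef[symmetric])
    also have "\<dots> = (\<Prod>p\<in>I. 1 / (1 - w p))"
      using w[OF I] by (intro prod.cong) (simp_all add: order_less_imp_not_eq2)
    finally show ?thesis .
  qed

  \<comment> \<open>Rests on \<open>1 / w p = (1 - w p) / w p + 1\<close>. Applied to
    \<open>I \<inter> J\<close>, it will decouple \<open>I\<close> from \<open>J\<close> in the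
    quadratic form.\<close>
  have expand: "1 / W I = (\<Sum>K\<in>Pow I. 1 / h K)" if I: "I \<in> D" for I
  proof -
    have "1 / W I = (\<Prod>p\<in>I. (1 - w p) / w p + 1)"
    proof -
      have "1 / w p = (1 - w p) / w p + 1" if "p \<in> I" for p
        using w[OF I that] by (simp add: field_simps)
      hence "(\<Prod>p\<in>I. 1 / w p) = (\<Prod>p\<in>I. (1 - w p) / w p + 1)" by (intro prod.cong) auto
      thus ?thesis by (simp add: W_def prod_dividef)
    qed
    also have "\<dots> = (\<Sum>K\<in>Pow I. (\<Prod>p\<in>K. (1 - w p) / w p) * (\<Prod>p\<in>I-K. 1))"
      using finI[OF I] by (rule prod_add)
    also have "\<dots> = (\<Sum>K\<in>Pow I. 1 / h K)"
      by (simp add: h_def prod_dividef)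
    finally show ?thesis .
  qed

  have yK: "(\<Sum>I\<in>{I\<in>D. K \<subseteq> I}. lam I * W I) = (-1) ^ card K * h K / G" if K: "K \<in> D" for K
  proof -
    have "(\<Sum>I\<in>{I\<in>D. K \<subseteq> I}. lam I * W I) =
        (\<Sum>I\<in>{I\<in>D. K \<subseteq> I}. \<Sum>M\<in>{M\<in>D. I \<subseteq> M}. (-1) ^ card I * h M / G)"
      using Wnz by (intro sum.cong) (simp_all add: lam_def sum_distrib_left sum_distrib_right sum_divide_distrib)
    also have "\<dots> = (\<Sum>I\<in>D. \<Sum>M\<in>D. if K \<subseteq> I \<and> I \<subseteq> M then (-1) ^ card I * h M / G else 0)"
      using finD by (subst sum.inter_filter) (auto intro!: sum.cong simp: sum.inter_filter)
    also have "\<dots> = (\<Sum>M\<in>D. \<Sum>I\<in>D. if K \<subseteq> I \<and> I \<subseteq> M then (-1) ^ card I * h M / G else 0)"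
      by (rule sum.swap)
    also have "\<dots> = (\<Sum>M\<in>D. \<Sum>I\<in>{I. K \<subseteq> I \<and> I \<subseteq> M}. (-1) ^ card I * h M / G)"
      using finD down by (intro sum.cong[OF refl], subst sum.inter_filter[symmetric]) (auto intro!: sum.cong)
    also have "\<dots> = (\<Sum>M\<in>{M\<in>D. K \<subseteq> M}. \<Sum>I\<in>{I. K \<subseteq> I \<and> I \<subseteq> M}. (-1) ^ card I * h M / G)"
      using finD by (intro sum.mono_neutral_right) (auto intro!: sum.neutral)
    \<comment> \<open>The signs cancel over all \<open>I\<close> between \<open>K\<close> and
      \<open>M\<close> unless \<open>K = M\<close>, so each diagonal variable keeps a single
      term.\<close>
    also have "\<dots> = (\<Sum>M\<in>{M\<in>D. K \<subseteq> M}. (if K = M then (-1) ^ card K else 0) * h M / G)"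
    proof (rule sum.cong[OF refl])
      fix M assume M: "M \<in> {M\<in>D. K \<subseteq> M}"
      have "(\<Sum>I\<in>{I. K \<subseteq> I \<and> I \<subseteq> M}. (-1) ^ card I * h M / G) =
            (\<Sum>I\<in>{I. K \<subseteq> I \<and> I \<subseteq> M}. (-1) ^ card I) * h M / G"
        by (simp add: sum_distrib_right sum_divide_distrib)
      thus "(\<Sum>I\<in>{I. K \<subseteq> I \<and> I \<subseteq> M}. (-1) ^ card I * h M / G) =
            (if K = M then (-1) ^ card K else 0) * h M / G"
        using sum_alternating_between[of M K] M finI by simp
    qed
    also have "\<dots> = (\<Sum>M\<in>{K}. (if K = M then (-1) ^ card K else 0) * h M / G)"
      using finD K by (intro sum.mono_neutral_right) auto
    finally show ?thesis by simp
  qed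

  have quad: "(\<Sum>I\<in>D. \<Sum>J\<in>D. lam I * lam J * W (I \<union> J)) = 1 / G"
  proof -
    \<comment> \<open>Since \<open>W (I \<union> J) = W I * W J / W (I \<inter> J)\<close>,
      expanding the reciprocal over subsets \<open>K\<close> of \<open>I \<inter> J\<close>
      diagonalises the form: it becomes the sum of the squares of the quantities in
      \<open>yK\<close>, each divided by \<open>h K\<close>.\<close>
    have "(\<Sum>I\<in>D. \<Sum>J\<in>D. lam I * lam J * W (I \<union> J)) =
       (\<Sum>I\<in>D. \<Sum>J\<in>D. \<Sum>K\<in>Pow (I \<inter> J). lam I * W I * (lam J * W J) / h K)"
    proof (intro sum.cong[OF refl])
      fix I J assume I: "I \<in> D" and J: "J \<in> D"
      have IJ: "I \<inter> J \<in> D" using down[OF I] by blast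
      have "W I * W J = W (I \<union> J) * W (I \<inter> J)"
        unfolding W_def using finI[OF I] finI[OF J] by (simp add: prod.union_inter)
      hence "W (I \<union> J) = W I * W J * (1 / W (I \<inter> J))"
        using Wpos[OF IJ] by (simp add: field_simps)
      hence "lam I * lam J * W (I \<union> J) = lam I * W I * (lam J * W J) * (1 / W (I \<inter> J))" by simp
      also have "\<dots> = (\<Sum>K\<in>Pow (I \<inter> J). lam I * W I * (lam J * W J) / h K)"
        unfolding expand[OF IJ] by (simp add: sum_distrib_left)
      finally show "lam I * lam J * W (I \<union> J) = (\<Sum>K\<in>Pow (I \<inter> J). lam I * W I * (lam J * W J) / h K)" .
    qed
    also have "\<dots> = (\<Sum>I\<in>D. \<Sum>J\<in>D. \<Sum>K\<in>D. if K \<subseteq> I \<inter> J then lam I * W I * (lam J * W J) / h K else 0)"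
      using finD down by (intro sum.cong[OF refl], subst sum.inter_filter[symmetric]) (auto intro!: sum.cong)
    also have "\<dots> = (\<Sum>I\<in>D. \<Sum>K\<in>D. \<Sum>J\<in>D. if K \<subseteq> I \<inter> J then lam I * W I * (lam J * W J) / h K else 0)"
      by (intro sum.cong[OF refl] sum.swap)
    also have "\<dots> = (\<Sum>K\<in>D. \<Sum>I\<in>D. \<Sum>J\<in>D. if K \<subseteq> I \<inter> J then lam I * W I * (lam J * W J) / h K else 0)"
      by (rule sum.swap)
    also have "\<dots> = (\<Sum>K\<in>D. (\<Sum>I\<in>{I\<in>D. K \<subseteq> I}. lam I * W I)\<^sup>2 / h K)"
    proof (rule sum.cong[OF refl])
      fix K assume K: "K \<in> D"
      have "(\<Sum>I\<in>{I\<in>D. K \<subseteq> I}. lam I * W I)\<^sup>2 / h K =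
            (\<Sum>I\<in>D. if K \<subseteq> I then lam I * W I else 0) * (\<Sum>I\<in>D. if K \<subseteq> I then lam I * W I else 0) / h K"
        using finD by (simp add: sum.inter_filter power2_eq_square)
      also have "\<dots> = (\<Sum>I\<in>D. \<Sum>J\<in>D. if K \<subseteq> I \<inter> J then lam I * W I * (lam J * W J) / h K else 0)"
        unfolding sum_product sum_divide_distrib by (intro sum.cong) auto
      finally show "(\<Sum>I\<in>D. \<Sum>J\<in>D. if K \<subseteq> I \<inter> J then lam I * W I * (lam J * W J) / h K else 0) =
         (\<Sum>I\<in>{I\<in>D. K \<subseteq> I}. lam I * W I)\<^sup>2 / h K" by simp
    qed
    also have "\<dots> = (\<Sum>K\<in>D. h K / G\<^sup>2)"
    proof (rule sum.cong[OF refl])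
      fix K assume K: "K \<in> D"
      have "((-1) ^ card K * h K / G)\<^sup>2 = (h K / G)\<^sup>2"
        by (simp add: power_mult_distrib power_divide flip: power_mult)
      thus "(\<Sum>I\<in>{I\<in>D. K \<subseteq> I}. lam I * W I)\<^sup>2 / h K = h K / G\<^sup>2"
        using yK[OF K] hpos[OF K] by (simp add: power_divide power2_eq_square)
    qed
    also have "\<dots> = G / G\<^sup>2" by (simp add: G_def sum_divide_distrib)
    finally show ?thesis using Gpos by (simp add: power2_eq_square)
  qed

  have "real (card {a \<in> X. \<forall>p\<in>\<Union>D. \<not> hits p a}) = (\<Sum>a\<in>{a \<in> X. \<forall>p\<in>\<Union>D. \<not> hits p a}. 1)" by simp
  \<comment> \<open>The majorant is a square: \<open>Q a = lam {} = 1\<close> when nothing hits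
    \<open>a\<close>, and \<open>(Q a)\<^sup>2\<close> is nonnegative for every other
    \<open>a\<close>.\<close>
  also have "\<dots> = (\<Sum>a\<in>{a \<in> X. \<forall>p\<in>\<Union>D. \<not> hits p a}. (Q a)\<^sup>2)"
  proof (rule sum.cong[OF refl])
    fix a assume a: "a \<in> {a \<in> X. \<forall>p\<in>\<Union>D. \<not> hits p a}"
    hence "{I \<in> D. \<forall>p\<in>I. hits p a} = {{}}" using empty by auto
    thus "1 = (Q a)\<^sup>2" by (simp add: Q_def lam_empty)
  qed
  also have "\<dots> \<le> (\<Sum>a\<in>X. (Q a)\<^sup>2)" using finX by (intro sum_mono2) auto
  also have "\<dots> = (\<Sum>a\<in>X. \<Sum>I\<in>D. \<Sum>J\<in>D. if \<forall>p\<in>I \<union> J. hits p a then lam I * lam J else 0)"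
  proof (rule sum.cong[OF refl])
    fix a
    have "(Q a)\<^sup>2 = (\<Sum>I\<in>D. if \<forall>p\<in>I. hits p a then lam I else 0) * (\<Sum>I\<in>D. if \<forall>p\<in>I. hits p a then lam I else 0)"
      unfolding Q_def using finD by (simp add: sum.inter_filter power2_eq_square)
    also have "\<dots> = (\<Sum>I\<in>D. \<Sum>J\<in>D. if \<forall>p\<in>I \<union> J. hits p a then lam I * lam J else 0)"
      unfolding sum_product by (intro sum.cong) auto
    finally show "(Q a)\<^sup>2 = (\<Sum>I\<in>D. \<Sum>J\<in>D. if \<forall>p\<in>I \<union> J. hits p a then lam I * lam J else 0)" .
  qed
  also have "\<dots> = (\<Sum>I\<in>D. \<Sum>a\<in>X. \<Sum>J\<in>D. if \<forall>p\<in>I \<union> J. hits p a then lam I * lam J else 0)"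
    by (rule sum.swap)
  also have "\<dots> = (\<Sum>I\<in>D. \<Sum>J\<in>D. \<Sum>a\<in>X. if \<forall>p\<in>I \<union> J. hits p a then lam I * lam J else 0)"
    by (intro sum.cong[OF refl] sum.swap)
  also have "\<dots> = (\<Sum>I\<in>D. \<Sum>J\<in>D. lam I * lam J * real (card {a \<in> X. \<forall>p\<in>I \<union> J. hits p a}))"
    using finX by (intro sum.cong[OF refl]) (simp add: sum.inter_filter[symmetric])
  also have "\<dots> \<le> (\<Sum>I\<in>D. \<Sum>J\<in>D. N * (lam I * lam J * W (I \<union> J)) + r * (\<bar>lam I\<bar> * \<bar>lam J\<bar>))"
  proof (intro sum_mono)
    fix I J assume I: "I \<in> D" and J: "J \<in> D"
    define c where "c = real (card {a \<in> X. \<forall>p\<in>I \<union> J. hits p a})"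
    have "lam I * lam J * (c - N * W (I \<union> J)) \<le> \<bar>lam I * lam J\<bar> * \<bar>c - N * W (I \<union> J)\<bar>"
      by (metis abs_ge_self abs_mult)
    also have "\<dots> \<le> \<bar>lam I * lam J\<bar> * r"
      using dens[OF I J] by (intro mult_left_mono) (auto simp: c_def W_def)
    finally show "lam I * lam J * c \<le> N * (lam I * lam J * W (I \<union> J)) + r * (\<bar>lam I\<bar> * \<bar>lam J\<bar>)"
      by (simp add: algebra_simps abs_mult)
  qed
  also have "\<dots> = N * (1 / G) + r * (\<Sum>I\<in>D. \<bar>lam I\<bar>)\<^sup>2"
  proof -
    have "(\<Sum>I\<in>D. \<bar>lam I\<bar>)\<^sup>2 = (\<Sum>I\<in>D. \<Sum>J\<in>D. \<bar>lam I\<bar> * \<bar>lam J\<bar>)"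
      by (simp add: power2_eq_square sum_product)
    thus ?thesis unfolding quad[symmetric] by (simp add: sum.distrib sum_distrib_left)
  qed
  also have "\<dots> \<le> N * (1 / G) + r * (\<Sum>I\<in>D. \<Prod>p\<in>I. 1 / (1 - w p))\<^sup>2"
    using r0 lam_bound by (intro add_left_mono mult_left_mono power_mono sum_mono sum_nonneg) auto
  finally show ?thesis by (simp add: G_def h_def)
qed

section \<open>Reciprocal sums over integers with prescribed prime factors\<close>

definition composed_of :: "nat set \<Rightarrow> nat set" where
  "composed_of P = {n. n > 0 \<and> (\<forall>p. prime p \<longrightarrow> p dvd n \<longrightarrow> p \<in> P)}"

text \<open>A truncated Euler product over the primes in \<open>P\<close>: upper bounds come from
  the full product, lower bounds from comparison with the harmonic sum.\<close>

definition recip_sum :: "nat set \<Rightarrow> nat \<Rightarrow> real" where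
  "recip_sum P x = (\<Sum>n\<in>composed_of P \<inter> {1..x}. 1 / real n)"

lemma recip_sum_nonneg: "recip_sum P x \<ge> 0"
  unfolding recip_sum_def by (intro sum_nonneg) auto

lemma composed_of_1 [simp]: "Suc 0 \<in> composed_of P"
  by (auto simp: composed_of_def)

lemma recip_sum_ge_1: "x \<ge> 1 \<Longrightarrow> recip_sum P x \<ge> 1"
  unfolding recip_sum_def
  by (rule order_trans[OF _ member_le_sum[of 1]]) auto

lemma composed_of_mult_iff:
  "m * n \<in> composed_of P \<longleftrightarrow> m \<in> composed_of P \<and> n \<in> composed_of P"
  by (auto simp: composed_of_def prime_dvd_mult_iff)

lemma composed_of_prime_iff: "prime p \<Longrightarrow> p \<in> composed_of P \<longleftrightarrow> p \<in> P"
  unfolding composed_of_def using primes_dvd_imp_eq[of _ p] by (auto simp: prime_gt_0_nat)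

lemma composed_of_Un_decompose:
  assumes "n \<in> composed_of (P \<union> Q)"
  shows "\<exists>m\<in>composed_of P. \<exists>k\<in>composed_of Q. n = m * k"
  using assms
proof (induction n rule: prime_divisors_induct)
  case zero thus ?case by (simp add: composed_of_def)
next
  case (unit x)
  thus ?case by (intro bexI[of _ 1]) auto
next
  case (factor p x)
  then obtain m k where mk: "m \<in> composed_of P" "k \<in> composed_of Q" "x = m * k"
    by (auto simp: composed_of_mult_iff)
  have "p \<in> P \<or> p \<in> Q"
    using factor by (auto simp: composed_of_mult_iff composed_of_prime_iff)
  thus ?case
  proof
    assume "p \<in> P"
    hence "p * m \<in> composed_of P" using mk factor by (simp add: composed_of_mult_iff composed_of_prime_iff)
    thus ?thesis using mk by (intro bexI[of _ "p * m"] bexI[of _ k]) auto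
  next
    assume "p \<in> Q"
    hence "p * k \<in> composed_of Q" using mk factor by (simp add: composed_of_mult_iff composed_of_prime_iff)
    thus ?thesis using mk by (intro bexI[of _ "p * k"] bexI[of _ m]) auto
  qed
qed

text \<open>Every counted \<open>n\<close> splits as \<open>m * k\<close> with both factors at most
  \<open>x\<close>. Given a lower bound for the left side and an upper bound for one factor, the
  other factor is bounded below.\<close>

lemma recip_sum_Un: "recip_sum (P \<union> Q) x \<le> recip_sum P x * recip_sum Q x"
proof -
  have "recip_sum (P \<union> Q) x \<le>
     (\<Sum>z\<in>(composed_of P \<inter> {1..x}) \<times> (composed_of Q \<inter> {1..x}). 1 / real (fst z) * (1 / real (snd z)))"
    unfolding recip_sum_def
  proof (rule sum_le_included[where i = "\<lambda>z. fst z * snd z"])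
    show "\<forall>n\<in>composed_of (P \<union> Q) \<inter> {1..x}. \<exists>z\<in>(composed_of P \<inter> {1..x}) \<times> (composed_of Q \<inter> {1..x}).
            fst z * snd z = n \<and> 1 / real n \<le> 1 / real (fst z) * (1 / real (snd z))"
    proof
      fix n assume n: "n \<in> composed_of (P \<union> Q) \<inter> {1..x}"
      then obtain m k where mk: "m \<in> composed_of P" "k \<in> composed_of Q" "n = m * k"
        using composed_of_Un_decompose by blast
      have "m > 0" "k > 0" using mk by (auto simp: composed_of_def)
      hence "m \<le> n" "k \<le> n" using mk(3) by auto
      hence "m \<le> x" "k \<le> x" using n by auto
      thus "\<exists>z\<in>(composed_of P \<inter> {1..x}) \<times> (composed_of Q \<inter> {1..x}).
            fst z * snd z = n \<and> 1 / real n \<le> 1 / real (fst z) * (1 / real (snd z))"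
        using mk n \<open>m > 0\<close> \<open>k > 0\<close> by (intro bexI[of _ "(m, k)"]) auto
    qed
  qed auto
  also have "\<dots> = recip_sum P x * recip_sum Q x"
    unfolding recip_sum_def sum_product by (simp add: sum.cartesian_product case_prod_unfold)
  finally show ?thesis .
qed

lemma recip_sum_mono: "P \<subseteq> Q \<Longrightarrow> recip_sum P x \<le> recip_sum Q x"
  unfolding recip_sum_def by (intro sum_mono2) (auto simp: composed_of_def)

lemma recip_sum_restrict: "recip_sum P x = recip_sum {p \<in> P. prime p \<and> p \<le> x} x"
proof -
  have "composed_of P \<inter> {1..x} = composed_of {p \<in> P. prime p \<and> p \<le> x} \<inter> {1..x}"
    by (auto simp: composed_of_def dest: dvd_imp_le)
  thus ?thesis by (simp add: recip_sum_def)
qed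

lemma recip_sum_singleton:
  assumes "prime p"
  shows "recip_sum {p} x \<le> 1 / (1 - 1 / real p)"
proof -
  have sub: "composed_of {p} \<inter> {1..x} \<subseteq> (\<lambda>k. p ^ k) ` {..<x}"
  proof
    fix n assume n: "n \<in> composed_of {p} \<inter> {1..x}"
    hence "prime_factors n \<subseteq> {p}" by (auto simp: composed_of_def prime_factors_dvd)
    hence "n = p ^ multiplicity p n"
      using n assms prime_factorization_nat[of n]
      by (cases "prime_factors n = {}") (auto simp: subset_singleton_iff prime_factorization_empty_iff not_dvd_imp_multiplicity_0)
    moreover have "multiplicity p n < p ^ multiplicity p n"
      using prime_gt_1_nat[OF assms] by (intro power_gt_expt) simp
    ultimately show "n \<in> (\<lambda>k. p ^ k) ` {..<x}" using n by (auto intro!: image_eqI[of _ _ "multiplicity p n"])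
  qed
  have p: "real p > 1" using prime_gt_1_nat[OF assms] by simp
  have "recip_sum {p} x \<le> (\<Sum>n\<in>(\<lambda>k. p ^ k) ` {..<x}. 1 / real n)"
    unfolding recip_sum_def by (intro sum_mono2 sub) auto
  also have "\<dots> = (\<Sum>k<x. (1 / real p) ^ k)"
    using prime_gt_1_nat[OF assms] by (subst sum.reindex) (auto simp: inj_on_def power_one_over)
  also have "\<dots> \<le> 1 / (1 - 1 / real p)"
  proof -
    have "(1 - 1 / real p) * (\<Sum>k<x. (1 / real p) ^ k) = 1 - (1 / real p) ^ x"
      by (rule one_diff_power_eq[symmetric])
    also have "\<dots> \<le> 1" by simp
    finally show ?thesis using p by (simp add: field_simps)
  qed
  finally show ?thesis .
qed

lemma recip_sum_le_prod:
  assumes "finite P" "\<And>p. p \<in> P \<Longrightarrow> prime p"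
  shows "recip_sum P x \<le> (\<Prod>p\<in>P. 1 / (1 - 1 / real p))"
  using assms
proof (induction P rule: finite_induct)
  case empty
  have "composed_of {} \<inter> {1..x} \<subseteq> {1}"
  proof
    fix n assume "n \<in> composed_of {} \<inter> {1..x}"
    hence "\<not> (\<exists>p. prime p \<and> p dvd n)" by (auto simp: composed_of_def)
    thus "n \<in> {1}" using prime_factor_nat by blast
  qed
  hence "recip_sum {} x \<le> (\<Sum>n\<in>{1::nat}. 1 / real n)"
    unfolding recip_sum_def by (intro sum_mono2) auto
  thus ?case by simp
next
  case (insert p P)
  have "recip_sum (insert p P) x \<le> recip_sum {p} x * recip_sum P x"
    using recip_sum_Un[of "{p}" P x] by simp
  also have "\<dots> \<le> 1 / (1 - 1 / real p) * (\<Prod>p\<in>P. 1 / (1 - 1 / real p))"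
    using insert recip_sum_nonneg prime_gt_1_nat[of p]
    by (intro mult_mono recip_sum_singleton) auto
  finally show ?case using insert by simp
qed

lemma ln_le_recip_sum: "ln (real x + 1) \<le> (\<Sum>n=1..x. 1 / real n)"
proof (induction x)
  case (Suc x)
  have "ln (real (Suc x) + 1) - ln (real x + 1) = ln (1 + 1 / (real x + 1))"
  proof -
    have "1 + 1 / (real x + 1) = (real (Suc x) + 1) / (real x + 1)" by (simp add: field_simps)
    thus ?thesis by (simp add: ln_div)
  qed
  also have "\<dots> \<le> 1 / (real x + 1)" by (intro ln_add_one_self_le_self) auto
  finally show ?case using Suc by (simp add: add.commute)
qed simp

lemma ln_le_recip_sum_primes:
  assumes "x \<ge> 1"
  shows "ln (real x) \<le> recip_sum {p. prime p} x"
proof -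
  have "composed_of {p. prime p} \<inter> {1..x} = {1..x}" by (auto simp: composed_of_def)
  moreover have "ln (real x) \<le> ln (real x + 1)" using assms by simp
  ultimately show ?thesis using ln_le_recip_sum[of x] by (simp add: recip_sum_def)
qed

section \<open>Square-free integers as sets of primes\<close>

lemma sum_inverse_squares_le: "(\<Sum>k=1..n. 1 / (real k)\<^sup>2) \<le> 2"
proof -
  have "(\<Sum>k=1..n. 1 / (real k)\<^sup>2) \<le> 2 - 1 / real n" if "n \<ge> 1"
    using that
  proof (induction n rule: nat_induct_at_least)
    case (Suc n)
    have "1 / (real (Suc n))\<^sup>2 \<le> 1 / (real n * real (Suc n))"
      using Suc.hyps by (intro divide_left_mono) (simp_all add: power2_eq_square mult_right_mono)
    also have "\<dots> = 1 / real n - 1 / real (Suc n)"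
      using Suc.hyps by (simp add: field_simps)
    finally have "1 / (real (Suc n))\<^sup>2 \<le> 1 / real n - 1 / real (Suc n)" .
    with Suc show ?case by simp
  qed simp
  moreover have "1 / real n \<ge> 0" by simp
  ultimately show ?thesis by (cases "n = 0") (simp, linarith)
qed

text \<open>Stands for the square-free integers up to \<open>x\<close> with prime factors in
  \<open>P\<close>. The family is closed under subsets, as the sieve requires of its
  \<open>D\<close>.\<close>

definition prime_sets :: "nat set \<Rightarrow> nat \<Rightarrow> nat set set" where
  "prime_sets P x = {I. finite I \<and> I \<subseteq> P \<and> (\<forall>p\<in>I. prime p) \<and> \<Prod>I \<le> x}"

lemma inj_on_prod_primes: "inj_on (\<lambda>I. \<Prod>I) {I. finite I \<and> (\<forall>p\<in>I. prime (p::nat))}"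
proof (rule inj_onI)
  fix I J :: "nat set"
  assume I: "I \<in> {I. finite I \<and> (\<forall>p\<in>I. prime p)}" and J: "J \<in> {I. finite I \<and> (\<forall>p\<in>I. prime p)}"
    and eq: "\<Prod>I = \<Prod>J"
  have *: "p \<in> K \<longleftrightarrow> prime p \<and> p dvd \<Prod>K" if K: "finite K" "\<forall>p\<in>K. prime p" for p and K :: "nat set"
  proof
    assume "p \<in> K"
    thus "prime p \<and> p dvd \<Prod>K" using that dvd_prodI[of K p "\<lambda>x. x"] by simp
  next
    assume p: "prime p \<and> p dvd \<Prod>K"
    then obtain q where q: "q \<in> K" "p dvd q" using K(1) prime_dvd_prod_iff[of K p "\<lambda>x. x"] by auto
    hence "p = q" using p that(2) primes_dvd_imp_eq by blast
    thus "p \<in> K" using q by simp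
  qed
  have "p \<in> I \<longleftrightarrow> p \<in> J" for p
  proof -
    have "p \<in> I \<longleftrightarrow> prime p \<and> p dvd \<Prod>I" using I by (intro *) simp_all
    also have "\<dots> \<longleftrightarrow> prime p \<and> p dvd \<Prod>J" unfolding eq ..
    also have "\<dots> \<longleftrightarrow> p \<in> J" using J by (intro *[symmetric]) simp_all
    finally show ?thesis .
  qed
  thus "I = J" by blast
qed

lemma prod_primes_ge_1: "(\<forall>p\<in>I. prime (p::nat)) \<Longrightarrow> \<Prod>I \<ge> 1"
  by (metis One_nat_def Suc_leI prime_gt_0_nat prod_pos)

lemma finite_prime_sets [simp]: "finite (prime_sets P x)"
proof -
  have "inj_on (\<lambda>I. \<Prod>I) (prime_sets P x)"
    by (rule inj_on_subset[OF inj_on_prod_primes]) (auto simp: prime_sets_def)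
  moreover have "(\<lambda>I. \<Prod>I) ` prime_sets P x \<subseteq> {..x}" by (auto simp: prime_sets_def)
  ultimately show ?thesis using finite_imageD finite_subset by blast
qed

lemma card_prime_sets_le: "card (prime_sets P x) \<le> x"
proof -
  have "card (prime_sets P x) = card ((\<lambda>I. \<Prod>I) ` prime_sets P x)"
    by (intro card_image[symmetric] inj_on_subset[OF inj_on_prod_primes]) (auto simp: prime_sets_def)
  also have "\<dots> \<le> card {1..x}"
    using prod_primes_ge_1 by (intro card_mono) (force simp: prime_sets_def)+
  finally show ?thesis by simp
qed

lemma prod_le_of_subset_primes:
  fixes I J :: "nat set"
  assumes "finite I" "\<forall>p\<in>I. prime p" "J \<subseteq> I"
  shows "\<Prod>J \<le> \<Prod>I"
proof -
  have "\<Prod>J dvd \<Prod>I" using assms by (intro prod_dvd_prod_subset) auto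
  moreover have "\<Prod>I > 0" using prod_primes_ge_1[OF assms(2)] by linarith
  ultimately show ?thesis by (rule dvd_imp_le)
qed

lemma prime_sets_downward: "I \<in> prime_sets P x \<Longrightarrow> J \<subseteq> I \<Longrightarrow> J \<in> prime_sets P x"
  unfolding prime_sets_def using prod_le_of_subset_primes[of I J]
  by (auto intro: finite_subset)

lemma sum_recip_prod_squares_le:
  assumes "finite F" "F \<subseteq> {I. finite I \<and> (\<forall>p\<in>I. prime (p::nat))}"
  shows "(\<Sum>I\<in>F. 1 / (real (\<Prod>I))\<^sup>2) \<le> 2"
proof -
  define n where "n = Max ((\<lambda>I. \<Prod>I) ` F)"
  have "(\<Sum>I\<in>F. 1 / (real (\<Prod>I))\<^sup>2) = (\<Sum>k\<in>(\<lambda>I. \<Prod>I) ` F. 1 / (real k)\<^sup>2)"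
    using inj_on_subset[OF inj_on_prod_primes assms(2)] by (simp add: sum.reindex)
  also have "\<dots> \<le> (\<Sum>k=1..n. 1 / (real k)\<^sup>2)"
    using assms prod_primes_ge_1 by (intro sum_mono2) (auto simp: n_def)
  also have "\<dots> \<le> 2" by (rule sum_inverse_squares_le)
  finally show ?thesis .
qed

text \<open>Each \<open>n\<close> is a square-free number times a square; the factor 2 bounds the
  sum of \<open>1 / k\<^sup>2\<close> over the square parts.\<close>

lemma recip_sum_le_prime_sets:
  "recip_sum P x \<le> 2 * (\<Sum>I\<in>prime_sets P x. 1 / real (\<Prod>I))"
proof -
  have "recip_sum P x \<le> (\<Sum>z\<in>prime_sets P x \<times> {1..x}. 1 / real (\<Prod>(fst z)) * (1 / (real (snd z))\<^sup>2))"
    unfolding recip_sum_def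
  proof (rule sum_le_included[where i = "\<lambda>z. \<Prod>(fst z) * (snd z)\<^sup>2"])
    show "\<forall>n\<in>composed_of P \<inter> {1..x}. \<exists>z\<in>prime_sets P x \<times> {1..x}.
       \<Prod>(fst z) * (snd z)\<^sup>2 = n \<and> 1 / real n \<le> 1 / real (\<Prod>(fst z)) * (1 / (real (snd z))\<^sup>2)"
    proof
      fix n assume n: "n \<in> composed_of P \<inter> {1..x}"
      define I where "I = {p \<in> prime_factors n. odd (multiplicity p n)}"
      define k where "k = (\<Prod>p\<in>prime_factors n. p ^ (multiplicity p n div 2))"
      have "n = (\<Prod>p\<in>prime_factors n. p ^ multiplicity p n)"
        using n by (intro prime_factorization_nat) auto
      also have "\<dots> = (\<Prod>p\<in>prime_factors n. (if odd (multiplicity p n) then p else 1) * (p ^ (multiplicity p n div 2))\<^sup>2)"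
      proof (rule prod.cong[OF refl])
        fix p
        have "p ^ multiplicity p n = p ^ (multiplicity p n mod 2 + multiplicity p n div 2 * 2)" by simp
        also have "\<dots> = p ^ (multiplicity p n mod 2) * (p ^ (multiplicity p n div 2))\<^sup>2"
          unfolding power_add power_mult ..
        also have "p ^ (multiplicity p n mod 2) = (if odd (multiplicity p n) then p else 1)"
          by (auto simp: odd_iff_mod_2_eq_one)
        finally show "p ^ multiplicity p n = (if odd (multiplicity p n) then p else 1) * (p ^ (multiplicity p n div 2))\<^sup>2" .
      qed
      also have "\<dots> = \<Prod>I * k\<^sup>2"
        unfolding prod.distrib k_def I_def prod_power_distrib
        by (subst prod.inter_filter) auto
      finally have eq: "n = \<Prod>I * k\<^sup>2" .
      have "n > 0" using n by auto
      hence "\<Prod>I > 0" "k > 0" using eq by (auto intro!: Nat.gr0I)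
      moreover have "\<Prod>I \<le> n" "k \<le> n"
      proof -
        show "\<Prod>I \<le> n" using eq \<open>n > 0\<close> by (metis dvd_imp_le dvd_triv_left)
        have "k dvd n" using eq by (metis dvd_def dvd_mult power2_eq_square)
        thus "k \<le> n" using \<open>n > 0\<close> by (rule dvd_imp_le)
      qed
      moreover have "I \<subseteq> P" "\<forall>p\<in>I. prime p" "finite I"
        using n by (auto simp: I_def composed_of_def prime_factors_dvd)
      ultimately show "\<exists>z\<in>prime_sets P x \<times> {1..x}.
         \<Prod>(fst z) * (snd z)\<^sup>2 = n \<and> 1 / real n \<le> 1 / real (\<Prod>(fst z)) * (1 / (real (snd z))\<^sup>2)"
        using n eq \<open>\<Prod>I \<le> n\<close>[THEN order_trans, of x] by (intro bexI[of _ "(I, k)"]) (auto simp: prime_sets_def)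
    qed
  qed (auto intro!: mult_nonneg_nonneg prod_nonneg)
  also have "\<dots> = (\<Sum>I\<in>prime_sets P x. 1 / real (\<Prod>I)) * (\<Sum>k=1..x. 1 / (real k)\<^sup>2)"
    unfolding sum_product by (simp add: sum.cartesian_product case_prod_unfold)
  also have "\<dots> \<le> (\<Sum>I\<in>prime_sets P x. 1 / real (\<Prod>I)) * 2"
    by (intro mult_left_mono sum_inverse_squares_le sum_nonneg) (auto intro!: prod_nonneg)
  finally show ?thesis by simp
qed

text \<open>Write \<open>I\<close> and \<open>J\<close> as \<open>K \<union> U\<close> and \<open>K \<union> V\<close> with \<open>K = I \<inter> J\<close>; the square
  \<open>1 / (\<Prod>K)\<^sup>2\<close> sums to at most 2, and \<open>D = U \<union> V\<close> can be split in \<open>2 ^ card D\<close> ways.\<close>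
lemma square_sum_prime_sets_le:
  "(\<Sum>I\<in>prime_sets P x. 1 / real (\<Prod>I))\<^sup>2 \<le> 2 * (\<Sum>D\<in>prime_sets P (x\<^sup>2). \<Prod>p\<in>D. 2 / real p)"
proof -
  let ?S = "prime_sets P x" and ?T = "prime_sets P (x\<^sup>2)"
  let ?B = "?S \<times> (SIGMA D:?T. Pow D)"
  have finB: "finite ?B"
    by (intro finite_cartesian_product finite_SigmaI finite_prime_sets) (simp add: prime_sets_def)
  have "(\<Sum>I\<in>?S. 1 / real (\<Prod>I))\<^sup>2 = (\<Sum>z\<in>?S \<times> ?S. 1 / real (\<Prod>(fst z)) * (1 / real (\<Prod>(snd z))))"
    unfolding power2_eq_square sum_product by (simp add: sum.cartesian_product case_prod_unfold)
  also have "\<dots> \<le> (\<Sum>y\<in>?B. 1 / (real (\<Prod>(fst y)))\<^sup>2 * (1 / real (\<Prod>(fst (snd y)))))"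
  proof (rule sum_le_included[where i = "\<lambda>y. (fst y \<union> snd (snd y), fst y \<union> (fst (snd y) - snd (snd y)))"])
    show "\<forall>z\<in>?S \<times> ?S. \<exists>y\<in>?B. (fst y \<union> snd (snd y), fst y \<union> (fst (snd y) - snd (snd y))) = z \<and>
        1 / real (\<Prod>(fst z)) * (1 / real (\<Prod>(snd z))) \<le> 1 / (real (\<Prod>(fst y)))\<^sup>2 * (1 / real (\<Prod>(fst (snd y))))"
    proof
      fix z assume "z \<in> ?S \<times> ?S"
      then obtain I J where z: "z = (I, J)" and I: "I \<in> ?S" and J: "J \<in> ?S" by auto
      have fin: "finite I" "finite J" using I J by (auto simp: prime_sets_def)
      define K D where "K = I \<inter> J" and "D = (I - J) \<union> (J - I)"
      have K: "K \<in> ?S" using I prime_sets_downward by (auto simp: K_def)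
      have prI: "\<Prod>I = \<Prod>K * \<Prod>(I - J)"
        using fin unfolding K_def by (metis Diff_disjoint Int_Diff_Un Int_Diff_disjoint finite_Diff finite_Int prod.union_disjoint)
      have prJ: "\<Prod>J = \<Prod>K * \<Prod>(J - I)"
        using fin unfolding K_def by (metis Int_Diff_Un Int_Diff_disjoint Int_commute finite_Diff finite_Int prod.union_disjoint)
      have prD: "\<Prod>D = \<Prod>(I - J) * \<Prod>(J - I)"
        using fin unfolding D_def by (intro prod.union_disjoint) auto
      have eq: "\<Prod>I * \<Prod>J = (\<Prod>K)\<^sup>2 * \<Prod>D"
        by (simp add: prI prJ prD power2_eq_square)
      have "\<Prod>K \<ge> 1" using K by (intro prod_primes_ge_1) (auto simp: prime_sets_def)
      hence "\<Prod>D \<le> \<Prod>I * \<Prod>J" unfolding eq by simp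
      also have "\<dots> \<le> x * x" using I J by (intro mult_mono) (auto simp: prime_sets_def)
      finally have D: "D \<in> ?T"
        using I J by (auto simp: prime_sets_def D_def power2_eq_square)
      have "1 / real (\<Prod>I) * (1 / real (\<Prod>J)) = 1 / real (\<Prod>I * \<Prod>J)" by simp
      also have "\<dots> = 1 / (real (\<Prod>K))\<^sup>2 * (1 / real (\<Prod>D))" unfolding eq by simp
      finally show "\<exists>y\<in>?B. (fst y \<union> snd (snd y), fst y \<union> (fst (snd y) - snd (snd y))) = z \<and>
        1 / real (\<Prod>(fst z)) * (1 / real (\<Prod>(snd z))) \<le> 1 / (real (\<Prod>(fst y)))\<^sup>2 * (1 / real (\<Prod>(fst (snd y))))"
        using K D by (intro bexI[of _ "(K, D, I - J)"]) (auto simp: z K_def D_def)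
    qed
  qed (use finB in \<open>auto intro!: mult_nonneg_nonneg prod_nonneg\<close>)
  also have "\<dots> = (\<Sum>K\<in>?S. 1 / (real (\<Prod>K))\<^sup>2) * (\<Sum>y\<in>(SIGMA D:?T. Pow D). 1 / real (\<Prod>(fst y)))"
    unfolding sum_product by (simp add: sum.cartesian_product case_prod_unfold)
  also have "(\<Sum>y\<in>(SIGMA D:?T. Pow D). 1 / real (\<Prod>(fst y))) = (\<Sum>D\<in>?T. \<Sum>U\<in>Pow D. 1 / real (\<Prod>D))"
    using finite_prime_sets[of P "x\<^sup>2"] by (subst sum.Sigma) (simp_all add: prime_sets_def case_prod_unfold)
  also have "\<dots> = (\<Sum>D\<in>?T. \<Prod>p\<in>D. 2 / real p)"
    by (intro sum.cong) (auto simp: prime_sets_def card_Pow prod_dividef)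
  also have "(\<Sum>K\<in>?S. 1 / (real (\<Prod>K))\<^sup>2) * (\<Sum>D\<in>?T. \<Prod>p\<in>D. 2 / real p) \<le> 2 * (\<Sum>D\<in>?T. \<Prod>p\<in>D. 2 / real p)"
  proof (rule mult_right_mono[OF sum_recip_prod_squares_le])
    show "?S \<subseteq> {I. finite I \<and> (\<forall>p\<in>I. prime p)}" by (auto simp: prime_sets_def)
  qed (auto intro!: sum_nonneg prod_nonneg)
  finally show ?thesis .
qed

section \<open>Counting integers hit by a pair of shifts\<close>

lemma card_residue_class:
  fixes q N x :: nat
  assumes "q > 0"
  shows "\<bar>real (card {a\<in>{1..N}. [a = x] (mod q)}) - real N / real q\<bar> \<le> 1"
proof -
  \<comment> \<open>The representative is taken in \<open>{1..q}\<close>, not in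
    \<open>{0..<q}\<close>, so that the count over \<open>{1..N}\<close> is exactly
    \<open>(N + (q - c)) div q\<close>.\<close>
  define c where "c = (if x mod q = 0 then q else x mod q)"
  have c: "1 \<le> c" "c \<le> q" "[x = c] (mod q)"
    using assms by (auto simp: c_def cong_def intro: less_imp_le)
  have "card {a\<in>{1..N}. [a = c] (mod q)} = (N + (q - c)) div q"
  proof (induction N)
    case 0
    thus ?case using c by simp
  next
    case (Suc N)
    have "[Suc N = c] (mod q) \<longleftrightarrow> [Suc N + q = c] (mod q)" unfolding cong_def by (metis mod_add_self2)
    also have "\<dots> \<longleftrightarrow> q dvd Suc N + q - c" using c by (intro cong_altdef_nat) linarith
    also have "Suc N + q - c = Suc (N + (q - c))" using c by simp
    finally have iff: "[Suc N = c] (mod q) \<longleftrightarrow> Suc (N + (q - c)) mod q = 0" by (simp add: dvd_eq_mod_eq_0)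
    show ?case
    proof (cases "[Suc N = c] (mod q)")
      case True
      hence "{a\<in>{1..Suc N}. [a = c] (mod q)} = insert (Suc N) {a\<in>{1..N}. [a = c] (mod q)}"
        by (auto simp: le_Suc_eq)
      thus ?thesis using Suc True iff by (simp add: div_Suc)
    next
      case False
      hence "{a\<in>{1..Suc N}. [a = c] (mod q)} = {a\<in>{1..N}. [a = c] (mod q)}"
        by (auto simp: le_Suc_eq)
      thus ?thesis using Suc False iff by (simp add: div_Suc)
    qed
  qed
  moreover have "{a\<in>{1..N}. [a = x] (mod q)} = {a\<in>{1..N}. [a = c] (mod q)}"
    using c(3) by (auto intro: cong_trans cong_sym)
  ultimately have card: "card {a\<in>{1..N}. [a = x] (mod q)} = (N + (q - c)) div q" by simp
  define t where "t = (N + (q - c)) div q"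
  have "t * q \<le> N + (q - c)" unfolding t_def by simp
  hence "t * q \<le> N + q" by linarith
  hence "real t * real q \<le> real N + real q" by (metis of_nat_add of_nat_le_iff of_nat_mult)
  moreover have "N + (q - c) < (t + 1) * q"
    unfolding t_def using assms dividend_less_div_times[of q "N + (q - c)"] by (simp add: algebra_simps)
  hence "N < (t + 1) * q" by linarith
  hence "real N < (real t + 1) * real q" by (metis of_nat_1 of_nat_add of_nat_less_iff of_nat_mult)
  ultimately have "real t \<le> real N / real q + 1" "real N / real q < real t + 1"
    using assms by (simp_all add: field_simps)
  thus ?thesis unfolding card t_def[symmetric] by linarith
qed

text \<open>For \<open>p\<close> not dividing \<open>h\<close> the classes 0 and \<open>-h\<close>
  modulo \<open>p\<close> are distinct. Their combinations form \<open>2 ^ card I\<close> classes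
  modulo the product of \<open>I\<close>, each counted with an error of at most 1.\<close>

lemma card_hits_pair:
  fixes h N :: nat
  assumes fin: "finite I" and pr: "\<And>p. p \<in> I \<Longrightarrow> prime p" and nd: "\<And>p. p \<in> I \<Longrightarrow> \<not> p dvd h"
  shows "\<bar>real (card {a\<in>{1..N}. \<forall>p\<in>I. p dvd a * (a + h)}) - real N * (\<Prod>p\<in>I. 2 / real p)\<bar> \<le> 2 ^ card I"
proof -
  define S where "S = {a\<in>{1..N}. \<forall>p\<in>I. p dvd a * (a + h)}"
  \<comment> \<open>\<open>J\<close> records which primes divide \<open>a\<close>; the remaining
    ones must divide \<open>a + h\<close>. By the Chinese remainder theorem each \<open>B J\<close>
    is a single residue class.\<close>
  define B where "B = (\<lambda>J. {a\<in>S. {p\<in>I. p dvd a} = J})"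
  have S: "S = (\<Union>J\<in>Pow I. B J)"
  proof (intro equalityI subsetI)
    fix a assume "a \<in> S"
    thus "a \<in> (\<Union>J\<in>Pow I. B J)" by (intro UN_I[of "{p\<in>I. p dvd a}"]) (auto simp: B_def)
  qed (auto simp: B_def)
  have "card S = (\<Sum>J\<in>Pow I. card (B J))"
  proof (subst S, rule card_UN_disjoint)
    show "finite (Pow I)" using fin by simp
    show "\<forall>J\<in>Pow I. finite (B J)" by (simp add: B_def S_def)
    show "\<forall>J\<in>Pow I. \<forall>K\<in>Pow I. J \<noteq> K \<longrightarrow> B J \<inter> B K = {}" unfolding B_def by blast
  qed
  hence cardS: "real (card S) = (\<Sum>J\<in>Pow I. real (card (B J)))" by simp
  have B: "\<bar>real (card (B J)) - real N / real (\<Prod>I)\<bar> \<le> 1" if J: "J \<in> Pow I" for J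
  proof -
    have cop: "\<forall>p\<in>I. \<forall>q\<in>I. p \<noteq> q \<longrightarrow> coprime p q" using pr primes_coprime by blast
    obtain x where x: "\<forall>p\<in>I. [x = (if p \<in> J then 0 else p - h mod p)] (mod p)"
      using chinese_remainder_nat[OF fin, of "\<lambda>p. p" "\<lambda>p. if p \<in> J then 0 else p - h mod p"] cop by blast
    have dvd1: "p dvd a + h \<longleftrightarrow> [a = p - h mod p] (mod p)" if "p \<in> I" for p a
    proof -
      have "p > 0" using pr[OF that] prime_gt_0_nat by blast
      hence "h mod p \<le> p" by (simp add: less_imp_le)
      have "[a = p - h mod p] (mod p) \<longleftrightarrow> [a + h mod p = (p - h mod p) + h mod p] (mod p)"
        by (simp only: cong_add_rcancel_nat)
      also have "(p - h mod p) + h mod p = p" using \<open>h mod p \<le> p\<close> by simp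
      also have "[a + h mod p = p] (mod p) \<longleftrightarrow> p dvd a + h" by (simp add: cong_def dvd_eq_mod_eq_0 mod_add_right_eq)
      finally show ?thesis by simp
    qed
    have "B J = {a\<in>{1..N}. [a = x] (mod \<Prod>I)}"
    proof (intro equalityI subsetI)
      fix a assume a: "a \<in> B J"
      have "[a = x] (mod p)" if p: "p \<in> I" for p
      proof (cases "p \<in> J")
        case True
        hence "p dvd a" using a unfolding B_def by blast
        hence "[a = 0] (mod p)" by (simp add: cong_0_iff)
        moreover have "[x = 0] (mod p)" using bspec[OF x p] True by simp
        ultimately show ?thesis using cong_sym cong_trans by blast
      next
        case False
        hence "\<not> p dvd a" using a p unfolding B_def by blast
        moreover have "p dvd a * (a + h)" using a p unfolding B_def S_def by blast
        ultimately have "p dvd a + h" using pr[OF p] prime_dvd_mult_iff by blast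
        hence "[a = p - h mod p] (mod p)" using dvd1[OF p] by blast
        moreover have "[x = p - h mod p] (mod p)" using bspec[OF x p] False by simp
        ultimately show ?thesis using cong_sym cong_trans by blast
      qed
      hence "[a = x] (mod \<Prod>I)" using cop cong_cong_prod_coprime_nat[of I a x "\<lambda>p. p"] by blast
      thus "a \<in> {a\<in>{1..N}. [a = x] (mod \<Prod>I)}" using a by (auto simp: B_def S_def)
    next
      fix a assume a: "a \<in> {a\<in>{1..N}. [a = x] (mod \<Prod>I)}"
      have ax: "[a = (if p \<in> J then 0 else p - h mod p)] (mod p)" if p: "p \<in> I" for p
      proof -
        have "p dvd \<Prod>I" using dvd_prodI[OF fin p, of "\<lambda>x. x"] by simp
        hence "[a = x] (mod p)" using a cong_dvd_modulus_nat by blast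
        thus ?thesis using bspec[OF x p] cong_trans by blast
      qed
      have 1: "p dvd a" if "p \<in> J" for p using ax[of p] that J by (auto simp: cong_0_iff)
      have 2: "p dvd a + h" if "p \<in> I - J" for p using ax[of p] dvd1[of p a] that by auto
      have 3: "\<not> p dvd a" if "p \<in> I - J" for p
        using 2[OF that] nd[of p] that by (auto simp: dvd_add_right_iff)
      have "p dvd a * (a + h)" if "p \<in> I" for p using 1 2 that by (cases "p \<in> J") auto
      hence "a \<in> S" using a unfolding S_def by auto
      thus "a \<in> B J" using 1 3 J by (auto simp: B_def)
    qed
    moreover have "\<Prod>I > 0" using pr prod_primes_ge_1[of I] by (auto simp: Suc_le_eq)
    ultimately show ?thesis using card_residue_class[of "\<Prod>I" N x] by simp
  qed
  have "real N * (\<Prod>p\<in>I. 2 / real p) = (\<Sum>J\<in>Pow I. real N / real (\<Prod>I))"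
    using fin by (simp add: prod_dividef card_Pow)
  hence "real (card S) - real N * (\<Prod>p\<in>I. 2 / real p) = (\<Sum>J\<in>Pow I. real (card (B J)) - real N / real (\<Prod>I))"
    by (simp add: cardS sum_subtractf)
  also have "\<bar>\<dots>\<bar> \<le> (\<Sum>J\<in>Pow I. 1)" by (rule order_trans[OF sum_abs sum_mono]) (use B in auto)
  finally show ?thesis using fin by (simp add: S_def card_Pow)
qed

section \<open>Mertens' theorem modulo 4\<close>

lemma sum_divisors_swap:
  fixes f :: "nat \<Rightarrow> nat \<Rightarrow> real"
  shows "(\<Sum>n=1..N. \<Sum>d | d dvd n. f d (n div d)) = (\<Sum>d=1..N. \<Sum>m=1..N div d. f d m)"
proof -
  have "(\<Sum>n=1..N. \<Sum>d | d dvd n. f d (n div d)) = (\<Sum>(n, d)\<in>(SIGMA n:{1..N}. {d. d dvd n}). f d (n div d))"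
    by (intro sum.Sigma) auto
  also have "\<dots> = (\<Sum>(d, m)\<in>(SIGMA d:{1..N}. {1..N div d}). f d m)"
  proof (rule sum.reindex_bij_witness[of _ "\<lambda>(d, m). (d * m, d)" "\<lambda>(n, d). (d, n div d)"])
    fix z assume "z \<in> (SIGMA n:{1..N}. {d. d dvd n})"
    then obtain n d where z: "z = (n, d)" "1 \<le> n" "n \<le> N" "d dvd n" by auto
    then obtain m where m: "n = d * m" by auto
    have "d > 0" "m > 0" using z m by (auto intro!: Nat.gr0I)
    moreover have "m \<le> N div d" using z m \<open>d > 0\<close> by (simp add: less_eq_div_iff_mult_less_eq mult.commute)
    moreover have "d \<le> N" using z m \<open>m > 0\<close> by (metis dvd_imp_le le_trans z(4) less_le_trans zero_less_one)
    ultimately show "(case case z of (n, d) \<Rightarrow> (d, n div d) of (d, m) \<Rightarrow> (d * m, d)) = z"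
      "(case z of (n, d) \<Rightarrow> (d, n div d)) \<in> (SIGMA d:{1..N}. {1..N div d})"
      "(case case z of (n, d) \<Rightarrow> (d, n div d) of (d, m) \<Rightarrow> f d m) = (case z of (n, d) \<Rightarrow> f d (n div d))"
      by (auto simp: z m)
  next
    fix y assume "y \<in> (SIGMA d:{1..N}. {1..N div d})"
    then obtain d m where y: "y = (d, m)" "1 \<le> d" "d \<le> N" "1 \<le> m" "m \<le> N div d" by auto
    hence "d * m \<le> N" by (simp add: less_eq_div_iff_mult_less_eq mult.commute)
    thus "(case case y of (d, m) \<Rightarrow> (d * m, d) of (n, d) \<Rightarrow> (d, n div d)) = y"
      "(case y of (d, m) \<Rightarrow> (d * m, d)) \<in> (SIGMA n:{1..N}. {d. d dvd n})"
      using y by auto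
  qed
  also have "\<dots> = (\<Sum>d=1..N. \<Sum>m=1..N div d. f d m)"
    by (rule sum.Sigma[symmetric]) auto
  finally show ?thesis .
qed

text \<open>The left side is the logarithm of \<open>N\<close> factorial, and \<open>N div d\<close>
  counts the multiples of \<open>d\<close>: Legendre's formula.\<close>

lemma sum_ln_eq_mangoldt:
  "(\<Sum>n=1..N. ln (real n)) = (\<Sum>d=1..N. mangoldt d * real (N div d))"
proof -
  have "(\<Sum>n=1..N. ln (real n)) = (\<Sum>n=1..N. \<Sum>d | d dvd n. mangoldt d)"
    using mangoldt_sum[where ?'a = real] by (intro sum.cong) auto
  also have "\<dots> = (\<Sum>d=1..N. \<Sum>m=1..N div d. mangoldt d)"
    by (rule sum_divisors_swap)
  finally show ?thesis by (simp add: mult.commute)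
qed

lemma sum_ln_bounds:
  "(\<Sum>n=1..N. ln (real n)) \<ge> real N * ln (real N) - real N"
  "(\<Sum>n=1..N. ln (real n)) \<le> real N * ln (real N)"
proof -
  show "(\<Sum>n=1..N. ln (real n)) \<ge> real N * ln (real N) - real N"
  proof (induction N)
    case (Suc N)
    have "real N * (ln (real (Suc N)) - ln (real N)) \<le> 1"
    proof (cases "N = 0")
      case False
      have "ln (real (Suc N)) - ln (real N) = ln (1 + 1 / real N)"
      proof -
        have "1 + 1 / real N = real (Suc N) / real N" using False by (simp add: field_simps)
        thus ?thesis using False by (simp add: ln_div)
      qed
      also have "\<dots> \<le> 1 / real N" by (intro ln_add_one_self_le_self) auto
      finally show ?thesis using False by (simp add: field_simps)
    qed simp
    with Suc show ?case by (simp add: algebra_simps)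
  qed simp
  have "(\<Sum>n=1..N. ln (real n)) \<le> (\<Sum>n=1..N. ln (real N))"
    by (intro sum_mono) auto
  thus "(\<Sum>n=1..N. ln (real n)) \<le> real N * ln (real N)" by simp
qed

text \<open>The left side is the logarithm of the central binomial coefficient of
  \<open>2 * N\<close>, which grows by a factor of at most 4 per step; \<open>ln 2 \<le> 1\<close>
  rounds the constant.\<close>

lemma sum_ln_double_le:
  "(\<Sum>n=1..2*N. ln (real n)) - 2 * (\<Sum>n=1..N. ln (real n)) \<le> 2 * real N"
proof (induction N)
  case (Suc N)
  have "ln (2 * real N + 1) \<le> ln (2 * (real N + 1))" by simp
  also have e: "ln (2 * (real N + 1)) = ln 2 + ln (real N + 1)"
    using ln_mult[of 2 "real N + 1"] by simp
  finally have "ln (1 + real N * 2) \<le> ln 2 + ln (1 + real N)" by (simp add: algebra_simps)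
  moreover have "ln (2 + real N * 2) = ln 2 + ln (1 + real N)" using e by (simp add: algebra_simps)
  moreover have "ln (2::real) \<le> 1" using ln_le_minus_one[of 2] by simp
  moreover have "{1..2 * Suc N} = insert (2 * N + 2) (insert (2 * N + 1) {1..2 * N})" by auto
  ultimately show ?case using Suc by (simp add: algebra_simps)
qed simp

section \<open>Chebyshev's upper bound and Mertens' first theorem\<close>

definition chebyshev_psi :: "nat \<Rightarrow> real" where
  "chebyshev_psi N = (\<Sum>d=1..N. mangoldt d)"

text \<open>Chebyshev's argument: \<open>2 * N div d - 2 * (N div d)\<close> is never negative and
  equals 1 for \<open>N < d \<le> 2 * N\<close>, so the central binomial coefficient controls the
  increment.\<close>

lemma chebyshev_psi_double: "chebyshev_psi (2 * N) \<le> chebyshev_psi N + 2 * real N"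
proof -
  have "chebyshev_psi (2 * N) - chebyshev_psi N = (\<Sum>d\<in>{N<..2*N}. mangoldt d)"
  proof -
    have "{1..2*N} = {1..N} \<union> {N<..2*N}" by auto
    hence "chebyshev_psi (2 * N) = chebyshev_psi N + (\<Sum>d\<in>{N<..2*N}. mangoldt d)"
      unfolding chebyshev_psi_def by (simp add: sum.union_disjoint ivl_disj_int)
    thus ?thesis by simp
  qed
  also have "\<dots> \<le> (\<Sum>d=1..2*N. mangoldt d * (real (2 * N div d) - 2 * real (N div d)))"
  proof -
    have nn: "real (2 * N div d) - 2 * real (N div d) \<ge> 0" for d
    proof -
      have "2 * (N div d) \<le> 2 * N div d"
        by (cases "d = 0") (auto simp: less_eq_div_iff_mult_less_eq)
      thus ?thesis by linarith
    qed
    have "(\<Sum>d\<in>{N<..2*N}. mangoldt d) = (\<Sum>d\<in>{N<..2*N}. mangoldt d * (real (2 * N div d) - 2 * real (N div d)))"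
    proof (intro sum.cong refl)
      fix d assume d: "d \<in> {N<..2*N}"
      hence "2 * N div d = 1" by (intro div_nat_eqI) auto
      thus "mangoldt d = mangoldt d * (real (2 * N div d) - 2 * real (N div d))" using d by simp
    qed
    also have "\<dots> \<le> (\<Sum>d=1..2*N. mangoldt d * (real (2 * N div d) - 2 * real (N div d)))"
      by (intro sum_mono2) (auto intro!: mult_nonneg_nonneg mangoldt_nonneg nn)
    finally show ?thesis .
  qed
  also have "\<dots> = (\<Sum>d=1..2*N. mangoldt d * real (2 * N div d)) - 2 * (\<Sum>d=1..2*N. mangoldt d * real (N div d))"
    by (simp add: algebra_simps sum_subtractf sum_distrib_left)
  also have "(\<Sum>d=1..2*N. mangoldt d * real (N div d)) = (\<Sum>d=1..N. mangoldt d * real (N div d))"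
    by (intro sum.mono_neutral_right) auto
  also have "(\<Sum>d=1..2*N. mangoldt d * real (2 * N div d)) - 2 * (\<Sum>d=1..N. mangoldt d * real (N div d)) \<le> 2 * real N"
    using sum_ln_double_le[of N] by (simp only: sum_ln_eq_mangoldt)
  finally show ?thesis by simp
qed

text \<open>Repeated halving. With \<open>k = N div 2\<close> a bound with factor \<open>C\<close>
  at \<open>k\<close> gives \<open>C * k + 2 * k + N\<close> at \<open>N\<close>, which is at most
  \<open>C * N\<close> from \<open>C = 4\<close> on.\<close>

lemma chebyshev_psi_le: "chebyshev_psi N \<le> 4 * real N"
proof (induction N rule: less_induct)
  case (less N)
  show ?case
  proof (cases "N = 0")
    case False
    define k where "k = N div 2"
    have k: "k < N" "N = 2 * k \<or> N = Suc (2 * k)" using False unfolding k_def by (simp, presburger)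
    have "chebyshev_psi N \<le> chebyshev_psi (2 * k) + real N"
    proof -
      have "mangoldt N \<le> real N"
        using mangoldt_le[of N] ln_le_minus_one[of "real N"] False by simp
      thus ?thesis using k(2) by (auto simp: chebyshev_psi_def)
    qed
    also have "\<dots> \<le> chebyshev_psi k + 2 * real k + real N" using chebyshev_psi_double[of k] by simp
    also have "\<dots> \<le> 6 * real k + real N" using less[OF k(1)] by simp
    also have "\<dots> \<le> 4 * real N" using k(2) by auto
    finally show ?thesis .
  qed (simp add: chebyshev_psi_def)
qed

lemma div_real_bounds:
  fixes N d :: nat
  assumes "d > 0"
  shows "real (N div d) \<le> real N / real d" "real N / real d - 1 \<le> real (N div d)"
proof -
  show "real (N div d) \<le> real N / real d" by (rule of_nat_div_le_of_nat)
  have "N < (N div d + 1) * d" using assms dividend_less_div_times[of d N] by (simp add: algebra_simps)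
  hence "real N < (real (N div d) + 1) * real d" by (metis of_nat_1 of_nat_add of_nat_less_iff of_nat_mult)
  hence "real N / real d < real (N div d) + 1" using assms by (simp add: field_simps)
  thus "real N / real d - 1 \<le> real (N div d)" by simp
qed

text \<open>Replacing \<open>N div d\<close> by \<open>N / d\<close> in Legendre's formula changes
  the sum by at most \<open>chebyshev_psi N\<close>, hence by \<open>O(N)\<close>; then everything
  is divided by \<open>N\<close>.\<close>

lemma mertens_mangoldt:
  assumes "N \<ge> 1"
  shows "\<bar>(\<Sum>d=1..N. mangoldt d / real d) - ln (real N)\<bar> \<le> 4"
proof -
  define S where "S = (\<Sum>d=1..N. mangoldt d / real d)"
  have eq: "real N * S = (\<Sum>d=1..N. mangoldt d * (real N / real d))"
    by (simp add: S_def sum_distrib_left algebra_simps)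
  have "(\<Sum>d=1..N. mangoldt d * real (N div d)) \<le> real N * S"
    unfolding eq by (intro sum_mono mult_left_mono div_real_bounds mangoldt_nonneg) auto
  hence "real N * ln (real N) - real N \<le> real N * S"
    using sum_ln_bounds(1)[of N] sum_ln_eq_mangoldt[of N] by linarith
  hence "real N * (ln (real N) - 1) \<le> real N * S" by (simp add: algebra_simps)
  hence 1: "ln (real N) - 1 \<le> S" using assms by simp
  have "real N * S - chebyshev_psi N = (\<Sum>d=1..N. mangoldt d * (real N / real d - 1))"
    unfolding eq chebyshev_psi_def by (simp add: algebra_simps sum_subtractf)
  also have "\<dots> \<le> (\<Sum>d=1..N. mangoldt d * real (N div d))"
    by (intro sum_mono mult_left_mono div_real_bounds mangoldt_nonneg) auto
  also have "\<dots> \<le> real N * ln (real N)" using sum_ln_bounds(2)[of N] sum_ln_eq_mangoldt[of N] by linarith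
  finally have "real N * S \<le> real N * (ln (real N) + 4)"
    using chebyshev_psi_le[of N] by (simp add: algebra_simps)
  hence 2: "S \<le> ln (real N) + 4" using assms by simp
  show ?thesis using 1 2 unfolding S_def[symmetric] by linarith
qed

section \<open>Summation by parts and the character modulo 4\<close>

lemma sum_by_parts:
  fixes u f :: "nat \<Rightarrow> real"
  assumes "a \<le> b"
  shows "(\<Sum>n=a..b. u n * f n) =
    (\<Sum>n=a..b. u n) * f b + (\<Sum>k=a..<b. (\<Sum>n=a..k. u n) * (f k - f (Suc k)))"
  using assms
proof (induction b rule: dec_induct)
  case (step b)
  thus ?case by (simp add: algebra_simps)
qed simp

lemma sum_by_parts_bound:
  fixes u f :: "nat \<Rightarrow> real"
  assumes u: "\<And>k. k \<ge> a \<Longrightarrow> \<bar>\<Sum>n=a..k. u n\<bar> \<le> B"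
    and dec: "\<And>k. k \<ge> a \<Longrightarrow> f (Suc k) \<le> f k" and nonneg: "\<And>k. k \<ge> a \<Longrightarrow> 0 \<le> f k"
  shows "\<bar>\<Sum>n=a..b. u n * f n\<bar> \<le> B * f a"
proof (cases "a \<le> b")
  case True
  have "\<bar>\<Sum>n=a..b. u n * f n\<bar> \<le> \<bar>(\<Sum>n=a..b. u n) * f b\<bar> + \<bar>\<Sum>k=a..<b. (\<Sum>n=a..k. u n) * (f k - f (Suc k))\<bar>"
    unfolding sum_by_parts[OF True] by (rule abs_triangle_ineq)
  also have "\<bar>(\<Sum>n=a..b. u n) * f b\<bar> \<le> B * f b"
    using u[OF True] nonneg[OF True] by (simp add: abs_mult mult_right_mono)
  also have "\<bar>\<Sum>k=a..<b. (\<Sum>n=a..k. u n) * (f k - f (Suc k))\<bar> \<le> (\<Sum>k=a..<b. B * (f k - f (Suc k)))"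
    using u dec by (intro order_trans[OF sum_abs] sum_mono) (auto simp: abs_mult intro!: mult_right_mono)
  also have "\<dots> = B * (f a - f b)"
    using sum_Suc_diff'[OF True, of f] by (simp add: sum_distrib_left[symmetric] sum_subtractf)
  finally show ?thesis by (simp add: algebra_simps)
next
  case False
  have "B \<ge> 0" using u[of a] by (metis abs_ge_zero order_refl order_trans)
  thus ?thesis using False nonneg[of a] by simp
qed

text \<open>The non-principal Dirichlet character modulo 4.\<close>

definition chi4 :: "nat \<Rightarrow> real" where
  "chi4 n = (if n mod 4 = 1 then 1 else if n mod 4 = 3 then -1 else 0)"

lemma nat_mod_4_cases: "(n::nat) mod 4 = 0 \<or> n mod 4 = 1 \<or> n mod 4 = 2 \<or> n mod 4 = 3"
  by presburger

lemma chi4_mult: "chi4 (m * n) = chi4 m * chi4 n"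
  using nat_mod_4_cases[of m] nat_mod_4_cases[of n] mod_mult_eq[of m 4 n]
  by (elim disjE) (simp_all add: chi4_def)

lemma abs_chi4_le: "\<bar>chi4 n\<bar> \<le> 1"
  by (simp add: chi4_def)

lemma abs_sum_chi4_le:
  assumes "1 \<le> a" "a \<le> k"
  shows "\<bar>\<Sum>n=a..k. chi4 n\<bar> \<le> 1"
proof -
  \<comment> \<open>\<open>c k\<close> is the sum of \<open>chi4\<close> over \<open>1..k\<close>.
    As it only takes the values 0 and 1, differences stay within 1.\<close>
  define c where "c = (\<lambda>k::nat. if k mod 4 = 1 \<or> k mod 4 = 2 then 1 else 0 :: real)"
  have step: "chi4 (Suc k) = c (Suc k) - c k" for k
    using nat_mod_4_cases[of k] by (elim disjE) (simp_all add: chi4_def c_def mod_Suc)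
  have "(\<Sum>n=a..k. chi4 n) = c k - c (a - 1)"
    using assms(2)
  proof (induction k rule: dec_induct)
    case base
    show ?case using step[of "a - 1"] assms(1) by simp
  next
    case (step k)
    thus ?case using \<open>\<And>k. chi4 (Suc k) = c (Suc k) - c k\<close>[of k] by simp
  qed
  thus ?thesis by (simp add: c_def)
qed

lemma chi4_sum_bound:
  assumes "1 \<le> a" "\<And>k. k \<ge> a \<Longrightarrow> f (Suc k) \<le> f k" "\<And>k. k \<ge> a \<Longrightarrow> 0 \<le> f k"
  shows "\<bar>\<Sum>n=a..b. chi4 n * f n\<bar> \<le> f a"
  using sum_by_parts_bound[of a chi4 1 f b] abs_sum_chi4_le assms by auto

text \<open>Twisting \<open>ln n\<close> as a divisor sum of \<open>mangoldt\<close> by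
  \<open>chi4\<close> writes a bounded logarithmic sum as nearly \<open>l * T\<close>, with
  \<open>l\<close> the truncated L-series at 1. Since \<open>l\<close> stays away from 0,
  \<open>T\<close> is bounded.\<close>

lemma abs_sum_chi4_mangoldt_le: "\<bar>\<Sum>d=1..N. chi4 d * mangoldt d / real d\<bar> \<le> 8"
proof (cases "N = 0")
  case False
  define l where "l = (\<Sum>m=1..N. chi4 m * (1 / real m))"
  define T where "T = (\<Sum>d=1..N. chi4 d * mangoldt d / real d)"
  have tail: "\<bar>\<Sum>m=a..b. chi4 m * (1 / real m)\<bar> \<le> 1 / real a" if "a \<ge> 1" for a b
    using that by (intro chi4_sum_bound) (auto simp: field_simps)
  \<comment> \<open>Nonvanishing of the L-series at 1 in explicit form: after the term 1, all terms
    from \<open>m = 3\<close> on together have absolute value at most \<open>1 / 3\<close>.\<close>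
  have l: "l \<ge> 2 / 3"
  proof (cases "N \<ge> 3")
    case True
    have "{1..N} = insert 1 (insert 2 {3..N})" using True by auto
    hence "l = 1 + (\<Sum>m=3..N. chi4 m * (1 / real m))" by (simp add: l_def chi4_def)
    thus ?thesis using tail[of 3 N] by simp
  next
    case F: False
    hence "N = 1 \<or> N = 2" using False by auto
    moreover have "{1..2::nat} = {1, 2}" by auto
    ultimately show ?thesis by (auto simp: l_def chi4_def)
  qed
  have "(\<Sum>n=1..N. chi4 n * (ln (real n) / real n)) =
      (\<Sum>n=1..N. \<Sum>d | d dvd n. chi4 d * mangoldt d / real d * (chi4 (n div d) * (1 / real (n div d))))"
  proof (intro sum.cong refl)
    fix n assume n: "n \<in> {1..N}"
    have "chi4 n * (ln (real n) / real n) = (\<Sum>d | d dvd n. chi4 n / real n * mangoldt d)"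
      unfolding sum_distrib_left[symmetric] using mangoldt_sum[of n, where ?'a = real] n by simp
    also have "\<dots> = (\<Sum>d | d dvd n. chi4 d * mangoldt d / real d * (chi4 (n div d) * (1 / real (n div d))))"
    proof (intro sum.cong refl)
      fix d assume "d \<in> {d. d dvd n}"
      then obtain m where m: "n = d * m" by auto
      hence "d > 0" using n by (auto intro!: Nat.gr0I)
      thus "chi4 n / real n * mangoldt d = chi4 d * mangoldt d / real d * (chi4 (n div d) * (1 / real (n div d)))"
        by (simp add: m chi4_mult)
    qed
    finally show "chi4 n * (ln (real n) / real n) =
      (\<Sum>d | d dvd n. chi4 d * mangoldt d / real d * (chi4 (n div d) * (1 / real (n div d))))" .
  qed
  also have "\<dots> = (\<Sum>d=1..N. \<Sum>m=1..N div d. chi4 d * mangoldt d / real d * (chi4 m * (1 / real m)))"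
    by (rule sum_divisors_swap)
  also have "\<dots> = (\<Sum>d=1..N. chi4 d * mangoldt d / real d * (\<Sum>m=1..N div d. chi4 m * (1 / real m)))"
    by (simp add: sum_distrib_left)
  finally have eq: "(\<Sum>n=1..N. chi4 n * (ln (real n) / real n)) = \<dots>" .
  have "l * T - (\<Sum>n=1..N. chi4 n * (ln (real n) / real n)) =
      (\<Sum>d=1..N. chi4 d * mangoldt d / real d * (l - (\<Sum>m=1..N div d. chi4 m * (1 / real m))))"
    unfolding eq T_def by (simp add: right_diff_distrib sum_subtractf sum_distrib_left mult.commute)
  \<comment> \<open>Completing the inner sum up to \<open>N\<close> costs at most the reciprocal of
    the first missing index, \<open>1 / (N div d + 1) \<le> d / N\<close>. This cancels
    \<open>1 / d\<close>, and Chebyshev's bound remains.\<close>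
  also have "\<bar>\<dots>\<bar> \<le> (\<Sum>d=1..N. mangoldt d / real N)"
  proof (rule order_trans[OF sum_abs sum_mono])
    fix d assume d: "d \<in> {1..N}"
    have "{1..N} = {1..q} \<union> {q + 1..N}" if "q \<le> N" for q using that by auto
    from this[OF div_le_dividend] have "{1..N} = {1..N div d} \<union> {N div d + 1..N}" .
    hence "l = (\<Sum>m=1..N div d. chi4 m * (1 / real m)) + (\<Sum>m=N div d + 1..N. chi4 m * (1 / real m))"
      unfolding l_def by (simp add: sum.union_disjoint)
    hence "\<bar>l - (\<Sum>m=1..N div d. chi4 m * (1 / real m))\<bar> \<le> 1 / real (N div d + 1)"
      using tail[of "N div d + 1" N] by simp
    also have "\<dots> \<le> 1 / (real N / real d)"
      using div_real_bounds(2)[of d N] d False by (intro divide_left_mono) auto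
    also have "\<dots> = real d / real N" by simp
    finally have le: "\<bar>l - (\<Sum>m=1..N div d. chi4 m * (1 / real m))\<bar> \<le> real d / real N" .
    have "\<bar>chi4 d * mangoldt d / real d\<bar> \<le> mangoldt d / real d"
      using abs_chi4_le[of d] mangoldt_nonneg[of d]
      by (simp add: abs_mult divide_right_mono mult_left_le_one_le)
    hence "\<bar>chi4 d * mangoldt d / real d\<bar> * \<bar>l - (\<Sum>m=1..N div d. chi4 m * (1 / real m))\<bar> \<le>
       mangoldt d / real d * (real d / real N)"
      using le by (intro mult_mono) (auto simp: mangoldt_nonneg)
    thus "\<bar>chi4 d * mangoldt d / real d * (l - (\<Sum>m=1..N div d. chi4 m * (1 / real m)))\<bar> \<le> mangoldt d / real N"
      using d by (simp add: abs_mult)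
  qed
  also have "\<dots> = chebyshev_psi N / real N" by (simp add: chebyshev_psi_def sum_divide_distrib)
  also have "\<dots> \<le> 4" using chebyshev_psi_le[of N] False by (simp add: field_simps)
  finally have d4: "\<bar>l * T - (\<Sum>n=1..N. chi4 n * (ln (real n) / real n))\<bar> \<le> 4" .
  have "\<bar>\<Sum>n=1..N. chi4 n * (ln (real n) / real n)\<bar> \<le> 1"
  proof -
    \<comment> \<open>\<open>ln x / x\<close> decreases only from \<open>exp 1\<close> on; the terms
      before 3 vanish, since \<open>ln 1 = 0\<close> and \<open>chi4 2 = 0\<close>.\<close>
    have "(\<Sum>n=1..N. chi4 n * (ln (real n) / real n)) = (\<Sum>n=3..N. chi4 n * (ln (real n) / real n))"
    proof (rule sum.mono_neutral_right)
      have "n = 1 \<or> n = 2" if "n \<in> {1..N} - {3..N}" for n using that by auto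
      thus "\<forall>n\<in>{1..N} - {3..N}. chi4 n * (ln (real n) / real n) = 0" by (auto simp: chi4_def)
    qed auto
    also have "\<bar>\<dots>\<bar> \<le> ln (real 3) / real 3"
    proof (rule chi4_sum_bound)
      fix k :: nat assume k: "3 \<le> k"
      have "exp 1 \<le> real k" using k exp_le by linarith
      thus "ln (real (Suc k)) / real (Suc k) \<le> ln (real k) / real k"
        by (intro ln_x_over_x_mono) auto
    qed auto
    also have "\<dots> \<le> 1" using ln_le_minus_one[of 3] by simp
    finally show ?thesis .
  qed
  with d4 have "\<bar>l * T\<bar> \<le> 5" by linarith
  hence "l * \<bar>T\<bar> \<le> 5" using l by (simp add: abs_mult)
  \<comment> \<open>5 is the 4 from completing the inner sums plus 1 from the logarithmic sum, and
    \<open>5 / (2 / 3) = 7.5\<close>.\<close>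
  moreover have "2 / 3 * \<bar>T\<bar> \<le> l * \<bar>T\<bar>" using l by (intro mult_right_mono) auto
  ultimately show ?thesis unfolding T_def[symmetric] by linarith
qed simp

text \<open>For the powers \<open>p ^ k\<close> with \<open>k \<ge> 2\<close> a geometric series
  leaves at most \<open>2 * ln p / p\<^sup>2\<close>, and \<open>ln p \<le> 2 * sqrt p\<close> turns
  this into a summable power of \<open>p\<close>.\<close>

lemma sum_nonprime_mangoldt_bounded:
  obtains C where "C \<ge> 0" "\<And>N. (\<Sum>n | n \<in> {1..N} \<and> \<not> prime n. mangoldt n / real n) \<le> C"
proof
  define f where "f = (\<lambda>n. real n powr (-3/2))"
  have sf: "summable f" unfolding f_def by (simp add: summable_real_powr_iff)
  show "4 * suminf f \<ge> 0" using sf by (intro mult_nonneg_nonneg suminf_nonneg) (auto simp: f_def)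
  fix N :: nat
  let ?S = "{p. prime p \<and> p \<le> N} \<times> {2..<N + 2}"
  have fin: "finite {p. prime p \<and> p \<le> N}" by (rule finite_subset[of _ "{..N}"]) auto
  have "(\<Sum>n | n \<in> {1..N} \<and> \<not> prime n. mangoldt n / real n) =
        (\<Sum>n | n \<in> {1..N} \<and> \<not> prime n \<and> primepow n. mangoldt n / real n)"
    by (intro sum.mono_neutral_right) (auto simp: mangoldt_def)
  also have "\<dots> \<le> (\<Sum>z\<in>?S. ln (real (fst z)) * (1 / real (fst z)) ^ snd z)"
  proof (rule sum_le_included[where i = "\<lambda>z. fst z ^ snd z"])
    show "\<forall>n\<in>{n. n \<in> {1..N} \<and> \<not> prime n \<and> primepow n}. \<exists>z\<in>?S. fst z ^ snd z = n \<and>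
        mangoldt n / real n \<le> ln (real (fst z)) * (1 / real (fst z)) ^ snd z"
    proof
      fix n assume n: "n \<in> {n. n \<in> {1..N} \<and> \<not> prime n \<and> primepow n}"
      then obtain p k where pk: "prime p" "k > 0" "n = p ^ k" by (auto simp: primepow_def)
      have "k \<noteq> 1" using n pk by auto
      moreover have "k < n" using pk prime_gt_1_nat[of p] power_gt_expt[of p k] by auto
      moreover have "p dvd n" using pk by (auto intro: dvd_power)
      hence "p \<le> n" using n by (auto dest: dvd_imp_le)
      ultimately show "\<exists>z\<in>?S. fst z ^ snd z = n \<and>
        mangoldt n / real n \<le> ln (real (fst z)) * (1 / real (fst z)) ^ snd z"
        using n pk by (intro bexI[of _ "(p, k)"]) (auto simp: mangoldt_primepow power_one_over divide_simps)
    qed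
  next
    show "\<forall>z\<in>?S. 0 \<le> ln (real (fst z)) * (1 / real (fst z)) ^ snd z"
      using prime_ge_1_nat by auto
  qed (use fin in auto)
  also have "\<dots> = (\<Sum>p | prime p \<and> p \<le> N. \<Sum>k=2..<N+2. ln (real p) * (1 / real p) ^ k)"
    by (simp only: sum.cartesian_product case_prod_unfold)
  also have "\<dots> \<le> (\<Sum>p | prime p \<and> p \<le> N. 4 * f p)"
  proof (intro sum_mono)
    fix p assume p: "p \<in> {p. prime p \<and> p \<le> N}"
    define x where "x = 1 / real p"
    have p2: "real p \<ge> 2" using p prime_ge_2_nat[of p] by auto
    have x: "0 < x" "x \<le> 1 / 2" using p2 by (auto simp: x_def field_simps)
    have eq: "(\<Sum>k=2..<N+2. x ^ k) = x\<^sup>2 * (\<Sum>k<N. x ^ k)"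
    proof -
      have "(\<Sum>k=0+2..<N+2. x ^ k) = (\<Sum>k=0..<N. x ^ (k + 2))"
        by (rule sum.shift_bounds_nat_ivl)
      hence "(\<Sum>k=2..<N+2. x ^ k) = (\<Sum>k<N. x ^ (k + 2))"
        by (simp only: add_0 atLeast0LessThan)
      also have "\<dots> = x\<^sup>2 * (\<Sum>k<N. x ^ k)"
        by (subst sum_distrib_left) (simp add: power_add power2_eq_square mult_ac)
      finally show ?thesis .
    qed
    have "(\<Sum>k<N. x ^ k) \<le> 2"
    proof -
      have "(1 - x) * (\<Sum>k<N. x ^ k) = 1 - x ^ N" by (rule one_diff_power_eq[symmetric])
      also have "\<dots> \<le> 1" using x by simp
      finally have "(1 - x) * (\<Sum>k<N. x ^ k) \<le> 1" .
      moreover have "1 / 2 * (\<Sum>k<N. x ^ k) \<le> (1 - x) * (\<Sum>k<N. x ^ k)"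
        using x by (intro mult_right_mono sum_nonneg) auto
      ultimately show ?thesis by simp
    qed
    hence "x\<^sup>2 * (\<Sum>k<N. x ^ k) \<le> x\<^sup>2 * 2" by (intro mult_left_mono) auto
    hence geo: "(\<Sum>k=2..<N+2. x ^ k) \<le> 2 * x\<^sup>2" unfolding eq by (simp only: mult.commute)
    have "ln (real p) = 2 * ln (real p powr (1/2))" using p2 by (simp add: ln_powr)
    also have "\<dots> \<le> 2 * real p powr (1/2)"
      using p2 ln_le_minus_one[of "real p powr (1/2)"] by simp
    finally have ln: "ln (real p) \<le> 2 * real p powr (1/2)" .
    have "(\<Sum>k=2..<N+2. ln (real p) * (1 / real p) ^ k) = ln (real p) * (\<Sum>k=2..<N+2. x ^ k)"
      by (simp only: sum_distrib_left x_def)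
    also have "\<dots> \<le> 2 * real p powr (1/2) * (2 * x\<^sup>2)"
      using geo ln x by (intro mult_mono sum_nonneg) auto
    also have "x\<^sup>2 = real p powr (-2)" using p2 by (simp add: x_def powr_minus_divide power_one_over powr_numeral)
    also have "2 * real p powr (1/2) * (2 * real p powr (-2)) = 4 * f p"
      by (simp add: f_def powr_add[symmetric])
    finally show "(\<Sum>k=2..<N+2. ln (real p) * (1 / real p) ^ k) \<le> 4 * f p" .
  qed
  also have "\<dots> = 4 * (\<Sum>p | prime p \<and> p \<le> N. f p)" by (simp add: sum_distrib_left)
  also have "(\<Sum>p | prime p \<and> p \<le> N. f p) \<le> suminf f"
    using fin sf by (intro sum_le_suminf) (auto simp: f_def)
  finally show "(\<Sum>n | n \<in> {1..N} \<and> \<not> prime n. mangoldt n / real n) \<le> 4 * suminf f" by simp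
qed

text \<open>Adding and subtracting the sums with weights 1 and \<open>chi4\<close> isolates each
  class; the prime 2 and the proper prime powers only change the constant.\<close>

lemma mertens_primes_mod_4:
  "\<exists>C\<ge>0. \<forall>N\<ge>1.
    \<bar>(\<Sum>p | p \<in> {1..N} \<and> prime p. ln (real p) / real p) - ln (real N)\<bar> \<le> C \<and>
    (\<forall>r\<in>{1, 3}. \<bar>(\<Sum>p | p \<in> {1..N} \<and> prime p \<and> p mod 4 = r. ln (real p) / real p) - ln (real N) / 2\<bar> \<le> C)"
proof -
  obtain E where E: "E \<ge> 0" "\<And>N. (\<Sum>n | n \<in> {1..N} \<and> \<not> prime n. mangoldt n / real n) \<le> E"
    using sum_nonprime_mangoldt_bounded by blast
  have split: "(\<Sum>n=1..N. g n) = (\<Sum>n | n \<in> {1..N} \<and> prime n. g n) + (\<Sum>n | n \<in> {1..N} \<and> \<not> prime n. g n)"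
    for N and g :: "nat \<Rightarrow> real"
  proof -
    have "{1..N} = {n. n \<in> {1..N} \<and> prime n} \<union> {n. n \<in> {1..N} \<and> \<not> prime n}" by auto
    thus ?thesis by (metis (no_types, lifting) disjoint_iff finite_Un finite_atLeastAtMost mem_Collect_eq sum.union_disjoint)
  qed
  have A: "\<bar>(\<Sum>p | p \<in> {1..N} \<and> prime p. ln (real p) / real p) - ln (real N)\<bar> \<le> 4 + E" if "N \<ge> 1" for N
  proof -
    have "(\<Sum>p | p \<in> {1..N} \<and> prime p. ln (real p) / real p) = (\<Sum>p | p \<in> {1..N} \<and> prime p. mangoldt p / real p)"
      by (intro sum.cong) auto
    moreover have "(\<Sum>n | n \<in> {1..N} \<and> \<not> prime n. mangoldt n / real n) \<ge> 0"
      by (intro sum_nonneg) (auto simp: mangoldt_nonneg)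
    ultimately show ?thesis
      using mertens_mangoldt[OF that] split[where N = N and g = "\<lambda>n. mangoldt n / real n"] E(2)[of N] by linarith
  qed
  have B: "\<bar>\<Sum>p | p \<in> {1..N} \<and> prime p. chi4 p * (ln (real p) / real p)\<bar> \<le> 8 + E" for N
  proof -
    have 1: "(\<Sum>p | p \<in> {1..N} \<and> prime p. chi4 p * (ln (real p) / real p)) =
        (\<Sum>p | p \<in> {1..N} \<and> prime p. chi4 p * mangoldt p / real p)"
      by (intro sum.cong) auto
    have "\<bar>\<Sum>n | n \<in> {1..N} \<and> \<not> prime n. chi4 n * mangoldt n / real n\<bar> \<le>
       (\<Sum>n | n \<in> {1..N} \<and> \<not> prime n. mangoldt n / real n)"
      using abs_chi4_le mangoldt_nonneg
      by (intro order_trans[OF sum_abs] sum_mono) (auto simp: abs_mult intro!: divide_right_mono mult_left_le_one_le)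
    thus ?thesis
      using 1 abs_sum_chi4_mangoldt_le[of N] split[where N = N and g = "\<lambda>n. chi4 n * mangoldt n / real n"] E(2)[of N] by linarith
  qed
  have two: "odd p \<or> p = 2" if "prime (p::nat)" for p using that primes_dvd_imp_eq two_is_prime_nat by blast
  define T where "T = (\<lambda>r N. \<Sum>p | p \<in> {1..N} \<and> prime p \<and> p mod 4 = r. ln (real p) / real p)"
  have chi: "(\<Sum>p | p \<in> {1..N} \<and> prime p. chi4 p * (ln (real p) / real p)) = T 1 N - T 3 N" for N
  proof -
    have "(\<Sum>p | p \<in> {1..N} \<and> prime p. chi4 p * (ln (real p) / real p)) =
      (\<Sum>p | p \<in> {1..N} \<and> prime p. (if p mod 4 = 1 then ln (real p) / real p else 0) - (if p mod 4 = 3 then ln (real p) / real p else 0))"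
      by (intro sum.cong) (auto simp: chi4_def)
    also have "\<dots> = T 1 N - T 3 N"
      unfolding T_def sum_subtractf by (simp add: sum.inter_filter[symmetric] conj_assoc)
    finally show ?thesis .
  qed
  have tot: "(\<Sum>p | p \<in> {1..N} \<and> prime p. ln (real p) / real p) - 1 \<le> T 1 N + T 3 N \<and>
     T 1 N + T 3 N \<le> (\<Sum>p | p \<in> {1..N} \<and> prime p. ln (real p) / real p)" for N
  proof -
    have "(\<Sum>p | p \<in> {1..N} \<and> prime p. ln (real p) / real p) =
      (\<Sum>p | p \<in> {1..N} \<and> prime p. (if p mod 4 = 1 then ln (real p) / real p else 0) +
         (if p mod 4 = 3 then ln (real p) / real p else 0) + (if p = 2 then ln (real p) / real p else 0))"
    proof (intro sum.cong refl)
      fix p assume "p \<in> {p. p \<in> {1..N} \<and> prime p}"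
      hence "odd p \<or> p = 2" using two by auto
      moreover have "p mod 4 = 1 \<or> p mod 4 = 3" if "odd p" using that by presburger
      ultimately show "ln (real p) / real p = (if p mod 4 = 1 then ln (real p) / real p else 0) +
         (if p mod 4 = 3 then ln (real p) / real p else 0) + (if p = 2 then ln (real p) / real p else 0)" by auto
    qed
    also have "\<dots> = T 1 N + T 3 N + (\<Sum>p | p \<in> {1..N} \<and> prime p. if p = 2 then ln (real p) / real p else 0)"
      unfolding T_def sum.distrib by (simp add: sum.inter_filter[symmetric] conj_assoc)
    also have "(\<Sum>p | p \<in> {1..N} \<and> prime p. if p = 2 then ln (real p) / real p else 0) = (if N \<ge> 2 then ln 2 / 2 else 0)"
      by (subst sum.delta) auto
    finally have "(\<Sum>p | p \<in> {1..N} \<and> prime p. ln (real p) / real p) = T 1 N + T 3 N + (if N \<ge> 2 then ln 2 / 2 else 0)" .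
    moreover have "ln (2::real) \<le> 1" "ln (2::real) \<ge> 0" using ln_le_minus_one[of 2] by simp_all
    ultimately show ?thesis by auto
  qed
  \<comment> \<open>The error is half of \<open>(4 + E) + (8 + E) + 1\<close>, where the last 1
    accounts for the prime 2.\<close>
  have R: "\<bar>T r N - ln (real N) / 2\<bar> \<le> 7 + E" if "N \<ge> 1" "r \<in> {1, 3}" for N r
    using A[OF that(1)] B[of N, unfolded chi] tot[of N] that(2) by (auto simp: abs_le_iff)
  have "\<bar>(\<Sum>p | p \<in> {1..N} \<and> prime p. ln (real p) / real p) - ln (real N)\<bar> \<le> 7 + E" if "N \<ge> 1" for N
    using A[OF that] by linarith
  thus ?thesis
    using R E(1) unfolding T_def by (intro exI[of _ "7 + E"] conjI allI impI ballI) simp_all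
qed

section \<open>Reciprocal sums and Euler products over primes\<close>

lemma sum_div_ln_le:
  fixes u :: "nat \<Rightarrow> real"
  assumes c: "c \<ge> 0" "C \<ge> 0" and u: "\<And>k. k \<ge> 2 \<Longrightarrow> (\<Sum>n=2..k. u n) \<le> c * ln (real k) + C" and N: "N \<ge> 2"
  shows "(\<Sum>n=2..N. u n / ln (real n)) \<le> c * ln (ln (real N)) + (c + C / ln 2 - c * ln (ln 2))"
proof -
  define f where "f = (\<lambda>n. 1 / ln (real n))"
  have lnpos: "ln (real k) > 0" if "k \<ge> 2" for k using that by simp
  have "(\<Sum>n=2..N. u n / ln (real n)) = (\<Sum>n=2..N. u n * f n)" by (simp add: f_def)
  also have "\<dots> = (\<Sum>n=2..N. u n) * f N + (\<Sum>k=2..<N. (\<Sum>n=2..k. u n) * (f k - f (Suc k)))"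
    by (rule sum_by_parts[OF N])
  also have "\<dots> \<le> (c * ln (real N) + C) * f N + (\<Sum>k=2..<N. c * (ln (ln (real (Suc k))) - ln (ln (real k))) + C * (f k - f (Suc k)))"
  proof (intro add_mono sum_mono)
    show "(\<Sum>n=2..N. u n) * f N \<le> (c * ln (real N) + C) * f N"
      using u[OF N] lnpos[OF N] by (intro mult_right_mono) (auto simp: f_def)
    fix k assume k: "k \<in> {2..<N}"
    have pos: "ln (real k) > 0" "ln (real (Suc k)) > 0" using lnpos[of k] lnpos[of "Suc k"] k by auto
    have le: "ln (real k) \<le> ln (real (Suc k))" using k by simp
    have "f (Suc k) \<le> f k" unfolding f_def using pos le by (intro divide_left_mono) auto
    hence "(\<Sum>n=2..k. u n) * (f k - f (Suc k)) \<le> (c * ln (real k) + C) * (f k - f (Suc k))"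
      using u[of k] k by (intro mult_right_mono) auto
    also have "\<dots> = c * (1 - ln (real k) / ln (real (Suc k))) + C * (f k - f (Suc k))"
      using pos by (simp add: f_def field_simps)
    \<comment> \<open>\<open>1 - u \<le> - ln u\<close> for the quotient \<open>u\<close> of
      consecutive logarithms makes the main term telescope to \<open>ln (ln N)\<close>.\<close>
    also have "1 - ln (real k) / ln (real (Suc k)) \<le> ln (ln (real (Suc k))) - ln (ln (real k))"
      using ln_le_minus_one[of "ln (real k) / ln (real (Suc k))"] pos by (simp add: ln_div)
    hence "c * (1 - ln (real k) / ln (real (Suc k))) \<le> c * (ln (ln (real (Suc k))) - ln (ln (real k)))"
      using c by (intro mult_left_mono)
    finally show "(\<Sum>n=2..k. u n) * (f k - f (Suc k)) \<le> c * (ln (ln (real (Suc k))) - ln (ln (real k))) + C * (f k - f (Suc k))"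
      by simp
  qed
  also have "(\<Sum>k=2..<N. c * (ln (ln (real (Suc k))) - ln (ln (real k))) + C * (f k - f (Suc k))) =
      c * (\<Sum>k=2..<N. ln (ln (real (Suc k))) - ln (ln (real k))) - C * (\<Sum>k=2..<N. f (Suc k) - f k)"
    by (simp add: sum.distrib sum_distrib_left sum_subtractf algebra_simps)
  also have "\<dots> = c * (ln (ln (real N)) - ln (ln 2)) - C * (f N - f 2)"
    using sum_Suc_diff'[OF N, of "\<lambda>k. ln (ln (real k))"] sum_Suc_diff'[OF N, of f] by simp
  also have "(c * ln (real N) + C) * f N + (c * (ln (ln (real N)) - ln (ln 2)) - C * (f N - f 2)) =
      c * ln (ln (real N)) + (c + C / ln 2 - c * ln (ln 2))"
    using lnpos[OF N] by (simp add: f_def field_simps)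
  finally show ?thesis .
qed

lemma mertens_recip_le:
  assumes "c \<ge> 0" "C \<ge> 0"
    and "\<And>k. k \<ge> 1 \<Longrightarrow> (\<Sum>p | p \<in> {1..k} \<and> prime p \<and> P p. ln (real p) / real p) \<le> c * ln (real k) + C"
  shows "\<exists>C'\<ge>0. \<forall>N\<ge>2. (\<Sum>p | p \<in> {1..N} \<and> prime p \<and> P p. 1 / real p) \<le> c * ln (ln (real N)) + C'"
proof -
  define u where "u = (\<lambda>n. if prime n \<and> P n then ln (real n) / real n else 0)"
  have set: "{p. p \<in> {1..k} \<and> prime p \<and> P p} = {p \<in> {2..k}. prime p \<and> P p}" for k
    by (auto dest: prime_ge_2_nat)
  have filter: "(\<Sum>p | p \<in> {1..k} \<and> prime p \<and> P p. g p) = (\<Sum>n=2..k. if prime n \<and> P n then g n else 0)"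
    for k and g :: "nat \<Rightarrow> real"
    unfolding set by (rule sum.inter_filter) simp
  have 1: "(\<Sum>n=2..k. u n) \<le> c * ln (real k) + C" if "k \<ge> 2" for k
    using assms(3)[of k] that unfolding filter u_def by simp
  have 2: "(\<Sum>p | p \<in> {1..N} \<and> prime p \<and> P p. 1 / real p) = (\<Sum>n=2..N. u n / ln (real n))" if "N \<ge> 2" for N
    unfolding filter u_def by (auto intro!: sum.cong)
  show ?thesis
    using sum_div_ln_le[OF assms(1,2) 1] 2
    by (intro exI[of _ "max 0 (c + C / ln 2 - c * ln (ln 2))"]) (fastforce intro: order_trans)
qed

text \<open>\<open>1 / (1 - 1 / p)\<close> exceeds \<open>1 + 1 / p\<close> by
  \<open>1 / (p * (p - 1))\<close>; the \<open>+ 1\<close> in the exponent absorbs the telescoping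
  sum of these.\<close>

lemma prod_primes_le:
  assumes "finite F" "\<And>p. p \<in> F \<Longrightarrow> prime (p::nat)"
  shows "(\<Prod>p\<in>F. 1 / (1 - 1 / real p)) \<le> exp ((\<Sum>p\<in>F. 1 / real p) + 1)"
proof -
  have tele: "(\<Sum>n=2..M. 1 / (real n * (real n - 1))) \<le> 1" for M
  proof -
    have "(\<Sum>n=2..M. 1 / (real n * (real n - 1))) \<le> 1 - 1 / real M" if "M \<ge> 1"
      using that
    proof (induction M rule: nat_induct_at_least)
      case (Suc M)
      have "1 / (real (Suc M) * (real (Suc M) - 1)) = 1 / real M - 1 / real (Suc M)"
        using Suc.hyps by (simp add: field_simps)
      thus ?case using Suc by simp
    qed simp
    moreover have "1 / real M \<ge> 0" by simp
    ultimately show ?thesis by (cases "M = 0") (simp, linarith)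
  qed
  have "(\<Prod>p\<in>F. 1 / (1 - 1 / real p)) \<le> (\<Prod>p\<in>F. exp (1 / real p + 1 / (real p * (real p - 1))))"
  proof (intro prod_mono conjI)
    fix p assume "p \<in> F"
    hence p: "real p > 1" using assms prime_gt_1_nat by simp
    thus "0 \<le> 1 / (1 - 1 / real p)" by simp
    have "1 / (1 - 1 / real p) = 1 + (1 / real p + 1 / (real p * (real p - 1)))"
      using p by (simp add: field_simps)
    also have "\<dots> \<le> exp (1 / real p + 1 / (real p * (real p - 1)))" by (rule exp_ge_add_one_self)
    finally show "1 / (1 - 1 / real p) \<le> exp (1 / real p + 1 / (real p * (real p - 1)))" .
  qed
  also have "\<dots> = exp ((\<Sum>p\<in>F. 1 / real p) + (\<Sum>p\<in>F. 1 / (real p * (real p - 1))))"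
    using assms(1) by (simp add: exp_sum sum.distrib[symmetric])
  also have "(\<Sum>p\<in>F. 1 / (real p * (real p - 1))) \<le> (\<Sum>n=2..Max (insert 0 F). 1 / (real n * (real n - 1)))"
    using assms prime_ge_2_nat by (intro sum_mono2) (auto simp: Max_ge)
  also note tele
  finally show ?thesis by simp
qed

lemma prod_primes_mod_4_le:
  fixes r :: nat
  assumes "r \<in> {1, 3}"
  shows "\<exists>C>0. \<forall>N\<ge>2. (\<Prod>p | p \<in> {1..N} \<and> prime p \<and> p mod 4 = r. 1 / (1 - 1 / real p)) \<le> C * sqrt (ln (real N))"
proof -
  obtain C where C: "C \<ge> 0" "\<And>N r. N \<ge> 1 \<Longrightarrow> r \<in> {1, 3} \<Longrightarrow>
      \<bar>(\<Sum>p | p \<in> {1..N} \<and> prime p \<and> p mod 4 = r. ln (real p) / real p) - ln (real N) / 2\<bar> \<le> C"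
    using mertens_primes_mod_4 by blast
  have "(\<Sum>p | p \<in> {1..k} \<and> prime p \<and> p mod 4 = r. ln (real p) / real p) \<le> 1 / 2 * ln (real k) + C" if "k \<ge> 1" for k
    using C(2)[OF that assms] by linarith
  from mertens_recip_le[OF _ C(1) this] obtain C' where
    C': "\<And>N. N \<ge> 2 \<Longrightarrow> (\<Sum>p | p \<in> {1..N} \<and> prime p \<and> p mod 4 = r. 1 / real p) \<le> 1 / 2 * ln (ln (real N)) + C'"
    by auto
  show ?thesis
  proof (intro exI[of _ "exp (C' + 1)"] conjI allI impI)
    fix N :: nat assume N: "N \<ge> 2"
    have "(\<Prod>p | p \<in> {1..N} \<and> prime p \<and> p mod 4 = r. 1 / (1 - 1 / real p)) \<le>
       exp ((\<Sum>p | p \<in> {1..N} \<and> prime p \<and> p mod 4 = r. 1 / real p) + 1)"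
      by (intro prod_primes_le) auto
    also have "\<dots> \<le> exp (C' + 1 + 1 / 2 * ln (ln (real N)))" using C'[OF N] by simp
    also have "\<dots> = exp (C' + 1) * (ln (real N) powr (1 / 2))"
      using N by (simp add: exp_add powr_def)
    also have "ln (real N) powr (1 / 2) = sqrt (ln (real N))" using N by (simp add: powr_half_sqrt)
    finally show "(\<Prod>p | p \<in> {1..N} \<and> prime p \<and> p mod 4 = r. 1 / (1 - 1 / real p)) \<le> exp (C' + 1) * sqrt (ln (real N))" .
  qed auto
qed

lemma sum_recip_primes_le:
  "\<exists>C\<ge>0. \<forall>N\<ge>2. (\<Sum>p | p \<in> {1..N} \<and> prime p. 1 / real p) \<le> ln (ln (real N)) + C"
proof -
  obtain C where C: "C \<ge> 0" "\<And>N. N \<ge> 1 \<Longrightarrow> \<bar>(\<Sum>p | p \<in> {1..N} \<and> prime p. ln (real p) / real p) - ln (real N)\<bar> \<le> C"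
    using mertens_primes_mod_4 by blast
  have "(\<Sum>p | p \<in> {1..k} \<and> prime p \<and> True. ln (real p) / real p) \<le> 1 * ln (real k) + C" if "k \<ge> 1" for k
    using C(2)[OF that] by simp
  from mertens_recip_le[OF _ C(1) this] show ?thesis by simp
qed

text \<open>Follows from Mertens' estimate alone: between \<open>y div K\<close> and
  \<open>y\<close> the sum of \<open>ln p / p\<close> is at least 1 once the constant
  \<open>K\<close> is large, and each such \<open>p\<close> exceeds \<open>y div K\<close>, which
  has the order of \<open>y\<close>.\<close>

lemma chebyshev_theta_1_mod_4_ge:
  "\<exists>c>0. \<exists>y0. \<forall>y\<ge>y0. (\<Sum>p | p \<in> {1..y} \<and> prime p \<and> p mod 4 = 1. ln (real p)) \<ge> c * real y"
proof -
  obtain C where C: "C \<ge> 0" "\<And>N r. N \<ge> 1 \<Longrightarrow> r \<in> {1, 3} \<Longrightarrow>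
      \<bar>(\<Sum>p | p \<in> {1..N} \<and> prime p \<and> p mod 4 = r. ln (real p) / real p) - ln (real N) / 2\<bar> \<le> C"
    using mertens_primes_mod_4 by blast
  \<comment> \<open>Makes \<open>ln K \<ge> 4 * C + 2\<close>: half of this, minus an error
    \<open>C\<close> at either end, leaves 1.\<close>
  define K where "K = nat \<lceil>exp (4 * C + 2)\<rceil>"
  have K: "real K \<ge> exp (4 * C + 2)" unfolding K_def by linarith
  hence Kpos: "real K > 0" using exp_gt_zero less_le_trans by blast
  have lnK: "ln (real K) \<ge> 4 * C + 2" using K Kpos by (simp add: ln_ge_iff)
  show ?thesis
  proof (intro exI[of _ "1 / (2 * real K)"] conjI exI[of _ K] allI impI)
    show "1 / (2 * real K) > 0" using Kpos by simp
    fix y assume y: "y \<ge> K"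
    define z where "z = y div K"
    have z: "z \<ge> 1" using y Kpos by (simp add: z_def less_eq_div_iff_mult_less_eq)
    have zle: "real z \<le> real y / real K" unfolding z_def by (rule of_nat_div_le_of_nat)
    have z2: "real y \<le> 2 * real K * real z"
    proof -
      have "y < (z + 1) * K" unfolding z_def using Kpos dividend_less_div_times[of K y] by (simp add: algebra_simps)
      also have "\<dots> \<le> (2 * z) * K" using z by (intro mult_right_mono) auto
      finally have "real y < real (2 * z * K)" by (simp only: of_nat_less_iff)
      thus ?thesis by (simp add: algebra_simps)
    qed
    have y1: "y \<ge> 1" using y Kpos by simp
    have zy: "z \<le> y" unfolding z_def by simp
    let ?A = "\<lambda>N. {p::nat. p \<in> {1..N} \<and> prime p \<and> p mod 4 = 1}"
    have fin: "finite (?A N)" for N by simp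
    have un: "?A y = ?A z \<union> (?A y - ?A z)" using zy by auto
    have "(\<Sum>p\<in>?A y. ln (real p) / real p) = (\<Sum>p\<in>?A z. ln (real p) / real p) + (\<Sum>p\<in>?A y - ?A z. ln (real p) / real p)"
      by (subst un, rule sum.union_disjoint) auto
    moreover have "ln (real y) - ln (real z) \<ge> 4 * C + 2"
    proof -
      have "ln (real z) \<le> ln (real y / real K)" using zle z by simp
      also have "\<dots> = ln (real y) - ln (real K)" using y1 Kpos by (simp add: ln_div)
      finally show ?thesis using lnK by linarith
    qed
    ultimately have ge1: "(\<Sum>p\<in>?A y - ?A z. ln (real p) / real p) \<ge> 1"
      using C(2)[OF y1, of 1] C(2)[OF z, of 1] by (auto simp: abs_le_iff)
    have "1 / (2 * real K) * real y \<le> real z"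
      using z2 Kpos by (simp add: field_simps)
    also have "\<dots> \<le> real z * (\<Sum>p\<in>?A y - ?A z. ln (real p) / real p)"
      using ge1 z by (simp add: mult_le_cancel_left1)
    also have "\<dots> = (\<Sum>p\<in>?A y - ?A z. real z * (ln (real p) / real p))" by (simp add: sum_distrib_left)
    also have "\<dots> \<le> (\<Sum>p\<in>?A y - ?A z. ln (real p))"
    proof (intro sum_mono)
      fix p assume p: "p \<in> ?A y - ?A z"
      hence "p > z" by auto
      hence "real z * ln (real p) \<le> real p * ln (real p)" using z by (intro mult_right_mono) auto
      thus "real z * (ln (real p) / real p) \<le> ln (real p)" using \<open>p > z\<close> by (simp add: field_simps)
    qed
    also have "\<dots> \<le> (\<Sum>p\<in>?A y. ln (real p))" by (intro sum_mono2) auto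
    finally show "1 / (2 * real K) * real y \<le> (\<Sum>p\<in>?A y. ln (real p))" .
  qed
qed

section \<open>The residue class\<close>

text \<open>Otherwise the congruence of \<open>a\<^sup>2\<close> and \<open>- b\<^sup>2\<close>,
  raised to the odd power \<open>(p - 1) / 2\<close>, would become \<open>1 = -1\<close> modulo
  \<open>p\<close> by Fermat.\<close>

lemma prime_3_mod_4_dvd_sum_squares:
  fixes a b p :: nat
  assumes p: "prime p" "p mod 4 = 3" and dvd: "p dvd a\<^sup>2 + b\<^sup>2"
  shows "p dvd a"
proof (rule ccontr)
  assume na: "\<not> p dvd a"
  have nb: "\<not> p dvd b"
  proof
    assume "p dvd b"
    hence "p dvd b\<^sup>2" by (simp add: power2_eq_square)
    with dvd have "p dvd a\<^sup>2" by (simp add: dvd_add_left_iff)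
    with p na show False using prime_dvd_power by blast
  qed
  define k where "k = (p - 1) div 2"
  have k: "p - 1 = 2 * k" and "odd k"
    using p unfolding k_def by (presburger, presburger)
  have "int p dvd (int a)\<^sup>2 - (- (int b)\<^sup>2)"
    using dvd by (metis diff_minus_eq_add int_dvd_int_iff of_nat_add of_nat_power)
  hence "[(int a)\<^sup>2 = - (int b)\<^sup>2] (mod int p)" by (simp add: cong_iff_dvd_diff)
  hence "[((int a)\<^sup>2) ^ k = (- (int b)\<^sup>2) ^ k] (mod int p)" by (rule cong_pow)
  hence c1: "[int (a ^ (p - 1)) = - int (b ^ (p - 1))] (mod int p)"
    unfolding k power_mult using \<open>odd k\<close> by simp
  have f1: "[int (a ^ (p - 1)) = 1] (mod int p)" and f2: "[int (b ^ (p - 1)) = 1] (mod int p)"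
    using fermat_theorem[OF p(1) na] fermat_theorem[OF p(1) nb]
    by (metis cong_int_iff of_nat_1, metis cong_int_iff of_nat_1)
  have "[1 = (- 1 :: int)] (mod int p)"
    using cong_trans[OF cong_sym[OF f1] cong_trans[OF c1 cong_uminus[OF f2]]] .
  hence "int p dvd 2" by (simp add: cong_iff_dvd_diff)
  hence "p dvd 2" by (metis int_dvd_int_iff of_nat_numeral)
  hence "p \<le> 2" by (auto dest: dvd_imp_le)
  with p show False by (cases "p = 2") auto
qed

lemma prime_3_mod_4_square_dvd_sum_squares:
  fixes a b p :: nat
  assumes p: "prime p" "p mod 4 = 3" and dvd: "p dvd a\<^sup>2 + b\<^sup>2"
  shows "p\<^sup>2 dvd a\<^sup>2 + b\<^sup>2"
proof -
  have "p dvd a" "p dvd b"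
    using prime_3_mod_4_dvd_sum_squares[OF p] dvd by (metis, metis add.commute)
  thus ?thesis by (simp add: dvd_add dvd_power_same)
qed

text \<open>\<open>wief\<close> says that \<open>p\<close> is not a Wieferich prime. The order of 2
  modulo \<open>p\<^sup>2\<close> divides \<open>p * (p - 1)\<close>; were it coprime to
  \<open>p\<close>, it would divide \<open>p - 1\<close>, against \<open>wief\<close>.\<close>

lemma prime_dvd_exponent_of_two:
  fixes p k :: nat
  assumes p: "prime p" and wief: "\<not> [2 ^ (p - 1) = 1] (mod p\<^sup>2)" and k: "[2 ^ k = 1] (mod p\<^sup>2)"
    and "odd p"
  shows "p dvd k"
proof (rule ccontr)
  assume nd: "\<not> p dvd k"
  have "ord (p\<^sup>2) 2 dvd k" using k ord_divides by blast
  hence cop: "coprime p (ord (p\<^sup>2) 2)"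
    using nd p by (meson dvd_trans prime_imp_coprime_nat)
  have "coprime (p\<^sup>2) 2" using \<open>odd p\<close> by simp
  hence "ord (p\<^sup>2) 2 dvd totient (p\<^sup>2)" by (rule order_divides_totient)
  also have "totient (p\<^sup>2) = p * (p - 1)"
    using totient_prime_power[OF p, of 2] by simp
  finally have "ord (p\<^sup>2) 2 dvd p - 1" using cop coprime_commute coprime_dvd_mult_right_iff by blast
  with wief show False using ord_divides by blast
qed

text \<open>Choosing \<open>s \<equiv> -1 (mod p)\<close> makes \<open>s\<close> a quadratic non-residue, so that \<open>2 ^ n\<^sup>2\<close> never
  agrees with \<open>2 ^ s\<close> modulo \<open>p\<^sup>2\<close>, although it does modulo \<open>p\<close> when \<open>n\<^sup>2 \<equiv> s\<close> modulo the order of 2.\<close>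
lemma not_two_squares_plus_power:
  fixes p s e n b1 b2 x :: nat
  assumes p: "prime p" "p mod 4 = 3" and wief: "\<not> [2 ^ (p - 1) = 1] (mod p\<^sup>2)"
    and s: "p dvd s + 1" and e: "[2 ^ e = 1] (mod p)" and ns: "[n\<^sup>2 = s] (mod e)"
    and x: "[x = 2 ^ s] (mod p\<^sup>2)"
  shows "x \<noteq> b1\<^sup>2 + b2\<^sup>2 + 2 ^ (n\<^sup>2)"
proof
  assume eq: "x = b1\<^sup>2 + b2\<^sup>2 + 2 ^ (n\<^sup>2)"
  have odd: "odd p" using p by presburger
  have "[n\<^sup>2 = s] (mod (ord p 2))"
    using ns e ord_divides cong_dvd_modulus_nat by blast
  hence c: "[2 ^ (n\<^sup>2) = 2 ^ s] (mod p)"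
    using order_divides_expdiff[of p 2 "n\<^sup>2" s] odd by (simp add: coprime_commute)
  have "[x = 2 ^ s] (mod p)" using x cong_dvd_modulus_nat[of _ _ "p\<^sup>2" p] by (simp add: power2_eq_square)
  hence "[0 + 2 ^ (n\<^sup>2) = b1\<^sup>2 + b2\<^sup>2 + 2 ^ (n\<^sup>2)] (mod p)" using c eq
    by (metis add_0 cong_sym cong_trans)
  hence "[0 = b1\<^sup>2 + b2\<^sup>2] (mod p)" by (simp only: cong_add_rcancel_nat)
  hence "p dvd b1\<^sup>2 + b2\<^sup>2" using cong_0_iff cong_sym by blast
  hence "p\<^sup>2 dvd b1\<^sup>2 + b2\<^sup>2" using prime_3_mod_4_square_dvd_sum_squares p by blast
  hence "[b1\<^sup>2 + b2\<^sup>2 = 0] (mod p\<^sup>2)" by (simp add: cong_0_iff)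
  hence "[b1\<^sup>2 + b2\<^sup>2 + 2 ^ (n\<^sup>2) = 0 + 2 ^ (n\<^sup>2)] (mod p\<^sup>2)" by (rule cong_add) simp
  hence c2: "[2 ^ (n\<^sup>2) = 2 ^ s] (mod p\<^sup>2)" using x eq by (metis add_0 cong_sym cong_trans)
  have cop: "coprime (p\<^sup>2) 2" using odd by simp
  have c3: "[n\<^sup>2 = s] (mod ord (p\<^sup>2) 2)"
    using c2 order_divides_expdiff[of "p\<^sup>2" 2] cop by blast
  have "p dvd ord (p\<^sup>2) 2"
    using prime_dvd_exponent_of_two[OF p(1) wief _ odd] ord by blast
  hence "[n\<^sup>2 = s] (mod p)" using c3 cong_dvd_modulus_nat by blast
  hence "[n\<^sup>2 + 1 = s + 1] (mod p)" by (rule cong_add) simp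
  hence "p dvd n\<^sup>2 + 1\<^sup>2" using s by (simp add: cong_dvd_iff)
  \<comment> \<open>The order of the summands matters: the divisibility lemma speaks of the first
    base, and here it has to yield \<open>p dvd 1\<close>.\<close>
  hence "p dvd 1\<^sup>2 + n\<^sup>2" by (simp add: add.commute)
  hence "p dvd 1" using prime_3_mod_4_dvd_sum_squares[OF p] by blast
  with p show False by simp
qed

text \<open>Odd \<open>n\<close> are covered modulo 2, and \<open>n\<close> prime to 3 modulo 3.
  Among the multiples of 6, those that are 1 or 4 modulo 5 are covered modulo 5, those that are 2 or
  3 modulo 5 have an even square that is 4 modulo 5, and multiples of 5 fall to the modulus 15. The
  right sides are chosen to be -1 modulo 3, 7, 31, 11 and 151 as well.\<close>

lemma square_covering:
  fixes n :: nat
  shows "[n\<^sup>2 = 5] (mod 2) \<or> [n\<^sup>2 = 13] (mod 3) \<or> [n\<^sup>2 = 61] (mod 5) \<or> [n\<^sup>2 = 54] (mod 10) \<or>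
         [n\<^sup>2 = 150] (mod 15)"
proof -
  have m2: "n\<^sup>2 mod 2 = 0 \<or> n\<^sup>2 mod 2 = 1" by presburger
  have "n mod 3 = 0 \<or> n mod 3 = 1 \<or> n mod 3 = 2" by presburger
  hence "n\<^sup>2 mod 3 = 0 \<or> n\<^sup>2 mod 3 = 1" by (subst (1 2) power_mod[symmetric]) auto
  moreover have "n mod 5 = 0 \<or> n mod 5 = 1 \<or> n mod 5 = 2 \<or> n mod 5 = 3 \<or> n mod 5 = 4" by presburger
  hence "n\<^sup>2 mod 5 = 0 \<or> n\<^sup>2 mod 5 = 1 \<or> n\<^sup>2 mod 5 = 4" by (subst (1 2 3) power_mod[symmetric]) auto
  ultimately have "n\<^sup>2 mod 2 = 1 \<or> n\<^sup>2 mod 3 = 1 \<or> n\<^sup>2 mod 5 = 1 \<or> n\<^sup>2 mod 10 = 4 \<or> n\<^sup>2 mod 15 = 0"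
    using m2 by presburger
  thus ?thesis by (simp add: cong_def)
qed

lemma residue_class_avoiding_S4:
  "\<exists>(M::int) (\<alpha>::int). M > 0 \<and> odd M \<and> {x::int. [x = \<alpha>] (mod M)} \<inter> int ` S4 = {}"
proof -
  \<comment> \<open>\<open>\<alpha>\<close> solves \<open>x = 2 ^ s\<close> modulo
    \<open>p\<^sup>2\<close> by the Chinese remainder theorem for the pairs \<open>(p, s)\<close> =
    (3, 5), (7, 13), (31, 61), (11, 54), (151, 150). Each \<open>s\<close> in turn joins -1 modulo
    \<open>p\<close> to the residue wanted modulo the order of 2 modulo \<open>p\<close>.\<close>
  define M \<alpha> :: nat where "M = (3 * 7 * 31 * 11 * 151)\<^sup>2" and "\<alpha> = 122020608803"
  have pr: "prime (3::nat)" "prime (7::nat)" "prime (31::nat)" "prime (11::nat)" "prime (151::nat)"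
    by simp_all
  have no: "x \<notin> S4" if x: "[x = \<alpha>] (mod M)" for x
  proof
    assume "x \<in> S4"
    then obtain b1 b2 n where eq: "x = b1\<^sup>2 + b2\<^sup>2 + 2 ^ (n\<^sup>2)" by (auto simp: S4_def)
    have c: "[x = \<alpha>] (mod d)" if "d dvd M" for d
      using x that cong_dvd_modulus_nat by blast
    have x3: "[x = 2 ^ 5] (mod 3\<^sup>2)" and x7: "[x = 2 ^ 13] (mod 7\<^sup>2)"
      and x31: "[x = 2 ^ 61] (mod 31\<^sup>2)" and x11: "[x = 2 ^ 54] (mod 11\<^sup>2)"
      and x151: "[x = 2 ^ 150] (mod 151\<^sup>2)"
      using c[of "3\<^sup>2"] c[of "7\<^sup>2"] c[of "31\<^sup>2"] c[of "11\<^sup>2"] c[of "151\<^sup>2"]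
      by (simp_all add: M_def \<alpha>_def cong_def)
    from square_covering[of n] show False
    proof (elim disjE)
      assume "[n\<^sup>2 = 5] (mod 2)"
      from not_two_squares_plus_power[OF pr(1) _ _ _ _ this x3, of b1 b2] eq show False
        by (simp add: cong_def)
    next
      assume "[n\<^sup>2 = 13] (mod 3)"
      from not_two_squares_plus_power[OF pr(2) _ _ _ _ this x7, of b1 b2] eq show False
        by (simp add: cong_def)
    next
      assume "[n\<^sup>2 = 61] (mod 5)"
      from not_two_squares_plus_power[OF pr(3) _ _ _ _ this x31, of b1 b2] eq show False
        by (simp add: cong_def)
    next
      assume "[n\<^sup>2 = 54] (mod 10)"
      from not_two_squares_plus_power[OF pr(4) _ _ _ _ this x11, of b1 b2] eq show False
        by (simp add: cong_def)
    next
      assume "[n\<^sup>2 = 150] (mod 15)"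
      from not_two_squares_plus_power[OF pr(5) _ _ _ _ this x151, of b1 b2] eq show False
        by (simp add: cong_def)
    qed
  qed
  have "{x::int. [x = int \<alpha>] (mod int M)} \<inter> int ` S4 = {}"
    using no cong_int_iff by auto
  moreover have "int M > 0" "odd (int M)" by (simp_all add: M_def)
  ultimately show ?thesis by blast
qed

section \<open>Sums of two squares\<close>

lemma sum_two_squares_mult:
  fixes m n :: nat
  assumes "\<exists>a b. m = a\<^sup>2 + b\<^sup>2" "\<exists>a b. n = a\<^sup>2 + b\<^sup>2"
  shows "\<exists>a b. m * n = a\<^sup>2 + (b::nat)\<^sup>2"
proof -
  from assms obtain a b c d where m: "m = a\<^sup>2 + b\<^sup>2" and n: "n = c\<^sup>2 + d\<^sup>2" by blast
  have "int (m * n) = (int a * int c + int b * int d)\<^sup>2 + (int a * int d - int b * int c)\<^sup>2"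
    by (simp add: m n power2_eq_square algebra_simps)
  also have "\<dots> = int ((a * c + b * d)\<^sup>2 + (nat \<bar>int a * int d - int b * int c\<bar>)\<^sup>2)"
    by simp
  finally show ?thesis using of_nat_eq_iff by blast
qed

text \<open>Thue's argument: if \<open>x\<^sup>2 = -1\<close> modulo \<open>p\<close>, two of the
  more than \<open>p\<close> pairs \<open>(u, v)\<close> with entries up to
  \<open>floor_sqrt p\<close> agree in \<open>u - x * v\<close> modulo \<open>p\<close>. Their
  difference is a nonzero pair whose sum of squares is a multiple of \<open>p\<close> below
  \<open>2 * p\<close>.\<close>

lemma prime_1_mod_4_sum_two_squares:
  fixes p :: nat
  assumes p: "prime p" "p mod 4 = 1"
  shows "\<exists>a b. p = a\<^sup>2 + (b::nat)\<^sup>2"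
proof -
  have p2: "p > 2"
  proof -
    have "p \<noteq> 2" using p(2) by auto
    thus ?thesis using prime_ge_2_nat[OF p(1)] by linarith
  qed
  have "even ((p - 1) div 2)" using p(2) by presburger
  hence L: "[Legendre (-1) p = 1] (mod int p)"
    using euler_criterion[OF p(1) p2, of "-1"] by simp
  obtain x :: int where x: "[x\<^sup>2 = -1] (mod int p)"
  proof (cases "QuadRes p (-1)")
    case True
    thus ?thesis using that by (auto simp: QuadRes_def)
  next
    case False
    hence "Legendre (-1) p = 0 \<or> Legendre (-1) p = -1" by (simp add: Legendre_def)
    hence "int p dvd 0 - 1 \<or> int p dvd -1 - 1"
      using L by (auto simp: cong_iff_dvd_diff)
    hence "int p dvd 1 \<or> int p dvd 2" by (auto simp: dvd_minus_iff)
    hence "int p \<le> 2" by (auto dest: zdvd_imp_le)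
    with p2 show ?thesis by simp
  qed
  define s where "s = floor_sqrt p"
  have s1: "s\<^sup>2 \<le> p" and s2: "p < (s + 1)\<^sup>2"
    using Suc_floor_sqrt_power2_gt[of p] by (simp_all add: s_def)
  \<comment> \<open>A prime is not a square, and the strict inequality is what excludes the multiple
    \<open>2 * p\<close>.\<close>
  have "\<not> prime (s\<^sup>2)" by (simp add: prime_power_iff)
  hence s3: "s\<^sup>2 < p" using s1 p by (metis order_le_imp_less_or_eq)
  define f where "f = (\<lambda>(u, v). (int u - x * int v) mod int p)"
  have "card (f ` ({0..s} \<times> {0..s})) \<le> card {0..<int p}"
    using p2 by (intro card_mono) (auto simp: f_def)
  also have "\<dots> < card ({0..s} \<times> {0..s})"
    using s2 by (simp add: card_cartesian_product power2_eq_square)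
  finally have "\<not> inj_on f ({0..s} \<times> {0..s})" using pigeonhole by blast
  then obtain u v u' v' where uv: "u \<le> s" "v \<le> s" "u' \<le> s" "v' \<le> s" "(u, v) \<noteq> (u', v')"
      "(int u - x * int v) mod int p = (int u' - x * int v') mod int p"
    unfolding inj_on_def f_def by auto
  define a b where "a = int u - int u'" and "b = int v - int v'"
  have "int p dvd (int u - x * int v) - (int u' - x * int v')"
    using uv(6) by (simp add: mod_eq_dvd_iff)
  hence "int p dvd a - x * b" by (simp add: a_def b_def algebra_simps)
  hence "int p dvd (a - x * b) * (a + x * b) + b\<^sup>2 * (x\<^sup>2 - (-1))"
    using x by (simp add: cong_iff_dvd_diff)
  also have "(a - x * b) * (a + x * b) + b\<^sup>2 * (x\<^sup>2 - (-1)) = a\<^sup>2 + b\<^sup>2"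
    by (simp add: power2_eq_square algebra_simps)
  finally obtain t where t: "a\<^sup>2 + b\<^sup>2 = int p * t" by (auto simp: dvd_def)
  have "\<bar>a\<bar> \<le> int s" "\<bar>b\<bar> \<le> int s" using uv by (auto simp: a_def b_def)
  hence "a\<^sup>2 \<le> (int s)\<^sup>2" "b\<^sup>2 \<le> (int s)\<^sup>2" by (simp_all add: abs_le_square_iff[symmetric])
  moreover have "(int s)\<^sup>2 < int p" using s3 by (metis of_nat_less_iff of_nat_power)
  ultimately have "int p * t < int p * 2" using t by linarith
  hence "t < 2" using p2 by simp
  moreover have "a\<^sup>2 + b\<^sup>2 > 0" using uv(5) by (auto simp: a_def b_def sum_power2_gt_zero_iff)
  hence "t > 0" using t p2 by (simp add: zero_less_mult_iff)
  ultimately have "t = 1" by simp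
  hence "int ((nat \<bar>a\<bar>)\<^sup>2 + (nat \<bar>b\<bar>)\<^sup>2) = int p" using t by simp
  hence "p = (nat \<bar>a\<bar>)\<^sup>2 + (nat \<bar>b\<bar>)\<^sup>2" using of_nat_eq_iff by metis
  thus ?thesis by blast
qed

lemma sum_two_squares_if_prime_factors:
  fixes n :: nat
  assumes "n > 0" "\<And>p. prime p \<Longrightarrow> p dvd n \<Longrightarrow> p = 2 \<or> p mod 4 = 1"
  shows "\<exists>a b. n = a\<^sup>2 + (b::nat)\<^sup>2"
  using assms
proof (induction n rule: prime_divisors_induct)
  case zero thus ?case by simp
next
  case (unit x)
  hence "x = 1\<^sup>2 + 0\<^sup>2" by simp
  thus ?case by blast
next
  case (factor p x)
  have "\<exists>a b. x = a\<^sup>2 + (b::nat)\<^sup>2"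
    using factor by (intro factor.IH) auto
  moreover have "\<exists>a b. p = a\<^sup>2 + (b::nat)\<^sup>2"
  proof (cases "p = 2")
    case True
    hence "p = 1\<^sup>2 + 1\<^sup>2" by simp
    thus ?thesis by blast
  next
    case False
    hence "p mod 4 = 1" using factor.prems(2)[OF factor.hyps(1)] by simp
    thus ?thesis using factor.hyps(1) prime_1_mod_4_sum_two_squares by blast
  qed
  ultimately show ?case using sum_two_squares_mult by blast
qed

section \<open>Density and pair correlation of sums of two squares\<close>

abbreviation "primes_1_mod_4 \<equiv> {p::nat. prime p \<and> p mod 4 = 1}"
abbreviation "primes_3_mod_4 \<equiv> {p::nat. prime p \<and> p mod 4 = 3}"

text \<open>Only sums of two squares without prime factors \<open>\<equiv> 3 (mod 4)\<close> are used. They have the same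
  order of magnitude as all sums of two squares, and the sieve then removes complete residue classes
  modulo primes instead of exact divisibility conditions.\<close>
definition norms :: "nat set" where "norms = composed_of (insert 2 primes_1_mod_4)"

lemma norms_sum_two_squares: "n \<in> norms \<Longrightarrow> \<exists>a b. n = a\<^sup>2 + (b::nat)\<^sup>2"
  by (rule sum_two_squares_if_prime_factors) (auto simp: norms_def composed_of_def)

lemma recip_sum_mod_4_le:
  assumes "r \<in> {1, 3}"
  shows "\<exists>C>0. \<forall>N\<ge>2. recip_sum {p. prime p \<and> p mod 4 = r} N \<le> C * sqrt (ln (real N))"
proof -
  have "recip_sum {p. prime p \<and> p mod 4 = r} N \<le> (\<Prod>p | p \<in> {1..N} \<and> prime p \<and> p mod 4 = r. 1 / (1 - 1 / real p))" for N
  proof -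
    have eq: "{p \<in> {p. prime p \<and> p mod 4 = r}. prime p \<and> p \<le> N} = {p. p \<in> {1..N} \<and> prime p \<and> p mod 4 = r}"
      using prime_ge_1_nat by auto
    show ?thesis by (subst recip_sum_restrict, unfold eq, rule recip_sum_le_prod) auto
  qed
  thus ?thesis using prod_primes_mod_4_le[OF assms] by (meson order_trans)
qed

lemma prime_mod_4_cases: "prime (p::nat) \<Longrightarrow> p = 2 \<or> p mod 4 = 1 \<or> p mod 4 = 3"
proof -
  assume "prime p"
  hence "p = 2 \<or> odd p" using primes_dvd_imp_eq two_is_prime_nat by blast
  thus ?thesis by presburger
qed

text \<open>Links the two classes: an upper bound of size \<open>sqrt (ln N)\<close> for one factor
  becomes a lower bound of the same size for the other.\<close>

lemma recip_sum_product_ge: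
  assumes "N \<ge> 1"
  shows "ln (real N) \<le> recip_sum (insert 2 primes_1_mod_4) N * recip_sum primes_3_mod_4 N"
proof -
  have "{p::nat. prime p} \<subseteq> insert 2 primes_1_mod_4 \<union> primes_3_mod_4" using prime_mod_4_cases by blast
  hence "recip_sum {p. prime p} N \<le> recip_sum (insert 2 primes_1_mod_4 \<union> primes_3_mod_4) N" by (rule recip_sum_mono)
  thus ?thesis using ln_le_recip_sum_primes[OF assms] recip_sum_Un[of "insert 2 primes_1_mod_4" primes_3_mod_4 N] by linarith
qed

lemma sqrt_le_of_product:
  fixes a x y C :: real
  assumes "a > 0" "C > 0" "a \<le> x * y" "x \<le> C * sqrt a" "y \<ge> 0"
  shows "1 / C * sqrt a \<le> y"
proof -
  have "sqrt a * sqrt a \<le> C * sqrt a * y"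
    using assms mult_right_mono[of x "C * sqrt a" y] by simp
  hence "sqrt a * sqrt a \<le> sqrt a * (C * y)" by (simp add: mult_ac)
  hence "sqrt a \<le> C * y" by (rule mult_left_le_imp_le) (use assms in simp)
  thus ?thesis using assms by (simp add: field_simps)
qed

lemma recip_sum_3_mod_4_ge: "\<exists>c>0. \<forall>N\<ge>2. c * sqrt (ln (real N)) \<le> recip_sum primes_3_mod_4 N"
proof -
  obtain C where C: "C > 0" "\<And>N. N \<ge> 2 \<Longrightarrow> recip_sum primes_1_mod_4 N \<le> C * sqrt (ln (real N))"
    using recip_sum_mod_4_le[of 1] by auto
  have "1 / (2 * C) * sqrt (ln (real N)) \<le> recip_sum primes_3_mod_4 N" if N: "N \<ge> 2" for N
  proof (rule sqrt_le_of_product)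
    show "ln (real N) \<le> recip_sum (insert 2 primes_1_mod_4) N * recip_sum primes_3_mod_4 N" using recip_sum_product_ge N by simp
    have "recip_sum (insert 2 primes_1_mod_4) N \<le> recip_sum {2} N * recip_sum primes_1_mod_4 N"
      using recip_sum_Un[of "{2}" primes_1_mod_4 N] by simp
    also have "\<dots> \<le> 2 * (C * sqrt (ln (real N)))"
      using recip_sum_singleton[of 2 N] C N by (intro mult_mono) (auto simp: recip_sum_nonneg)
    finally show "recip_sum (insert 2 primes_1_mod_4) N \<le> 2 * C * sqrt (ln (real N))" by simp
  qed (use N C recip_sum_nonneg in auto)
  thus ?thesis using C(1) by (intro exI[of _ "1 / (2 * C)"]) auto
qed

lemma recip_sum_norms_ge: "\<exists>c>0. \<forall>N\<ge>2. c * sqrt (ln (real N)) \<le> recip_sum (insert 2 primes_1_mod_4) N"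
proof -
  obtain C where C: "C > 0" "\<And>N. N \<ge> 2 \<Longrightarrow> recip_sum primes_3_mod_4 N \<le> C * sqrt (ln (real N))"
    using recip_sum_mod_4_le[of 3] by auto
  have "1 / C * sqrt (ln (real N)) \<le> recip_sum (insert 2 primes_1_mod_4) N" if N: "N \<ge> 2" for N
  proof (rule sqrt_le_of_product)
    show "ln (real N) \<le> recip_sum primes_3_mod_4 N * recip_sum (insert 2 primes_1_mod_4) N"
      using recip_sum_product_ge[of N] N by (simp add: mult.commute)
  qed (use N C recip_sum_nonneg in auto)
  thus ?thesis using C(1) by (intro exI[of _ "1 / C"]) auto
qed

lemma sum_ln_prime_divisors_le:
  fixes n :: nat
  assumes "n > 0"
  shows "(\<Sum>p | p \<in> Q \<and> prime p \<and> p dvd n. ln (real p)) \<le> ln (real n)"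
proof -
  define F where "F = {p. p \<in> Q \<and> prime p \<and> p dvd n}"
  have "(\<Sum>p\<in>F. ln (real p)) = (\<Sum>p\<in>F. mangoldt p)"
    by (intro sum.cong) (auto simp: F_def)
  also have "\<dots> \<le> (\<Sum>d | d dvd n. mangoldt d)"
    using assms by (intro sum_mono2) (auto simp: F_def mangoldt_nonneg)
  also have "\<dots> = ln (real n)" using mangoldt_sum[of n, where ?'a = real] assms by simp
  finally show ?thesis by (simp add: F_def)
qed

text \<open>Each \<open>n\<close> is weighted by the sum of \<open>ln p\<close> over its prime
  divisors \<open>p = 1 (mod 4)\<close>, a weight of at most \<open>ln N\<close>. Writing
  \<open>n = p * m\<close> and summing over \<open>p\<close> first gives at least a constant times
  \<open>N / m\<close>, hence \<open>N\<close> times a reciprocal sum of size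
  \<open>sqrt (ln N)\<close>; dividing by \<open>ln N\<close> leaves the claim.\<close>

lemma card_norms_ge: "\<exists>c>0. \<exists>N0. \<forall>N\<ge>N0. c * real N / sqrt (ln (real N)) \<le> real (card (norms \<inter> {1..N}))"
proof -
  obtain c1 y0 where c1: "c1 > 0"
    and theta: "\<And>y. y \<ge> y0 \<Longrightarrow> (\<Sum>p | p \<in> {1..y} \<and> prime p \<and> p mod 4 = 1. ln (real p)) \<ge> c1 * real y"
    using chebyshev_theta_1_mod_4_ge by blast
  obtain c2 where c2: "c2 > 0" "\<And>N. N \<ge> 2 \<Longrightarrow> c2 * sqrt (ln (real N)) \<le> recip_sum (insert 2 primes_1_mod_4) N"
    using recip_sum_norms_ge by blast
  define y where "y = y0 + 2"
  have "c1 * c2 / 4 * real N / sqrt (ln (real N)) \<le> real (card (norms \<inter> {1..N}))" if N: "N \<ge> 4 * y\<^sup>2" for N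
  proof -
    define B where "B = norms \<inter> {1..N}"
    have ypos: "y \<ge> 2" by (simp add: y_def)
    have "4 * 2\<^sup>2 \<le> 4 * y\<^sup>2" using ypos by (intro mult_left_mono power_mono) auto
    hence N16: "N \<ge> 16" using N by simp
    \<comment> \<open>For \<open>m \<le> z\<close> the range \<open>N div m\<close> is at least
      \<open>y\<close>, where the Chebyshev bound applies. \<open>N \<ge> 4 * y\<^sup>2\<close>
      gives \<open>z \<ge> sqrt N\<close>, so \<open>ln z\<close> is still at least half of
      \<open>ln N\<close>.\<close>
    define z where "z = N div y"
    have z_ge: "real z \<ge> sqrt (real N)"
    proof -
      have sq: "2 * real y \<le> sqrt (real N)"
      proof (rule real_le_rsqrt)
        have "real (4 * y\<^sup>2) \<le> real N" using N by (simp only: of_nat_le_iff)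
        thus "(2 * real y)\<^sup>2 \<le> real N" by (simp add: power_mult_distrib)
      qed
      have "2 * real y * sqrt (real N) \<le> sqrt (real N) * sqrt (real N)"
        using sq by (intro mult_right_mono) auto
      hence s1: "2 * sqrt (real N) \<le> real N / real y" using ypos by (simp add: field_simps)
      have "sqrt (real N) \<ge> 4" using N16 by (intro real_le_rsqrt) auto
      thus ?thesis using s1 div_real_bounds(2)[of y N] ypos unfolding z_def by simp
    qed
    have "sqrt (real N) \<ge> 4" using N16 by (intro real_le_rsqrt) auto
    hence z2: "z \<ge> 2" using z_ge by linarith
    have "ln (sqrt (real N)) \<le> ln (real z)" using z_ge z2 N16 by (subst ln_le_cancel_iff) auto
    hence lnz: "ln (real N) / 2 \<le> ln (real z)" using N16 by (simp add: ln_sqrt)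
    have lnN: "ln (real N) > 0" using N16 by simp
    let ?T = "\<lambda>k. {p. p \<in> {1..k} \<and> prime p \<and> p mod 4 = 1}"
    let ?S1 = "SIGMA m:B. ?T (N div m)"
    let ?S2 = "SIGMA n:B. {p. p \<in> primes_1_mod_4 \<and> prime p \<and> p dvd n}"
    have finB: "finite B" by (simp add: B_def)
    have "real N / 2 * c1 * (c2 * sqrt (ln (real N) / 2)) \<le> real N / 2 * c1 * recip_sum (insert 2 primes_1_mod_4) z"
    proof (intro mult_left_mono)
      have "c2 * sqrt (ln (real N) / 2) \<le> c2 * sqrt (ln (real z))"
        using lnz c2(1) by (intro mult_left_mono real_sqrt_le_mono) auto
      also have "\<dots> \<le> recip_sum (insert 2 primes_1_mod_4) z" by (rule c2(2)[OF z2])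
      finally show "c2 * sqrt (ln (real N) / 2) \<le> recip_sum (insert 2 primes_1_mod_4) z" .
    qed (use c1 in auto)
    also have "\<dots> = (\<Sum>m\<in>norms \<inter> {1..z}. c1 * (real N / (2 * real m)))"
      by (simp add: recip_sum_def norms_def sum_distrib_left mult_ac)
    also have "\<dots> \<le> (\<Sum>m\<in>norms \<inter> {1..z}. \<Sum>p\<in>?T (N div m). ln (real p))"
    proof (intro sum_mono)
      fix m assume m: "m \<in> norms \<inter> {1..z}"
      hence m1: "m \<ge> 1" "m \<le> N div y" by (auto simp: z_def)
      hence "m * y \<le> N" using ypos by (simp add: less_eq_div_iff_mult_less_eq)
      hence Nm: "N div m \<ge> y" using m1 by (simp add: less_eq_div_iff_mult_less_eq mult.commute)
      have "real N / (2 * real m) \<le> real (N div m)"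
      proof -
        have "m * 2 \<le> m * y" using ypos by (rule mult_le_mono2)
        hence "real (m * 2) \<le> real N" using \<open>m * y \<le> N\<close> by (simp only: of_nat_le_iff)
        hence "1 \<le> real N / (2 * real m)" using m1 by (simp add: field_simps)
        moreover have "real N / real m = 2 * (real N / (2 * real m))" by simp
        ultimately show ?thesis using div_real_bounds(2)[of m N] m1 by linarith
      qed
      hence "c1 * (real N / (2 * real m)) \<le> c1 * real (N div m)" using c1 by (intro mult_left_mono) auto
      also have "\<dots> \<le> (\<Sum>p\<in>?T (N div m). ln (real p))" using Nm by (intro theta) (simp add: y_def)
      finally show "c1 * (real N / (2 * real m)) \<le> (\<Sum>p\<in>?T (N div m). ln (real p))" .
    qed
    also have "\<dots> \<le> (\<Sum>m\<in>B. \<Sum>p\<in>?T (N div m). ln (real p))"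
    proof (intro sum_mono2 sum_nonneg)
      have "z \<le> N" by (simp add: z_def)
      thus "norms \<inter> {1..z} \<subseteq> B" by (auto simp: B_def)
    qed (use finB in auto)
    also have "\<dots> = (\<Sum>(m, p)\<in>?S1. ln (real p))" using finB by (intro sum.Sigma) auto
    also have "\<dots> \<le> (\<Sum>(n, p)\<in>?S2. ln (real p))"
    proof (rule sum_le_included[where i = "\<lambda>(n, p). (n div p, p)"])
      show "finite ?S1" using finB by (intro finite_SigmaI) auto
      show "finite ?S2" using finB by (intro finite_SigmaI) (auto simp: B_def)
      show "\<forall>y\<in>?S2. 0 \<le> (case y of (n, p) \<Rightarrow> ln (real p))" using prime_ge_1_nat by auto
      show "\<forall>x\<in>?S1. \<exists>y\<in>?S2. (case y of (n, p) \<Rightarrow> (n div p, p)) = x \<and>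
         (case x of (m, p) \<Rightarrow> ln (real p)) \<le> (case y of (n, p) \<Rightarrow> ln (real p))"
      proof
        fix x assume "x \<in> ?S1"
        then obtain m p where x: "x = (m, p)" "m \<in> B" "1 \<le> p" "p \<le> N div m" "prime p" "p mod 4 = 1" by auto
        have "m \<ge> 1" using x by (auto simp: B_def)
        hence "p * m \<le> N" using x by (simp add: less_eq_div_iff_mult_less_eq)
        moreover have "p * m \<in> norms"
          using x by (auto simp: B_def norms_def composed_of_mult_iff composed_of_prime_iff)
        ultimately have "p * m \<in> B" using x \<open>m \<ge> 1\<close> by (auto simp: B_def)
        thus "\<exists>y\<in>?S2. (case y of (n, p) \<Rightarrow> (n div p, p)) = x \<and>
         (case x of (m, p) \<Rightarrow> ln (real p)) \<le> (case y of (n, p) \<Rightarrow> ln (real p))"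
          using x by (intro bexI[of _ "(p * m, p)"]) auto
      qed
    qed
    also have "\<dots> = (\<Sum>n\<in>B. \<Sum>p | p \<in> primes_1_mod_4 \<and> prime p \<and> p dvd n. ln (real p))"
      using finB by (intro sum.Sigma[symmetric]) (auto simp: B_def)
    also have "\<dots> \<le> (\<Sum>n\<in>B. ln (real N))"
    proof (intro sum_mono)
      fix n assume n: "n \<in> B"
      have "(\<Sum>p | p \<in> primes_1_mod_4 \<and> prime p \<and> p dvd n. ln (real p)) \<le> ln (real n)"
        using n by (intro sum_ln_prime_divisors_le) (auto simp: B_def)
      also have "\<dots> \<le> ln (real N)" using n by (auto simp: B_def)
      finally show "(\<Sum>p | p \<in> primes_1_mod_4 \<and> prime p \<and> p dvd n. ln (real p)) \<le> ln (real N)" .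
    qed
    also have "\<dots> = real (card B) * ln (real N)" by simp
    finally have main: "real N / 2 * c1 * (c2 * sqrt (ln (real N) / 2)) \<le> real (card B) * ln (real N)" .
    have "sqrt (ln (real N)) / 2 \<le> sqrt (ln (real N) / 2)"
      by (rule real_le_rsqrt) (use lnN in \<open>auto simp: power_divide\<close>)
    hence "real N / 2 * c1 * (c2 * (sqrt (ln (real N)) / 2)) \<le> real N / 2 * c1 * (c2 * sqrt (ln (real N) / 2))"
      using c1 c2 by (intro mult_left_mono) auto
    hence "c1 * c2 / 4 * real N * sqrt (ln (real N)) \<le> real (card B) * sqrt (ln (real N)) * sqrt (ln (real N))"
      using main lnN by (simp add: mult.assoc)
    hence "c1 * c2 / 4 * real N \<le> real (card B) * sqrt (ln (real N))"
      by (rule mult_right_le_imp_le) (use lnN in simp)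
    thus ?thesis using lnN unfolding B_def[symmetric] by (simp add: field_simps)
  qed
  thus ?thesis using c1 c2 by (intro exI[of _ "c1 * c2 / 4"] conjI exI[of _ "4 * y\<^sup>2"]) auto
qed

section \<open>Upper bound for pairs with a given difference\<close>

lemma power2_card_le_prod:
  assumes "finite I" "\<And>p. p \<in> I \<Longrightarrow> (p::nat) \<ge> 2"
  shows "2 ^ card I \<le> \<Prod>I"
proof -
  have "(\<Prod>p\<in>I. 2) \<le> (\<Prod>p\<in>I. p)" using assms by (intro prod_mono) auto
  thus ?thesis by simp
qed

text \<open>Primes dividing \<open>h\<close> are left out, as their two forbidden classes coincide.
  The sieve runs to level \<open>s\<^sup>2\<close> because its denominator is compared with the
  square of a reciprocal sum up to \<open>s\<close>; the square of 2 for the square parts and a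
  further 2 for the common parts give 8. The error is \<open>s ^ 4\<close> per pair of sets, times
  the square of a total weight of at most \<open>s ^ 4\<close>.\<close>

lemma norms_pairs_sieve:
  fixes h N s :: nat
  assumes s: "s \<ge> 1"
  shows "real (card {a\<in>{1..N}. a \<in> norms \<and> a + h \<in> norms}) \<le>
     8 * real N / (recip_sum {p \<in> primes_3_mod_4. \<not> p dvd h} s)\<^sup>2 + real s ^ 12"
proof -
  define P where "P = {p \<in> primes_3_mod_4. \<not> p dvd h}"
  define D where "D = prime_sets P (s\<^sup>2)"
  define w where "w = (\<lambda>p. 2 / real p)"
  define hits where "hits = (\<lambda>p a. p dvd a * (a + h))"
  define G where "G = (\<Sum>I\<in>D. \<Prod>p\<in>I. w p / (1 - w p))"
  have ge3: "p \<ge> 3" if "p \<in> P" for p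
  proof -
    have "p mod 4 = 3" using that by (simp add: P_def)
    thus ?thesis by presburger
  qed
  have D: "finite I" "I \<subseteq> P" "\<Prod>I \<le> s\<^sup>2" if "I \<in> D" for I
    using that by (auto simp: D_def prime_sets_def)
  have emptyD: "{} \<in> D" using s by (simp add: D_def prime_sets_def)
  have w: "0 < w p \<and> w p < 1" if "p \<in> P" for p
    using ge3[OF that] by (simp add: w_def)
  have "real (card {a \<in> {1..N}. a \<in> norms \<and> a + h \<in> norms}) \<le> real (card {a \<in> {1..N}. \<forall>p\<in>\<Union>D. \<not> hits p a})"
  proof (intro of_nat_mono card_mono)
    show "{a \<in> {1..N}. a \<in> norms \<and> a + h \<in> norms} \<subseteq> {a \<in> {1..N}. \<forall>p\<in>\<Union>D. \<not> hits p a}"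
    proof safe
      fix a I p assume a: "a \<in> norms" "a + h \<in> norms" and p: "I \<in> D" "p \<in> I" "hits p a"
      have pr: "prime p" "p mod 4 = 3" using p D(2) by (auto simp: P_def)
      hence "p dvd a \<or> p dvd a + h" using p by (auto simp: hits_def prime_dvd_mult_iff)
      hence "p \<in> insert 2 primes_1_mod_4" using a pr by (auto simp: norms_def composed_of_def)
      thus False using pr by auto
    qed
  qed auto
  also have "\<dots> \<le> real N / G + real s ^ 4 * (\<Sum>I\<in>D. \<Prod>p\<in>I. 1 / (1 - w p))\<^sup>2"
    unfolding G_def
  proof (rule selberg_sieve)
    show "finite D" by (simp add: D_def)
    show "J \<in> D" if "I \<in> D" "J \<subseteq> I" for I J using that prime_sets_downward by (auto simp: D_def)
    show "0 < w p \<and> w p < 1" if "I \<in> D" "p \<in> I" for p I using that D w by blast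
    show "\<bar>real (card {a \<in> {1..N}. \<forall>p\<in>I \<union> J. hits p a}) - real N * (\<Prod>p\<in>I \<union> J. w p)\<bar> \<le> real s ^ 4"
      if I: "I \<in> D" and J: "J \<in> D" for I J
    proof -
      have "\<bar>real (card {a \<in> {1..N}. \<forall>p\<in>I \<union> J. hits p a}) - real N * (\<Prod>p\<in>I \<union> J. w p)\<bar> \<le> 2 ^ card (I \<union> J)"
        unfolding hits_def w_def
        using D[OF I] D[OF J] by (intro card_hits_pair) (auto simp: P_def)
      also have "\<dots> \<le> real (2 ^ card I * 2 ^ card J)"
        using card_Un_le[of I J] by (simp flip: power_add)
      also have "\<dots> \<le> real (s\<^sup>2 * s\<^sup>2)"
      proof (intro of_nat_mono mult_mono)
        have ge2: "p \<ge> 2" if "p \<in> P" for p using ge3[OF that] by simp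
        show "2 ^ card I \<le> s\<^sup>2"
          using power2_card_le_prod[of I] D[OF I] ge2 by (meson order_trans subsetD)
        show "2 ^ card J \<le> s\<^sup>2"
          using power2_card_le_prod[of J] D[OF J] ge2 by (meson order_trans subsetD)
      qed auto
      also have "\<dots> = real s ^ 4" by (simp flip: power_add)
      finally show ?thesis .
    qed
  qed (use D emptyD in auto)
  also have "real s ^ 4 * (\<Sum>I\<in>D. \<Prod>p\<in>I. 1 / (1 - w p))\<^sup>2 \<le> real s ^ 4 * (real s ^ 4)\<^sup>2"
  proof (intro mult_left_mono power_mono)
    have "(\<Sum>I\<in>D. \<Prod>p\<in>I. 1 / (1 - w p)) \<le> (\<Sum>I\<in>D. real (s\<^sup>2))"
    proof (intro sum_mono)
      fix I assume I: "I \<in> D"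
      have "(\<Prod>p\<in>I. 1 / (1 - w p)) \<le> (\<Prod>p\<in>I. real p)"
      proof (intro prod_mono conjI)
        fix p assume "p \<in> I"
        hence p: "real p \<ge> 3" using D[OF I] ge3[of p] by auto
        have "1 - w p = (real p - 2) / real p" using p by (simp add: w_def field_simps)
        hence eq: "1 / (1 - w p) = real p / (real p - 2)" by simp
        show "0 \<le> 1 / (1 - w p)" unfolding eq using p by simp
        have "real p * 1 \<le> real p * (real p - 2)" using p by (intro mult_left_mono) auto
        thus "1 / (1 - w p) \<le> real p" unfolding eq using p by (simp add: divide_le_eq)
      qed
      also have "\<dots> = real (\<Prod>I)" by simp
      also have "\<dots> \<le> real (s\<^sup>2)" using D(3)[OF I] by (simp only: of_nat_le_iff)
      finally show "(\<Prod>p\<in>I. 1 / (1 - w p)) \<le> real (s\<^sup>2)" .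
    qed
    also have "\<dots> = real (card D) * real (s\<^sup>2)" by simp
    also have "\<dots> \<le> real (s\<^sup>2) * real (s\<^sup>2)"
      unfolding D_def by (intro mult_right_mono of_nat_mono card_prime_sets_le) auto
    also have "\<dots> = real s ^ 4" by (simp flip: power_add)
    finally show "(\<Sum>I\<in>D. \<Prod>p\<in>I. 1 / (1 - w p)) \<le> real s ^ 4" .
    show "0 \<le> (\<Sum>I\<in>D. \<Prod>p\<in>I. 1 / (1 - w p))"
    proof (intro sum_nonneg prod_nonneg)
      fix I p assume "I \<in> D" "p \<in> I"
      hence "w p < 1" using D w by blast
      thus "0 \<le> 1 / (1 - w p)" by simp
    qed
  qed auto
  also have "real s ^ 4 * (real s ^ 4)\<^sup>2 = real s ^ 12" by (simp flip: power_mult power_add)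
  also have "real N / G \<le> 8 * real N / (recip_sum P s)\<^sup>2"
  proof -
    have "(recip_sum P s)\<^sup>2 \<le> (2 * (\<Sum>I\<in>prime_sets P s. 1 / real (\<Prod>I)))\<^sup>2"
      by (intro power_mono recip_sum_le_prime_sets recip_sum_nonneg)
    also have "\<dots> = 4 * (\<Sum>I\<in>prime_sets P s. 1 / real (\<Prod>I))\<^sup>2" by (simp add: power_mult_distrib)
    also have "\<dots> \<le> 4 * (2 * (\<Sum>I\<in>D. \<Prod>p\<in>I. 2 / real p))"
      unfolding D_def by (intro mult_left_mono square_sum_prime_sets_le) auto
    also have "(\<Sum>I\<in>D. \<Prod>p\<in>I. 2 / real p) \<le> G"
      unfolding G_def
    proof (intro sum_mono prod_mono conjI)
      fix I p assume "I \<in> D" "p \<in> I"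
      hence "0 < w p" "w p < 1" using D w by blast+
      hence "w p / 1 \<le> w p / (1 - w p)" by (intro divide_left_mono) auto
      thus "2 / real p \<le> w p / (1 - w p)" by (simp add: w_def)
    qed auto
    finally have le: "(recip_sum P s)\<^sup>2 \<le> 8 * G" by simp
    have "recip_sum P s \<ge> 1" using recip_sum_ge_1 s by blast
    hence pos: "(recip_sum P s)\<^sup>2 > 0" by simp
    hence "8 * real N / (8 * G) \<le> 8 * real N / (recip_sum P s)\<^sup>2"
      using le order_less_le_trans[OF pos le] by (intro divide_left_mono mult_pos_pos) auto
    thus ?thesis by simp
  qed
  finally show ?thesis by (simp add: P_def)
qed

text \<open>Restores the primes dividing \<open>h\<close>: each costs the square of
  \<open>1 / (1 - 1 / p)\<close>, which is at most \<open>1 + 4 / p\<close> from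
  \<open>p = 3\<close> on.\<close>

lemma recip_sum_coprime_part_ge:
  fixes h s :: nat
  assumes h: "h > 0" and s: "s \<ge> 1"
  shows "(recip_sum primes_3_mod_4 s)\<^sup>2 \<le> (recip_sum {p \<in> primes_3_mod_4. \<not> p dvd h} s)\<^sup>2 * (\<Prod>p | p \<in> primes_3_mod_4 \<and> p dvd h. 1 + 4 / real p)"
proof -
  define F where "F = {p. p \<in> primes_3_mod_4 \<and> p dvd h}"
  define P where "P = {p \<in> primes_3_mod_4. \<not> p dvd h}"
  have finF: "finite F" unfolding F_def by (rule finite_subset[of _ "{d. d dvd h}"]) (use h in auto)
  have un: "primes_3_mod_4 = F \<union> P" by (auto simp: F_def P_def)
  have "recip_sum primes_3_mod_4 s \<le> recip_sum F s * recip_sum P s" unfolding un by (rule recip_sum_Un)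
  also have "\<dots> \<le> (\<Prod>p\<in>F. 1 / (1 - 1 / real p)) * recip_sum P s"
    by (intro mult_right_mono recip_sum_le_prod recip_sum_nonneg finF) (auto simp: F_def)
  finally have "(recip_sum primes_3_mod_4 s)\<^sup>2 \<le> ((\<Prod>p\<in>F. 1 / (1 - 1 / real p)) * recip_sum P s)\<^sup>2"
    by (intro power_mono recip_sum_nonneg)
  also have "\<dots> = (recip_sum P s)\<^sup>2 * (\<Prod>p\<in>F. (1 / (1 - 1 / real p))\<^sup>2)"
    by (simp add: power_mult_distrib prod_power_distrib mult.commute)
  also have "\<dots> \<le> (recip_sum P s)\<^sup>2 * (\<Prod>p\<in>F. 1 + 4 / real p)"
  proof (intro mult_left_mono prod_mono conjI)
    fix p assume p: "p \<in> F"
    have "p mod 4 = 3" using p by (simp add: F_def)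
    hence "p \<ge> 3" by presburger
    hence p3: "real p \<ge> 3" by simp
    have eq: "1 / (1 - 1 / real p) = real p / (real p - 1)" using p3 by (simp add: field_simps)
    have "real p ^ 3 \<le> (real p + 4) * (real p - 1)\<^sup>2"
    proof -
      \<comment> \<open>Expanded around 3, the smallest admissible prime, so that positivity is
        visible.\<close>
      have "(real p + 4) * (real p - 1)\<^sup>2 - real p ^ 3 = 2 * (real p - 3)\<^sup>2 + 5 * (real p - 3) + 1"
        by (simp add: power2_eq_square power3_eq_cube algebra_simps)
      also have "\<dots> \<ge> 0" using p3 by (intro add_nonneg_nonneg) auto
      finally show ?thesis by simp
    qed
    hence "(real p)\<^sup>2 * real p \<le> (real p + 4) * (real p - 1)\<^sup>2" by (simp add: power2_eq_square power3_eq_cube)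
    hence "(real p)\<^sup>2 / (real p - 1)\<^sup>2 \<le> (real p + 4) / real p"
      using p3 by (simp add: divide_le_eq le_divide_eq)
    also have "\<dots> = 1 + 4 / real p" using p3 by (simp add: field_simps)
    finally show "(1 / (1 - 1 / real p))\<^sup>2 \<le> 1 + 4 / real p" unfolding eq by (simp add: power_divide)
  qed auto
  finally show ?thesis by (simp add: F_def P_def)
qed

lemma card_norms_pairs_le:
  "\<exists>C>0. \<exists>N0. \<forall>N\<ge>N0. \<forall>h>0. real (card {a\<in>{1..N}. a \<in> norms \<and> a + h \<in> norms}) \<le>
     C * (real N / ln (real N)) * (\<Prod>p | p \<in> primes_3_mod_4 \<and> p dvd h. 1 + 4 / real p)"
proof -
  obtain c where c: "c > 0" "\<And>N. N \<ge> 2 \<Longrightarrow> c * sqrt (ln (real N)) \<le> recip_sum primes_3_mod_4 N"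
    using recip_sum_3_mod_4_ge by blast
  \<comment> \<open>\<open>384 = 8 * 48\<close>: 8 from the sieve and 48 from
    \<open>ln s \<ge> ln N / 48\<close>. The 2 comes from \<open>sqrt N \<le> 2 * N / ln N\<close>
    in the error term.\<close>
  define C where "C = 384 / c\<^sup>2 + 2"
  have "real (card {a\<in>{1..N}. a \<in> norms \<and> a + h \<in> norms}) \<le>
     C * (real N / ln (real N)) * (\<Prod>p | p \<in> primes_3_mod_4 \<and> p dvd h. 1 + 4 / real p)"
    if N: "N \<ge> 2 ^ 48" and h: "h > 0" for N h
  proof -
    define g where "g = (\<Prod>p | p \<in> primes_3_mod_4 \<and> p dvd h. 1 + 4 / real p)"
    define R where "R = recip_sum {p \<in> primes_3_mod_4. \<not> p dvd h}"
    have g1: "g \<ge> 1" unfolding g_def by (intro prod_ge_1) auto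
    have N1: "real N \<ge> 2 ^ 48" using N by (metis of_nat_le_iff of_nat_numeral of_nat_power)
    have lnN: "ln (real N) > 0" using N1 by simp
    \<comment> \<open>The exponent turns the error \<open>s ^ 12\<close> into at most
      \<open>sqrt N\<close>. From \<open>N \<ge> 2 ^ 48\<close> follows \<open>x \<ge> 4\<close>,
      which allows rounding down with \<open>s \<ge> sqrt x\<close>.\<close>
    define x where "x = real N powr (1 / 24)"
    have x2: "x \<ge> 4"
    proof -
      have "(2 ^ 48) powr (1 / 24) \<le> x" unfolding x_def using N1 by (intro powr_mono2) auto
      moreover have "(2 ^ 48 :: real) = 2 powr 48" by (simp add: powr_numeral)
      hence "(2 ^ 48 :: real) powr (1 / 24) = 2 powr 2" by (simp only: powr_powr) simp
      ultimately show ?thesis by simp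
    qed
    define s where "s = nat \<lfloor>x\<rfloor>"
    have s: "real s \<le> x" "x < real s + 1" using x2 by (auto simp: s_def)
    have s2: "s \<ge> 2" using s x2 by linarith
    have xs: "sqrt x \<le> real s"
    proof -
      have "sqrt x \<ge> 2" using x2 by (intro real_le_rsqrt) auto
      hence "2 * sqrt x \<le> sqrt x * sqrt x" using x2 by (intro mult_right_mono) auto
      hence "2 * sqrt x \<le> x" using x2 by simp
      thus ?thesis using s \<open>sqrt x \<ge> 2\<close> by linarith
    qed
    have "ln (sqrt x) \<le> ln (real s)" using xs x2 s2 by (subst ln_le_cancel_iff) auto
    moreover have "ln (sqrt x) = ln (real N) / 48"
      using x2 N1 by (simp add: ln_sqrt) (simp add: x_def ln_powr)
    ultimately have lns: "ln (real N) / 48 \<le> ln (real s)" by simp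
    have Rpos: "R s \<ge> 1" unfolding R_def using s2 by (intro recip_sum_ge_1) auto
    have "c\<^sup>2 * (ln (real N) / 48) \<le> c\<^sup>2 * ln (real s)" using lns by (intro mult_left_mono) auto
    also have "\<dots> = (c * sqrt (ln (real s)))\<^sup>2" using s2 by (simp add: power_mult_distrib)
    also have "\<dots> \<le> (recip_sum primes_3_mod_4 s)\<^sup>2" using c s2 by (intro power_mono) auto
    also have "\<dots> \<le> (R s)\<^sup>2 * g" unfolding R_def g_def using h s2 by (intro recip_sum_coprime_part_ge) auto
    finally have key: "c\<^sup>2 * (ln (real N) / 48) \<le> (R s)\<^sup>2 * g" .
    have "8 * real N / (R s)\<^sup>2 \<le> 384 / c\<^sup>2 * (real N / ln (real N)) * g"
    proof -
      have "8 * real N * (c\<^sup>2 * (ln (real N) / 48)) \<le> 8 * real N * ((R s)\<^sup>2 * g)"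
        using key by (intro mult_left_mono) auto
      thus ?thesis using c(1) lnN Rpos by (simp add: field_simps)
    qed
    moreover have "real s ^ 12 \<le> 2 * (real N / ln (real N)) * g"
    proof -
      have "real s ^ 12 \<le> x ^ 12" using s by (intro power_mono) auto
      also have "x ^ 12 = sqrt (real N)"
        using N1 by (simp add: x_def powr_power powr_half_sqrt)
      also have "sqrt (real N) \<le> 2 * (real N / ln (real N))"
      proof -
        have sq: "sqrt (real N) > 0" using N1 by simp
        have "ln (real N) = 2 * ln (sqrt (real N))" using N1 by (simp add: ln_sqrt)
        also have "\<dots> \<le> 2 * sqrt (real N)" using ln_le_minus_one[OF sq] by simp
        finally have "sqrt (real N) * ln (real N) \<le> sqrt (real N) * (2 * sqrt (real N))"
          using sq by (intro mult_left_mono) auto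
        also have "\<dots> = 2 * real N" using N1 by simp
        finally show ?thesis using lnN by (simp add: le_divide_eq)
      qed
      also have "\<dots> \<le> 2 * (real N / ln (real N)) * g"
        using g1 lnN mult_left_mono[of 1 g "2 * (real N / ln (real N))"] by simp
      finally show ?thesis .
    qed
    moreover have "real (card {a\<in>{1..N}. a \<in> norms \<and> a + h \<in> norms}) \<le> 8 * real N / (R s)\<^sup>2 + real s ^ 12"
      unfolding R_def using s2 by (intro norms_pairs_sieve) auto
    ultimately have "real (card {a\<in>{1..N}. a \<in> norms \<and> a + h \<in> norms}) \<le>
        384 / c\<^sup>2 * (real N / ln (real N)) * g + 2 * (real N / ln (real N)) * g" by linarith
    thus ?thesis unfolding g_def[symmetric] C_def by (simp only: distrib_right)
  qed
  moreover have "C > 0" using c(1) by (auto simp: C_def intro: add_pos_pos)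
  ultimately show ?thesis by blast
qed

section \<open>Romanoff's average\<close>

lemma card_divisors_le: 
  assumes "e > 0"
  shows "real (card {d::nat. d dvd e}) \<le> 2 * sqrt (real e)"
proof -
  define s where "s = floor_sqrt e"
  have "{d. d dvd e} \<subseteq> {1..s} \<union> (\<lambda>d. e div d) ` {1..s}"
  proof
    fix d assume "d \<in> {d. d dvd e}"
    then obtain k where k: "e = d * k" by auto
    have pos: "d > 0" "k > 0" using k assms by auto
    show "d \<in> {1..s} \<union> (\<lambda>d. e div d) ` {1..s}"
    proof (cases "d \<le> s")
      case True
      thus ?thesis using pos by auto
    next
      case False
      have "k \<le> s"
      proof (rule ccontr)
        assume "\<not> k \<le> s"
        with False have "Suc s * Suc s \<le> d * k" by (intro mult_le_mono) auto
        moreover have "e < (Suc s)\<^sup>2" unfolding s_def by (rule Suc_floor_sqrt_power2_gt)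
        ultimately show False using k by (simp add: power2_eq_square)
      qed
      moreover have "d = e div k" using k pos by simp
      ultimately show ?thesis using pos by (intro UnI2 image_eqI[of _ _ k]) auto
    qed
  qed
  hence "card {d. d dvd e} \<le> card ({1..s} \<union> (\<lambda>d. e div d) ` {1..s})" by (intro card_mono) auto
  also have "\<dots> \<le> card {1..s} + card ((\<lambda>d. e div d) ` {1..s})" by (rule card_Un_le)
  also have "\<dots> \<le> s + s" using card_image_le[of "{1..s}" "\<lambda>d. e div d"] by simp
  finally have "real (card {d. d dvd e}) \<le> 2 * real s" by linarith
  moreover have "real s \<le> sqrt (real e)"
  proof (rule real_le_rsqrt)
    have "s\<^sup>2 \<le> e" by (simp add: s_def)
    thus "(real s)\<^sup>2 \<le> real e" by (metis of_nat_le_iff of_nat_power)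
  qed
  ultimately show ?thesis by linarith
qed

lemma card_multiples_le:
  assumes "u > 0"
  shows "real (card {x\<in>{1..M}. u dvd x}) \<le> real M / real (u::nat)"
proof -
  have "{x\<in>{1..M}. u dvd x} \<subseteq> (\<lambda>k. u * k) ` {1..M div u}"
  proof
    fix x assume x: "x \<in> {x\<in>{1..M}. u dvd x}"
    then obtain k where k: "x = u * k" by auto
    have "k \<ge> 1" using k x by (cases k) auto
    moreover have "k \<le> M div u" using k x assms by (simp add: less_eq_div_iff_mult_less_eq mult.commute)
    ultimately show "x \<in> (\<lambda>k. u * k) ` {1..M div u}" using k by auto
  qed
  hence "card {x\<in>{1..M}. u dvd x} \<le> card ((\<lambda>k. u * k) ` {1..M div u})" by (intro card_mono) auto
  also have "\<dots> \<le> M div u" using card_image_le[of "{1..M div u}" "\<lambda>k. u * k"] by simp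
  finally show ?thesis using of_nat_div_le_of_nat[of M u, where ?'a = real] by linarith
qed

definition index_pairs :: "nat \<Rightarrow> (nat \<times> nat) set" where
  "index_pairs M = {(k, n). k < n \<and> n \<le> M}"

lemma finite_index_pairs [simp]: "finite (index_pairs M)"
  by (rule finite_subset[of _ "{..M} \<times> {..M}"]) (auto simp: index_pairs_def)

text \<open>If \<open>e\<close> divides \<open>(n - k) (n + k)\<close>, split \<open>e = u v\<close> with \<open>u\<close> dividing \<open>n - k\<close> and \<open>v\<close>
  dividing \<open>n + k\<close>. As both factors are positive, no error term arises even for large \<open>e\<close>.\<close>
lemma card_index_pairs_dvd_le:
  assumes e: "e > 0"
  shows "real (card {z \<in> index_pairs M. e dvd (snd z)\<^sup>2 - (fst z)\<^sup>2}) \<le> 4 * (real M)\<^sup>2 / sqrt (real e)"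
proof -
  define Z where "Z = {z \<in> index_pairs M. e dvd (snd z)\<^sup>2 - (fst z)\<^sup>2}"
  define B where "B = (\<lambda>u. {x\<in>{1..M}. u dvd x} \<times> {y\<in>{1..2*M}. e div u dvd y})"
  define f where "f = (\<lambda>(k::nat, n::nat). (n - k, n + k))"
  have "inj_on f (index_pairs M)"
    by (rule inj_onI) (auto simp: f_def index_pairs_def)
  hence inj: "inj_on f Z" by (rule inj_on_subset) (auto simp: Z_def)
  have fin: "finite {u. u dvd e}" using e by simp
  have sub: "f ` Z \<subseteq> (\<Union>u\<in>{u. u dvd e}. B u)"
  proof
    fix w assume "w \<in> f ` Z"
    then obtain k n where kn: "k < n" "n \<le> M" "e dvd n\<^sup>2 - k\<^sup>2" "w = (n - k, n + k)"
      by (auto simp: Z_def index_pairs_def f_def)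
    have "n\<^sup>2 - k\<^sup>2 = (n - k) * (n + k)"
      using kn(1) by (simp add: power2_eq_square algebra_simps diff_mult_distrib diff_mult_distrib2)
    hence "e dvd (n - k) * (n + k)" using kn(3) by simp
    then obtain u v where uv: "e = u * v" "u dvd n - k" "v dvd n + k"
      using division_decomp by blast
    have "u > 0" using uv e by auto
    hence "e div u = v" using uv by simp
    hence "w \<in> B u" using kn uv by (auto simp: B_def)
    thus "w \<in> (\<Union>u\<in>{u. u dvd e}. B u)" using uv by (intro UN_I[of u]) auto
  qed
  have "card Z = card (f ` Z)" using inj by (simp add: card_image)
  also have "\<dots> \<le> card (\<Union>u\<in>{u. u dvd e}. B u)"
    using sub fin by (intro card_mono) (auto simp: B_def)
  also have "\<dots> \<le> (\<Sum>u | u dvd e. card (B u))" using fin by (intro card_UN_le)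
  finally have "real (card Z) \<le> (\<Sum>u | u dvd e. real (card (B u)))" by (metis of_nat_le_iff of_nat_sum)
  also have "\<dots> \<le> (\<Sum>u | u dvd e. 2 * (real M)\<^sup>2 / real e)"
  proof (intro sum_mono)
    fix u assume "u \<in> {u. u dvd e}"
    then obtain v where v: "e = u * v" by auto
    have pos: "u > 0" "v > 0" using v e by auto
    have "real (card (B u)) = real (card {x\<in>{1..M}. u dvd x}) * real (card {y\<in>{1..2*M}. v dvd y})"
      using pos by (simp add: B_def card_cartesian_product v)
    also have "\<dots> \<le> real M / real u * (real (2 * M) / real v)"
      using pos by (intro mult_mono card_multiples_le) auto
    also have "\<dots> = 2 * (real M)\<^sup>2 / real e" by (simp add: v power2_eq_square)
    finally show "real (card (B u)) \<le> 2 * (real M)\<^sup>2 / real e" .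
  qed
  also have "\<dots> = real (card {u. u dvd e}) * (2 * (real M)\<^sup>2 / real e)" by simp
  also have "\<dots> \<le> 2 * sqrt (real e) * (2 * (real M)\<^sup>2 / real e)"
    using card_divisors_le[OF e] by (intro mult_right_mono) auto
  also have "\<dots> = 4 * (real M)\<^sup>2 / sqrt (real e)"
  proof -
    have "2 * sqrt (real e) * (2 * (real M)\<^sup>2 / real e) = 4 * (real M)\<^sup>2 * (sqrt (real e) / real e)" by simp
    also have "sqrt (real e) / real e = 1 / sqrt (real e)" by (simp add: sqrt_divide_self_eq inverse_eq_divide)
    finally show ?thesis by simp
  qed
  finally show ?thesis by (simp add: Z_def)
qed

text \<open>These primes are the prime divisors of \<open>2 ^ i - 1\<close>. Each is at least 2, and
  the product of the distinct ones is at most \<open>2 ^ i\<close>.\<close>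

lemma card_primes_order_dvd_le:
  assumes "i > 0"
  shows "finite {p. prime p \<and> ord p (2::nat) dvd i}" "card {p. prime p \<and> ord p (2::nat) dvd i} \<le> i"
proof -
  have two: "2 \<le> (2::nat) ^ i" using assms power_increasing[of 1 i "2::nat"] by simp
  define n where "n = (2::nat) ^ i - 1"
  have n: "n > 0" using two by (simp add: n_def)
  have eq: "{p. prime p \<and> ord p (2::nat) dvd i} = {p. p \<in> UNIV \<and> prime p \<and> p dvd n}"
  proof -
    have "ord p 2 dvd i \<longleftrightarrow> p dvd n" for p
    proof -
      have "ord p 2 dvd i \<longleftrightarrow> [2 ^ i = 1] (mod p)" by (rule ord_divides[symmetric])
      also have "\<dots> \<longleftrightarrow> p dvd n" unfolding n_def using two by (intro cong_altdef_nat) auto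
      finally show ?thesis .
    qed
    thus ?thesis by simp
  qed
  have fin: "finite {p. p \<in> UNIV \<and> prime p \<and> p dvd n}"
    by (rule finite_subset[of _ "{d. d dvd n}"]) (use n in auto)
  thus "finite {p. prime p \<and> ord p (2::nat) dvd i}" unfolding eq .
  have "real (card {p. p \<in> UNIV \<and> prime p \<and> p dvd n}) * ln 2 = (\<Sum>p | p \<in> UNIV \<and> prime p \<and> p dvd n. ln 2)" by simp
  also have "\<dots> \<le> (\<Sum>p | p \<in> UNIV \<and> prime p \<and> p dvd n. ln (real p))"
  proof (intro sum_mono)
    fix p assume "p \<in> {p. p \<in> UNIV \<and> prime p \<and> p dvd n}"
    hence "real p \<ge> 2" using prime_ge_2_nat[of p] by auto
    thus "ln 2 \<le> ln (real p)" by simp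
  qed
  also have "\<dots> \<le> ln (real n)" by (rule sum_ln_prime_divisors_le[OF n])
  also have "\<dots> \<le> ln (2 ^ i)"
  proof -
    have "n \<le> 2 ^ i" by (simp add: n_def)
    hence "real n \<le> 2 ^ i" by (metis of_nat_le_iff of_nat_numeral of_nat_power)
    thus ?thesis using n by simp
  qed
  also have "\<dots> = real i * ln 2" by (simp add: ln_realpow)
  finally have "real (card {p. p \<in> UNIV \<and> prime p \<and> p dvd n}) * ln 2 \<le> real i * ln 2" .
  hence "real (card {p. p \<in> UNIV \<and> prime p \<and> p dvd n}) \<le> real i"
    by (rule mult_right_le_imp_le) simp
  thus "card {p. prime p \<and> ord p (2::nat) dvd i} \<le> i" unfolding eq by simp
qed

section \<open>Euler products over primes with small order of 2\<close>

lemma ord_2_pos: "p \<in> primes_3_mod_4 \<Longrightarrow> ord p (2::nat) > 0"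
proof -
  assume "p \<in> primes_3_mod_4"
  hence "p mod 4 = 3" by simp
  hence "odd p" by presburger
  thus ?thesis by simp
qed

text \<open>With \<open>x = 4 ^ j\<close> there are at most \<open>x\<^sup>2\<close> such primes.
  Those up to \<open>Y = x\<^sup>2 + 1\<close> have a reciprocal sum of at most
  \<open>ln (ln Y)\<close> plus a constant, and the others contribute at most 1 in total because
  there are fewer than \<open>Y\<close> of them. Exponentiating gives the fourth power of
  \<open>ln Y\<close>, which is linear in \<open>j\<close>; \<open>256 = 4 ^ 4\<close> stems from
  \<open>ln Y \<le> 4 * (j + 1)\<close>.\<close>

lemma prod_small_order_le:
  "\<exists>C>0. \<forall>j U. finite U \<longrightarrow> U \<subseteq> primes_3_mod_4 \<longrightarrow> (\<forall>p\<in>U. ord p (2::nat) \<le> 4 ^ j) \<longrightarrow>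
     (\<Prod>p\<in>U. 1 + 4 / real p) \<le> C * (real j + 1) ^ 4"
proof -
  obtain C where C: "C \<ge> 0" "\<And>N. N \<ge> 2 \<Longrightarrow> (\<Sum>p | p \<in> {1..N} \<and> prime p. 1 / real p) \<le> ln (ln (real N)) + C"
    using sum_recip_primes_le by blast
  show ?thesis
  proof (intro exI[of _ "exp (4 * (C + 1)) * 256"] conjI allI impI)
    fix j :: nat and U assume fin: "finite U" and U: "U \<subseteq> primes_3_mod_4" and small: "\<forall>p\<in>U. ord p (2::nat) \<le> 4 ^ j"
    define x :: nat where "x = 4 ^ j"
    define Y where "Y = x\<^sup>2 + 1"
    have x1: "x \<ge> 1" by (simp add: x_def)
    have Y2: "Y \<ge> 2" using x1 by (simp add: Y_def)
    have cardU: "card U \<le> x\<^sup>2"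
    proof -
      have "U \<subseteq> (\<Union>i\<in>{1..x}. {p. prime p \<and> ord p (2::nat) dvd i})"
      proof
        fix p assume p: "p \<in> U"
        hence "ord p (2::nat) \<in> {1..x}" using U small ord_2_pos[of p] by (auto simp: x_def Suc_le_eq)
        thus "p \<in> (\<Union>i\<in>{1..x}. {p. prime p \<and> ord p (2::nat) dvd i})"
          by (rule UN_I) (use p U in auto)
      qed
      hence "card U \<le> card (\<Union>i\<in>{1..x}. {p. prime p \<and> ord p (2::nat) dvd i})"
        by (rule card_mono[rotated]) (use card_primes_order_dvd_le(1) in auto)
      also have "\<dots> \<le> (\<Sum>i\<in>{1..x}. card {p. prime p \<and> ord p (2::nat) dvd i})" by (rule card_UN_le) simp
      also have "\<dots> \<le> (\<Sum>i\<in>{1..x}. x)"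
      proof (intro sum_mono)
        fix i assume "i \<in> {1..x}"
        thus "card {p. prime p \<and> ord p (2::nat) dvd i} \<le> x" using card_primes_order_dvd_le(2)[of i] by auto
      qed
      finally show ?thesis by (simp add: power2_eq_square)
    qed
    have "(\<Sum>p\<in>U. 1 / real p) \<le> ln (ln (real Y)) + C + 1"
    proof -
      have "(\<Sum>p\<in>U. 1 / real p) = (\<Sum>p\<in>U \<inter> {..Y}. 1 / real p) + (\<Sum>p\<in>U - {..Y}. 1 / real p)"
        using fin by (rule sum.Int_Diff)
      moreover have "(\<Sum>p\<in>U \<inter> {..Y}. 1 / real p) \<le> (\<Sum>p | p \<in> {1..Y} \<and> prime p. 1 / real p)"
        using U prime_ge_1_nat by (intro sum_mono2) auto
      moreover have "(\<Sum>p\<in>U - {..Y}. 1 / real p) \<le> 1"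
      proof -
        have "(\<Sum>p\<in>U - {..Y}. 1 / real p) \<le> (\<Sum>p\<in>U - {..Y}. 1 / real Y)"
          using Y2 by (intro sum_mono divide_left_mono) auto
        also have "\<dots> = real (card (U - {..Y})) / real Y" by simp
        also have "\<dots> \<le> real (x\<^sup>2) / real Y"
        proof (intro divide_right_mono of_nat_mono)
          have "card (U - {..Y}) \<le> card U" using fin by (intro card_mono) auto
          thus "card (U - {..Y}) \<le> x\<^sup>2" using cardU by linarith
        qed auto
        also have "\<dots> \<le> 1" by (simp add: Y_def divide_le_eq add_pos_nonneg)
        finally show ?thesis .
      qed
      ultimately show ?thesis using C(2)[OF Y2] by linarith
    qed
    note sum_le = this
    have lnY: "ln (real Y) > 0" using Y2 by simp
    have lnY_le: "ln (real Y) \<le> 4 * (real j + 1)"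
    proof -
      have "x\<^sup>2 \<ge> 1" using x1 by simp
      hence "Y \<le> 2 * x\<^sup>2" by (simp add: Y_def)
      also have "\<dots> = 2 ^ (4 * j + 1)"
      proof -
        have "x = 2 ^ (2 * j)" unfolding x_def by (simp add: power_mult)
        thus ?thesis by (simp flip: power_mult)
      qed
      finally have "real Y \<le> 2 ^ (4 * j + 1)" by (metis of_nat_le_iff of_nat_numeral of_nat_power)
      hence "ln (real Y) \<le> ln (2 ^ (4 * j + 1))" using Y2 by (subst ln_le_cancel_iff) auto
      also have "\<dots> = real (4 * j + 1) * ln 2" by (rule ln_realpow)
      also have "\<dots> \<le> real (4 * j + 1) * 1" using ln_le_minus_one[of 2] by (intro mult_left_mono) auto
      finally show ?thesis by simp
    qed
    have "(\<Prod>p\<in>U. 1 + 4 / real p) \<le> (\<Prod>p\<in>U. exp (4 / real p))"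
      by (intro prod_mono conjI exp_ge_add_one_self) auto
    also have "\<dots> = exp (4 * (\<Sum>p\<in>U. 1 / real p))" using fin by (simp add: exp_sum[symmetric] sum_distrib_left)
    also have "\<dots> \<le> exp (4 * (ln (ln (real Y)) + C + 1))" using sum_le by simp
    also have "\<dots> = exp (4 * (C + 1)) * exp (4 * ln (ln (real Y)))" by (simp add: exp_add[symmetric] algebra_simps)
    also have "exp (4 * ln (ln (real Y))) = ln (real Y) ^ 4"
      using lnY exp_of_nat_mult[of 4 "ln (ln (real Y))"] by simp
    also have "ln (real Y) ^ 4 \<le> (4 * (real j + 1)) ^ 4" using lnY lnY_le by (intro power_mono) auto
    also have "(4 * (real j + 1)) ^ 4 = 256 * (real j + 1) ^ 4" by (simp only: power_mult_distrib) simp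
    finally show "(\<Prod>p\<in>U. 1 + 4 / real p) \<le> exp (4 * (C + 1)) * 256 * (real j + 1) ^ 4" by simp
  qed auto
qed

lemma summable_power4_geometric: "summable (\<lambda>j. (real j + 1) ^ 4 * (2 / 2 ^ j))"
proof (rule summable_ratio_test[of "3 / 4" 9])
  fix j :: nat assume j: "9 \<le> j"
  \<comment> \<open>\<open>(j + 2) / (j + 1) \<le> 11 / 10\<close> holds from \<open>j = 9\<close>
    on, and \<open>(11 / 10) ^ 4 < 3 / 2\<close>; halving gives the ratio
    \<open>3 / 4\<close>.\<close>
  have "(real (Suc j) + 1) ^ 4 \<le> (11 / 10 * (real j + 1)) ^ 4" using j by (intro power_mono) auto
  also have "\<dots> = (11 / 10) ^ 4 * (real j + 1) ^ 4" by (rule power_mult_distrib)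
  also have "\<dots> \<le> 3 / 2 * (real j + 1) ^ 4" by (intro mult_right_mono) (auto simp: power_divide)
  finally have "(real (Suc j) + 1) ^ 4 * (2 / 2 ^ Suc j) \<le> 3 / 2 * (real j + 1) ^ 4 * (2 / 2 ^ Suc j)"
    by (intro mult_right_mono) auto
  also have "\<dots> = 3 / 4 * ((real j + 1) ^ 4 * (2 / 2 ^ j))" by simp
  finally show "norm ((real (Suc j) + 1) ^ 4 * (2 / 2 ^ Suc j)) \<le> 3 / 4 * norm ((real j + 1) ^ 4 * (2 / 2 ^ j))"
    by simp
qed simp

text \<open>It encodes simultaneous divisibility: all primes of \<open>I\<close> divide
  \<open>2 ^ n\<^sup>2 - 2 ^ k\<^sup>2\<close> exactly if this number divides
  \<open>n\<^sup>2 - k\<^sup>2\<close>, for odd primes and \<open>k < n\<close>.\<close>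

definition lcm_orders :: "nat set \<Rightarrow> nat" where
  "lcm_orders I = Lcm ((\<lambda>p. ord p 2) ` I)"

lemma lcm_orders_pos: "finite I \<Longrightarrow> I \<subseteq> primes_3_mod_4 \<Longrightarrow> lcm_orders I > 0"
proof -
  assume I: "finite I" "I \<subseteq> primes_3_mod_4"
  have "ord p (2::nat) \<noteq> 0" if "p \<in> I" for p
    using ord_2_pos[of p] that I(2) by blast
  hence "0 \<notin> (\<lambda>p. ord p (2::nat)) ` I" by (metis imageE)
  hence "lcm_orders I \<noteq> 0" unfolding lcm_orders_def using I(1) by (simp add: Lcm_0_iff)
  thus ?thesis by simp
qed

text \<open>Partial summation over powers of 4: for the least \<open>j\<close> with
  \<open>e \<le> 4 ^ j\<close>, minimality gives \<open>sqrt e > 2 ^ (j - 1)\<close> if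
  \<open>j > 0\<close>, so this one term already suffices.\<close>

lemma inverse_sqrt_le_dyadic:
  fixes e J :: nat
  assumes "e \<ge> 1" "e \<le> 4 ^ J"
  shows "1 / sqrt (real e) \<le> (\<Sum>j\<le>J. if e \<le> 4 ^ j then 2 / 2 ^ j else 0)"
proof -
  define j where "j = (LEAST j. e \<le> 4 ^ j)"
  have j: "e \<le> 4 ^ j" unfolding j_def using assms(2) by (rule LeastI)
  have jJ: "j \<le> J" unfolding j_def using assms(2) by (rule Least_le)
  have "1 / sqrt (real e) \<le> 2 / 2 ^ j"
  proof (cases j)
    case 0
    hence "e = 1" using j assms by simp
    thus ?thesis using 0 by simp
  next
    case (Suc i)
    hence "\<not> e \<le> 4 ^ i" using not_less_Least[of i "\<lambda>j. e \<le> 4 ^ j"] by (simp add: j_def)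
    hence "4 ^ i \<le> real e" by (metis less_imp_le not_le of_nat_le_iff of_nat_numeral of_nat_power)
    moreover have "(4::real) ^ i = (2 ^ i)\<^sup>2" by (simp add: power2_eq_square flip: power_mult_distrib)
    ultimately have "2 ^ i \<le> sqrt (real e)" by (intro real_le_rsqrt) simp
    hence "1 / sqrt (real e) \<le> 1 / 2 ^ i" by (intro divide_left_mono) (use assms in auto)
    thus ?thesis using Suc by simp
  qed
  also have "\<dots> = (if e \<le> 4 ^ j then 2 / 2 ^ j else 0)" using j by simp
  also have "\<dots> \<le> (\<Sum>j\<le>J. if e \<le> 4 ^ j then 2 / 2 ^ j else 0)"
    using jJ by (intro member_le_sum) auto
  finally show ?thesis .
qed

lemma prod_one_plus_eq_sum:
  fixes f :: "'b \<Rightarrow> real"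
  assumes "finite A"
  shows "(\<Prod>x\<in>A. 1 + f x) = (\<Sum>I\<in>Pow A. \<Prod>x\<in>I. f x)"
  using prod_add[OF assms, of f "\<lambda>_. 1"] by (simp add: add.commute)

text \<open>Erdos's argument for Romanoff's theorem: at most \<open>x\<^sup>2\<close> primes have order at most \<open>x\<close>, so
  the sets of primes whose orders have a least common multiple up to \<open>x\<close> contribute only a power
  of \<open>log x\<close>, and partial summation over powers of 4 converges.\<close>
lemma romanoff_sum_le:
  "\<exists>C>0. \<forall>U. finite U \<longrightarrow> U \<subseteq> primes_3_mod_4 \<longrightarrow>
     (\<Sum>I\<in>Pow U. (\<Prod>p\<in>I. 4 / real p) / sqrt (real (lcm_orders I))) \<le> C"
proof -
  obtain C where C: "C > 0" "\<And>j U. finite U \<Longrightarrow> U \<subseteq> primes_3_mod_4 \<Longrightarrow> (\<forall>p\<in>U. ord p (2::nat) \<le> 4 ^ j) \<Longrightarrow>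
     (\<Prod>p\<in>U. 1 + 4 / real p) \<le> C * (real j + 1) ^ 4"
    using prod_small_order_le by blast
  define g where "g = (\<lambda>j. (real j + 1) ^ 4 * (2 / 2 ^ j :: real))"
  have g0: "g j \<ge> 0" for j by (simp add: g_def)
  define f where "f = (\<lambda>I. \<Prod>p\<in>I. 4 / real p)"
  have f0: "f I \<ge> 0" for I unfolding f_def by (intro prod_nonneg) auto
  have *: "(\<Sum>I\<in>Pow U. f I / sqrt (real (lcm_orders I))) \<le> C * suminf g" if fin: "finite U" and U: "U \<subseteq> primes_3_mod_4" for U
  proof -
    define J where "J = Max (lcm_orders ` Pow U)"
    have pos: "lcm_orders I \<ge> 1" if "I \<in> Pow U" for I
      using lcm_orders_pos[of I] that fin U by (auto simp: Suc_le_eq dest: finite_subset)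
    have J: "lcm_orders I \<le> 4 ^ J" if "I \<in> Pow U" for I
    proof -
      have "lcm_orders I \<le> J" unfolding J_def using that fin by (intro Max_ge) auto
      also have "J < 4 ^ J" by (rule power_gt_expt) simp
      finally show ?thesis by simp
    qed
    have "(\<Sum>I\<in>Pow U. f I / sqrt (real (lcm_orders I))) \<le>
       (\<Sum>I\<in>Pow U. \<Sum>j\<le>J. if lcm_orders I \<le> 4 ^ j then f I * (2 / 2 ^ j) else 0)"
    proof (intro sum_mono)
      fix I assume I: "I \<in> Pow U"
      have "f I * (1 / sqrt (real (lcm_orders I))) \<le> f I * (\<Sum>j\<le>J. if lcm_orders I \<le> 4 ^ j then 2 / 2 ^ j else 0)"
        using pos[OF I] J[OF I] f0 by (intro mult_left_mono inverse_sqrt_le_dyadic)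
      also have "\<dots> = (\<Sum>j\<le>J. if lcm_orders I \<le> 4 ^ j then f I * (2 / 2 ^ j) else 0)"
        unfolding sum_distrib_left by (intro sum.cong) auto
      finally show "f I / sqrt (real (lcm_orders I)) \<le> (\<Sum>j\<le>J. if lcm_orders I \<le> 4 ^ j then f I * (2 / 2 ^ j) else 0)"
        by simp
    qed
    also have "\<dots> = (\<Sum>j\<le>J. \<Sum>I\<in>Pow U. if lcm_orders I \<le> 4 ^ j then f I * (2 / 2 ^ j) else 0)"
      by (rule sum.swap)
    also have "\<dots> \<le> (\<Sum>j\<le>J. C * g j)"
    proof (intro sum_mono)
      fix j
      define V where "V = {p \<in> U. ord p (2::nat) \<le> 4 ^ j}"
      have V: "finite V" "V \<subseteq> primes_3_mod_4" using fin U by (auto simp: V_def)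
      have "(\<Sum>I\<in>Pow U. if lcm_orders I \<le> 4 ^ j then f I * (2 / 2 ^ j) else 0) =
          (\<Sum>I\<in>{I \<in> Pow U. lcm_orders I \<le> 4 ^ j}. f I * (2 / 2 ^ j))"
        using fin by (intro sum.inter_filter[symmetric]) auto
      also have "\<dots> \<le> (\<Sum>I\<in>Pow V. f I * (2 / 2 ^ j))"
      proof (rule sum_mono2)
        show "finite (Pow V)" using V by simp
        \<comment> \<open>A small least common multiple forces each single order to be small. After
          this relaxation the sum over \<open>I\<close> factors as an Euler product over
          \<open>V\<close>.\<close>
        show "{I \<in> Pow U. lcm_orders I \<le> 4 ^ j} \<subseteq> Pow V"
        proof safe
          fix I p assume I: "I \<subseteq> U" "lcm_orders I \<le> 4 ^ j" and p: "p \<in> I"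
          have "ord p 2 dvd lcm_orders I" unfolding lcm_orders_def using p by (intro dvd_Lcm) auto
          hence "ord p 2 \<le> lcm_orders I" using pos[of I] I by (intro dvd_imp_le) auto
          thus "p \<in> V" using I p by (auto simp: V_def)
        qed
      qed (use f0 in auto)
      also have "\<dots> = (\<Sum>I\<in>Pow V. f I) * (2 / 2 ^ j)" by (rule sum_distrib_right[symmetric])
      also have "(\<Sum>I\<in>Pow V. f I) = (\<Prod>p\<in>V. 1 + 4 / real p)"
        unfolding f_def using prod_one_plus_eq_sum[OF V(1)] by simp
      also have "\<dots> * (2 / 2 ^ j) \<le> C * (real j + 1) ^ 4 * (2 / 2 ^ j)"
        using V by (intro mult_right_mono C(2)) (auto simp: V_def)
      finally show "(\<Sum>I\<in>Pow U. if lcm_orders I \<le> 4 ^ j then f I * (2 / 2 ^ j) else 0) \<le> C * g j"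
        by (simp add: g_def mult.assoc)
    qed
    also have "\<dots> = C * (\<Sum>j\<le>J. g j)" by (rule sum_distrib_left[symmetric])
    also have "\<dots> \<le> C * suminf g"
      using C(1) summable_power4_geometric g0 by (intro mult_left_mono sum_le_suminf) (auto simp: g_def)
    finally show ?thesis .
  qed
  have "suminf g \<ge> 0" using summable_power4_geometric g0 by (intro suminf_nonneg) (auto simp: g_def)
  hence "C * suminf g + 1 > 0" using C(1) by (intro add_nonneg_pos mult_nonneg_nonneg) auto
  moreover have "(\<Sum>I\<in>Pow U. f I / sqrt (real (lcm_orders I))) \<le> C * suminf g + 1" if "finite U" "U \<subseteq> primes_3_mod_4" for U
    using *[OF that] by simp
  ultimately show ?thesis unfolding f_def by blast
qed

text \<open>Expanding each product over sets \<open>I\<close> of primes and exchanging the sums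
  leaves, for each \<open>I\<close>, the number of index pairs with \<open>lcm_orders I\<close>
  dividing \<open>n\<^sup>2 - k\<^sup>2\<close>. The bound for this number produces the convergent
  Romanoff sum.\<close>

lemma sum_index_pairs_prod_le:
  "\<exists>C>0. \<forall>M. (\<Sum>z\<in>index_pairs M. \<Prod>p | p \<in> primes_3_mod_4 \<and> ord p (2::nat) dvd (snd z)\<^sup>2 - (fst z)\<^sup>2. 1 + 4 / real p) \<le> C * (real M)\<^sup>2"
proof -
  obtain C where C: "C > 0" "\<And>U. finite U \<Longrightarrow> U \<subseteq> primes_3_mod_4 \<Longrightarrow>
     (\<Sum>I\<in>Pow U. (\<Prod>p\<in>I. 4 / real p) / sqrt (real (lcm_orders I))) \<le> C"
    using romanoff_sum_le by blast
  define f where "f = (\<lambda>I. \<Prod>p\<in>I. 4 / real p)"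
  have f0: "f I \<ge> 0" for I unfolding f_def by (intro prod_nonneg) auto
  define F where "F = (\<lambda>z. {p. p \<in> primes_3_mod_4 \<and> ord p (2::nat) dvd (snd z)\<^sup>2 - (fst z)\<^sup>2})"
  have "(\<Sum>z\<in>index_pairs M. \<Prod>p\<in>F z. 1 + 4 / real p) \<le> 4 * C * (real M)\<^sup>2" for M
  proof -
    define U where "U = (\<Union>z\<in>index_pairs M. F z)"
    have finF: "finite (F z)" if "z \<in> index_pairs M" for z
    proof -
      have "(fst z)\<^sup>2 < (snd z)\<^sup>2" using that by (auto simp: index_pairs_def intro: power_strict_mono)
      hence "(snd z)\<^sup>2 - (fst z)\<^sup>2 > 0" by simp
      from card_primes_order_dvd_le(1)[OF this] show ?thesis
        by (rule finite_subset[rotated]) (auto simp: F_def)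
    qed
    have finU: "finite U" using finF by (auto simp: U_def)
    have UP: "U \<subseteq> primes_3_mod_4" by (auto simp: U_def F_def)
    have "(\<Sum>z\<in>index_pairs M. \<Prod>p\<in>F z. 1 + 4 / real p) =
        (\<Sum>z\<in>index_pairs M. \<Sum>I\<in>Pow U. if lcm_orders I dvd (snd z)\<^sup>2 - (fst z)\<^sup>2 then f I else 0)"
    proof (intro sum.cong refl)
      fix z assume z: "z \<in> index_pairs M"
      have "(\<Prod>p\<in>F z. 1 + 4 / real p) = (\<Sum>I\<in>Pow (F z). f I)"
        unfolding f_def by (rule prod_one_plus_eq_sum[OF finF[OF z]])
      also have "Pow (F z) = {I \<in> Pow U. lcm_orders I dvd (snd z)\<^sup>2 - (fst z)\<^sup>2}"
      proof (intro Collect_cong[of "\<lambda>I. I \<subseteq> F z", folded Pow_def])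
        fix I
        have "F z \<subseteq> U" unfolding U_def using z by blast
        moreover have "I \<subseteq> F z \<longleftrightarrow> (\<forall>p\<in>I. ord p (2::nat) dvd (snd z)\<^sup>2 - (fst z)\<^sup>2)" if "I \<subseteq> U"
          unfolding F_def using that UP by blast
        moreover have "lcm_orders I dvd (snd z)\<^sup>2 - (fst z)\<^sup>2 \<longleftrightarrow> (\<forall>p\<in>I. ord p (2::nat) dvd (snd z)\<^sup>2 - (fst z)\<^sup>2)"
          unfolding lcm_orders_def Lcm_dvd_iff by simp
        ultimately show "I \<subseteq> F z \<longleftrightarrow> I \<in> Pow U \<and> lcm_orders I dvd (snd z)\<^sup>2 - (fst z)\<^sup>2"
          unfolding Pow_iff by (meson order_trans)
      qed
      also have "(\<Sum>I\<in>\<dots>. f I) = (\<Sum>I\<in>Pow U. if lcm_orders I dvd (snd z)\<^sup>2 - (fst z)\<^sup>2 then f I else 0)"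
        using finU by (intro sum.inter_filter) auto
      finally show "(\<Prod>p\<in>F z. 1 + 4 / real p) = (\<Sum>I\<in>Pow U. if lcm_orders I dvd (snd z)\<^sup>2 - (fst z)\<^sup>2 then f I else 0)" .
    qed
    also have "\<dots> = (\<Sum>I\<in>Pow U. \<Sum>z\<in>index_pairs M. if lcm_orders I dvd (snd z)\<^sup>2 - (fst z)\<^sup>2 then f I else 0)"
      by (rule sum.swap)
    also have "\<dots> = (\<Sum>I\<in>Pow U. f I * real (card {z \<in> index_pairs M. lcm_orders I dvd (snd z)\<^sup>2 - (fst z)\<^sup>2}))"
      by (intro sum.cong refl) (simp add: sum.inter_filter[symmetric] mult.commute)
    also have "\<dots> \<le> (\<Sum>I\<in>Pow U. f I * (4 * (real M)\<^sup>2 / sqrt (real (lcm_orders I))))"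
    proof (intro sum_mono mult_left_mono f0)
      fix I assume "I \<in> Pow U"
      hence "lcm_orders I > 0" using lcm_orders_pos finU UP by (meson PowD finite_subset order_trans)
      thus "real (card {z \<in> index_pairs M. lcm_orders I dvd (snd z)\<^sup>2 - (fst z)\<^sup>2}) \<le> 4 * (real M)\<^sup>2 / sqrt (real (lcm_orders I))"
        by (rule card_index_pairs_dvd_le)
    qed
    also have "\<dots> = 4 * (real M)\<^sup>2 * (\<Sum>I\<in>Pow U. f I / sqrt (real (lcm_orders I)))"
      by (simp add: sum_distrib_left mult_ac)
    also have "\<dots> \<le> 4 * (real M)\<^sup>2 * C"
      unfolding f_def using finU UP by (intro mult_left_mono C(2)) auto
    finally show ?thesis by (simp add: mult_ac)
  qed
  thus ?thesis using C(1) unfolding F_def by (intro exI[of _ "4 * C"]) auto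
qed

section \<open>The second moment\<close>

lemma card_image_squared_le:
  fixes \<phi> :: "'a \<Rightarrow> 'b"
  assumes "finite T" "\<phi> ` T \<subseteq> S" "finite S"
  shows "(real (card T))\<^sup>2 \<le> real (card S) * real (card {z \<in> T \<times> T. \<phi> (fst z) = \<phi> (snd z)})"
proof -
  define R where "R = (\<lambda>m. card {t \<in> T. \<phi> t = m})"
  have T: "card T = (\<Sum>m\<in>S. R m)"
  proof -
    have "T = (\<Union>m\<in>S. {t \<in> T. \<phi> t = m})" using assms(2) by auto
    hence "card T = card (\<Union>m\<in>S. {t \<in> T. \<phi> t = m})" by simp
    also have "\<dots> = (\<Sum>m\<in>S. R m)" unfolding R_def using assms by (intro card_UN_disjoint) auto
    finally show ?thesis .
  qed
  have E: "card {z \<in> T \<times> T. \<phi> (fst z) = \<phi> (snd z)} = (\<Sum>m\<in>S. (R m)\<^sup>2)"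
  proof -
    have "{z \<in> T \<times> T. \<phi> (fst z) = \<phi> (snd z)} = (\<Union>m\<in>S. {t \<in> T. \<phi> t = m} \<times> {t \<in> T. \<phi> t = m})"
      using assms(2) by auto
    also have "card \<dots> = (\<Sum>m\<in>S. card ({t \<in> T. \<phi> t = m} \<times> {t \<in> T. \<phi> t = m}))"
      using assms by (intro card_UN_disjoint) auto
    finally show ?thesis by (simp add: R_def card_cartesian_product power2_eq_square)
  qed
  have "(real (card T))\<^sup>2 = (\<Sum>m\<in>S. 1 * real (R m))\<^sup>2" by (simp add: T)
  also have "\<dots> \<le> (\<Sum>m\<in>S. 1\<^sup>2) * (\<Sum>m\<in>S. (real (R m))\<^sup>2)" by (rule Cauchy_Schwarz_ineq_sum)
  finally show ?thesis by (simp add: E)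
qed

text \<open>A collision with equal exponents is diagonal. Otherwise the exponents
  \<open>k < n\<close> and the smaller summand \<open>a\<close> determine the other one, and the
  factor 2 accounts for the two orders of the pair.\<close>

lemma card_collisions_le:
  fixes H M :: nat
  defines "T \<equiv> (norms \<inter> {1..H}) \<times> {..M}" and "\<phi> \<equiv> (\<lambda>(a, n). a + 2 ^ n\<^sup>2)"
  shows "card {z \<in> T \<times> T. \<phi> (fst z) = \<phi> (snd z)} \<le>
    card T + 2 * (\<Sum>(k, n)\<in>index_pairs M. card {a \<in> {1..H}. a \<in> norms \<and> a + (2 ^ n\<^sup>2 - 2 ^ k\<^sup>2) \<in> norms})"
proof -
  define A where "A = (\<lambda>(k::nat, n::nat). {a \<in> {1..H}. a \<in> norms \<and> a + (2 ^ n\<^sup>2 - 2 ^ k\<^sup>2) \<in> norms})"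
  define E where "E = {z \<in> T \<times> T. \<phi> (fst z) = \<phi> (snd z)}"
  define E1 where "E1 = (\<lambda>((k::nat, n::nat), a::nat). ((a, n), (a + (2 ^ n\<^sup>2 - 2 ^ k\<^sup>2), k))) ` (SIGMA z:index_pairs M. A z)"
  have finA: "finite (A z)" for z by (auto simp: A_def case_prod_unfold)
  have finS: "finite (SIGMA z:index_pairs M. A z)" using finA by auto
  have finE1: "finite E1" unfolding E1_def using finS by (rule finite_imageI)
  have cardE1: "card E1 \<le> (\<Sum>z\<in>index_pairs M. card (A z))"
    unfolding E1_def using card_image_le[OF finS] finA by (simp add: card_SigmaI)
  have step: "((a, n), (b, k)) \<in> E1" if "((a, n), (b, k)) \<in> E" "k < n" for a b n k
  proof -
    have a: "a \<in> norms" "1 \<le> a" "a \<le> H" "n \<le> M" "b \<in> norms" and eq: "a + 2 ^ n\<^sup>2 = b + 2 ^ k\<^sup>2"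
      using that by (auto simp: E_def T_def \<phi>_def)
    have "k\<^sup>2 \<le> n\<^sup>2" using that by (intro power_mono) auto
    hence "(2::nat) ^ k\<^sup>2 \<le> 2 ^ n\<^sup>2" by (intro power_increasing) auto
    hence b: "b = a + (2 ^ n\<^sup>2 - 2 ^ k\<^sup>2)" using eq by simp
    have "((k, n), a) \<in> (SIGMA z:index_pairs M. A z)"
      using a that(2) unfolding b by (auto simp: A_def index_pairs_def)
    thus ?thesis unfolding E1_def b by (rule rev_image_eqI) simp
  qed
  have "E \<subseteq> (\<lambda>t. (t, t)) ` T \<union> (E1 \<union> prod.swap ` E1)"
  proof
    fix z assume z: "z \<in> E"
    obtain a n b k where zz: "z = ((a, n), (b, k))" by (metis surj_pair)
    have sw: "((b, k), (a, n)) \<in> E" using z by (auto simp: E_def zz)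
    consider "k < n" | "n < k" | "k = n" by linarith
    thus "z \<in> (\<lambda>t. (t, t)) ` T \<union> (E1 \<union> prod.swap ` E1)"
    proof cases
      case 1
      thus ?thesis using step z zz by blast
    next
      case 2
      hence "((b, k), (a, n)) \<in> E1" using step sw by blast
      hence "prod.swap ((b, k), (a, n)) \<in> prod.swap ` E1" by (rule imageI)
      thus ?thesis by (simp add: zz)
    next
      case 3
      thus ?thesis using z by (auto simp: E_def zz \<phi>_def)
    qed
  qed
  hence "card E \<le> card ((\<lambda>t. (t, t)) ` T \<union> (E1 \<union> prod.swap ` E1))"
    using finE1 by (intro card_mono) (auto simp: T_def)
  also have "\<dots> \<le> card ((\<lambda>t. (t, t)) ` T) + (card E1 + card (prod.swap ` E1))"
    by (meson add_left_mono card_Un_le order_trans)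
  also have "\<dots> \<le> card T + (card E1 + card E1)"
    using card_image_le[of T "\<lambda>t. (t, t)"] card_image_le[OF finE1, of prod.swap] by (simp add: T_def)
  also have "\<dots> \<le> card T + 2 * (\<Sum>z\<in>index_pairs M. card (A z))" using cardE1 by simp
  finally show ?thesis by (simp add: E_def A_def case_prod_unfold)
qed

lemma prime_3_mod_4_dvd_power_diff_iff:
  fixes p k n :: nat
  assumes "p \<in> primes_3_mod_4" "k < n"
  shows "p dvd 2 ^ n\<^sup>2 - 2 ^ k\<^sup>2 \<longleftrightarrow> ord p (2::nat) dvd n\<^sup>2 - k\<^sup>2"
proof -
  have kn: "k\<^sup>2 \<le> n\<^sup>2" using assms by (intro power_mono) auto
  have "p mod 4 = 3" using assms by simp
  hence "odd p" by presburger
  have "p dvd 2 ^ n\<^sup>2 - 2 ^ k\<^sup>2 \<longleftrightarrow> [2 ^ n\<^sup>2 = 2 ^ k\<^sup>2] (mod p)"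
    using kn by (intro cong_altdef_nat[symmetric] power_increasing) auto
  also have "\<dots> \<longleftrightarrow> [n\<^sup>2 = k\<^sup>2] (mod ord p 2)"
    using \<open>odd p\<close> by (intro order_divides_expdiff) simp
  also have "\<dots> \<longleftrightarrow> ord p 2 dvd n\<^sup>2 - k\<^sup>2" using kn by (rule cong_altdef_nat)
  finally show ?thesis .
qed

lemma sum_pairs_le:
  "\<exists>C>0. \<exists>H0. \<forall>H\<ge>H0. \<forall>M. 
     real (\<Sum>(k, n)\<in>index_pairs M. card {a \<in> {1..H}. a \<in> norms \<and> a + (2 ^ n\<^sup>2 - 2 ^ k\<^sup>2) \<in> norms}) \<le>
       C * (real H / ln (real H)) * (real M)\<^sup>2"
proof -
  obtain C1 H0 where C1: "C1 > 0" "\<And>H h. H \<ge> H0 \<Longrightarrow> h > 0 \<Longrightarrow>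
     real (card {a\<in>{1..H}. a \<in> norms \<and> a + h \<in> norms}) \<le>
     C1 * (real H / ln (real H)) * (\<Prod>p | p \<in> primes_3_mod_4 \<and> p dvd h. 1 + 4 / real p)"
    using card_norms_pairs_le by blast
  obtain C2 where C2: "C2 > 0" "\<And>M. (\<Sum>z\<in>index_pairs M. \<Prod>p | p \<in> primes_3_mod_4 \<and> ord p (2::nat) dvd (snd z)\<^sup>2 - (fst z)\<^sup>2. 1 + 4 / real p) \<le> C2 * (real M)\<^sup>2"
    using sum_index_pairs_prod_le by blast
  have "real (\<Sum>(k, n)\<in>index_pairs M. card {a \<in> {1..H}. a \<in> norms \<and> a + (2 ^ n\<^sup>2 - 2 ^ k\<^sup>2) \<in> norms}) \<le>
       C1 * C2 * (real H / ln (real H)) * (real M)\<^sup>2" if H: "H \<ge> max H0 2" for H M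
  proof -
    have lnH: "ln (real H) > 0" using H by simp
    have "real (\<Sum>(k, n)\<in>index_pairs M. card {a \<in> {1..H}. a \<in> norms \<and> a + (2 ^ n\<^sup>2 - 2 ^ k\<^sup>2) \<in> norms}) =
      (\<Sum>z\<in>index_pairs M. real (card {a \<in> {1..H}. a \<in> norms \<and> a + (2 ^ (snd z)\<^sup>2 - 2 ^ (fst z)\<^sup>2) \<in> norms}))"
      by (simp add: case_prod_unfold)
    also have "\<dots> \<le> (\<Sum>z\<in>index_pairs M. C1 * (real H / ln (real H)) *
        (\<Prod>p | p \<in> primes_3_mod_4 \<and> ord p (2::nat) dvd (snd z)\<^sup>2 - (fst z)\<^sup>2. 1 + 4 / real p))"
    proof (intro sum_mono)
      fix z assume "z \<in> index_pairs M"
      hence lt: "fst z < snd z" by (auto simp: index_pairs_def)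
      hence "(fst z)\<^sup>2 < (snd z)\<^sup>2" by (intro power_strict_mono) auto
      hence "(2::nat) ^ (fst z)\<^sup>2 < 2 ^ (snd z)\<^sup>2" by (intro power_strict_increasing) auto
      hence pos: "(2::nat) ^ (snd z)\<^sup>2 - 2 ^ (fst z)\<^sup>2 > 0" by simp
      have "{p. p \<in> primes_3_mod_4 \<and> p dvd 2 ^ (snd z)\<^sup>2 - 2 ^ (fst z)\<^sup>2} = {p. p \<in> primes_3_mod_4 \<and> ord p (2::nat) dvd (snd z)\<^sup>2 - (fst z)\<^sup>2}"
        using prime_3_mod_4_dvd_power_diff_iff[OF _ lt] by blast
      thus "real (card {a \<in> {1..H}. a \<in> norms \<and> a + (2 ^ (snd z)\<^sup>2 - 2 ^ (fst z)\<^sup>2) \<in> norms}) \<le>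
         C1 * (real H / ln (real H)) * (\<Prod>p | p \<in> primes_3_mod_4 \<and> ord p (2::nat) dvd (snd z)\<^sup>2 - (fst z)\<^sup>2. 1 + 4 / real p)"
        using C1(2)[OF _ pos, of H] H by simp
    qed
    also have "\<dots> = C1 * (real H / ln (real H)) *
        (\<Sum>z\<in>index_pairs M. \<Prod>p | p \<in> primes_3_mod_4 \<and> ord p (2::nat) dvd (snd z)\<^sup>2 - (fst z)\<^sup>2. 1 + 4 / real p)"
      by (rule sum_distrib_left[symmetric])
    also have "\<dots> \<le> C1 * (real H / ln (real H)) * (C2 * (real M)\<^sup>2)"
      using C1(1) lnH by (intro mult_left_mono C2(2)) auto
    finally show ?thesis by (simp add: mult_ac)
  qed
  thus ?thesis using C1(1) C2(1) by (intro exI[of _ "C1 * C2"] conjI exI[of _ "max H0 2"]) auto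
qed

text \<open>The number of pairs \<open>t\<close> occurs in the numerator and in the diagonal part of
  the collision bound; monotonicity lets a lower bound for \<open>t\<close> replace it in both
  places.\<close>

lemma square_div_add_mono:
  fixes t t0 K :: real
  assumes "0 < t0" "t0 \<le> t" "0 \<le> K"
  shows "t0\<^sup>2 / (t0 + K) \<le> t\<^sup>2 / (t + K)"
proof -
  have "t0\<^sup>2 * K \<le> t\<^sup>2 * K" using assms by (intro mult_right_mono power_mono) auto
  moreover have "t0 * t * t0 \<le> t0 * t * t" using assms by (intro mult_left_mono) auto
  ultimately have "t0\<^sup>2 * (t + K) \<le> t\<^sup>2 * (t0 + K)" by (simp add: algebra_simps power2_eq_square)
  thus ?thesis using assms by (simp add: divide_le_eq le_divide_eq)
qed

text \<open>\<open>M\<close> is \<open>sqrt (log 2 H)\<close> rounded down. The upper bound limits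
  the number of index pairs; the lower bound is for \<open>M + 1\<close>, the number of exponents in
  \<open>{..M}\<close>.\<close>

lemma exists_exponent_bound:
  fixes N H :: nat
  assumes N: "N \<ge> 16" and H: "H = N div 2"
  shows "\<exists>M. 2 ^ M\<^sup>2 \<le> H \<and> (real M)\<^sup>2 \<le> 2 * ln (real N) \<and> sqrt (ln (real N)) \<le> 2 * real (M + 1)"
proof -
  define x where "x = sqrt (log 2 (real H))"
  define M where "M = nat \<lfloor>x\<rfloor>"
  have H8: "H \<ge> 8" using N H by simp
  have ln2: "1 / 2 \<le> ln (2::real)" "ln (2::real) \<le> 1" "ln (2::real) > 0"
  proof -
    show "ln (2::real) \<le> 1" using ln_le_minus_one[of 2] by simp
    have "ln (1 / 2 :: real) \<le> 1 / 2 - 1" by (rule ln_le_minus_one) simp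
    thus "1 / 2 \<le> ln (2::real)" by (simp add: ln_div)
    show "ln (2::real) > 0" by simp
  qed
  have lnH: "ln (real H) > 0" using H8 by simp
  have x2: "x\<^sup>2 = log 2 (real H)" using H8 by (simp add: x_def)
  have x0: "x \<ge> 0" using H8 by (simp add: x_def)
  have M: "real M \<le> x" "x < real (M + 1)" using x0 unfolding M_def by linarith+
  have "(real M)\<^sup>2 \<le> x\<^sup>2" using M x0 by (intro power_mono) auto
  hence M2: "(real M)\<^sup>2 \<le> log 2 (real H)" by (simp add: x2)
  have "(2::real) ^ M\<^sup>2 = 2 powr ((real M)\<^sup>2)" by (simp add: powr_realpow[symmetric])
  also have "\<dots> \<le> 2 powr log 2 (real H)" using M2 by (intro powr_mono) auto
  also have "\<dots> = real H" using H8 by simp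
  finally have 1: "2 ^ M\<^sup>2 \<le> H" by (metis of_nat_le_iff of_nat_numeral of_nat_power)
  have "ln (real H) \<le> ln (real N)" using H H8 by simp
  moreover have "log 2 (real H) \<le> 2 * ln (real H)"
  proof -
    have "ln (real H) * 1 \<le> ln (real H) * (2 * ln 2)" using ln2 lnH by (intro mult_left_mono) auto
    thus ?thesis using ln2(3) by (simp add: log_def divide_le_eq mult_ac)
  qed
  ultimately have 2: "(real M)\<^sup>2 \<le> 2 * ln (real N)" using M2 by linarith
  have "ln (real N) / 4 \<le> log 2 (real H)"
  proof -
    have "real N \<le> (real H)\<^sup>2"
    proof -
      have "N \<le> 3 * H" using H H8 by simp
      also have "\<dots> \<le> H * H" using H8 by (intro mult_right_mono) auto
      finally show ?thesis by (metis of_nat_le_iff of_nat_mult power2_eq_square)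
    qed
    hence "ln (real N) \<le> ln ((real H)\<^sup>2)" using N H8 by (subst ln_le_cancel_iff) auto
    also have "\<dots> = 2 * ln (real H)" using H8 by (simp add: ln_realpow)
    finally have "ln (real N) / 4 \<le> ln (real H)" using lnH by linarith
    also have "\<dots> \<le> log 2 (real H)"
      using ln2 lnH by (simp add: log_def le_divide_eq mult_left_le)
    finally show ?thesis .
  qed
  hence "sqrt (ln (real N) / 4) \<le> x" unfolding x_def by (rule real_sqrt_le_mono)
  hence "sqrt (ln (real N)) \<le> 2 * x" by (simp add: real_sqrt_divide)
  also have "2 * x \<le> 2 * real (M + 1)" using M(2) by simp
  finally have 3: "sqrt (ln (real N)) \<le> 2 * real (M + 1)" .
  from 1 2 3 show ?thesis by blast
qed

lemma card_S4_ge: "\<exists>\<delta>>0. \<exists>N0. \<forall>N\<ge>N0. \<delta> * real N \<le> real (card (S4 \<inter> {1..N}))"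
proof -
  obtain c H1 where c: "c > 0"
    and norms_ge: "\<And>H. H \<ge> H1 \<Longrightarrow> c * real H / sqrt (ln (real H)) \<le> real (card (norms \<inter> {1..H}))"
    using card_norms_ge by blast
  obtain C H2 where C: "C > 0" and pairs_le: "\<And>H M. H \<ge> H2 \<Longrightarrow>
     real (\<Sum>(k, n)\<in>index_pairs M. card {a \<in> {1..H}. a \<in> norms \<and> a + (2 ^ n\<^sup>2 - 2 ^ k\<^sup>2) \<in> norms}) \<le>
       C * (real H / ln (real H)) * (real M)\<^sup>2"
    using sum_pairs_le by blast
  \<comment> \<open>The value of \<open>t\<^sup>2 / (t + 8 * C * H)\<close> at the lower bound
    \<open>t = c / 2 * H\<close>, divided by \<open>3 * H \<ge> N\<close>.\<close>
  define \<delta> where "\<delta> = (c / 2)\<^sup>2 / (c / 2 + 8 * C) / 3"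
  have \<delta>: "\<delta> > 0" using c C by (simp add: \<delta>_def add_pos_pos)
  have "\<delta> * real N \<le> real (card (S4 \<inter> {1..N}))" if N: "N \<ge> 16 + 2 * H1 + 2 * H2" for N
  proof -
    \<comment> \<open>Both summands \<open>a\<close> and \<open>2 ^ n\<^sup>2\<close> are kept below
      half of \<open>N\<close>, so that their sums stay in \<open>{1..N}\<close>.\<close>
    define H where "H = N div 2"
    have H: "H \<ge> H1" "H \<ge> H2" "H \<ge> 8" "N \<le> 3 * H" "2 * H \<le> N" using N by (auto simp: H_def)
    obtain M where M: "2 ^ M\<^sup>2 \<le> H" "(real M)\<^sup>2 \<le> 2 * ln (real N)" "sqrt (ln (real N)) \<le> 2 * real (M + 1)"
      using exists_exponent_bound[of N H] N H_def by auto
    define T where "T = (norms \<inter> {1..H}) \<times> {..M}"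
    define \<phi> where "\<phi> = (\<lambda>(a::nat, n::nat). a + 2 ^ n\<^sup>2)"
    define t where "t = real (card T)"
    define E where "E = {z \<in> T \<times> T. \<phi> (fst z) = \<phi> (snd z)}"
    have lnH: "ln (real H) > 0" using H by simp
    have lnN_pos: "ln (real N) > 0" using N by simp
    have lnHN: "ln (real H) \<le> ln (real N)" using H by simp
    have lnN: "ln (real N) \<le> 2 * ln (real H)"
    proof -
      have "3 * H \<le> H * H" using H by (intro mult_right_mono) auto
      hence "N \<le> H * H" using H by linarith
      hence "real N \<le> (real H)\<^sup>2" by (metis of_nat_le_iff of_nat_mult power2_eq_square)
      hence "ln (real N) \<le> ln ((real H)\<^sup>2)" using N H by (subst ln_le_cancel_iff) auto
      thus ?thesis using H by (simp add: ln_realpow)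
    qed
    have sub: "\<phi> ` T \<subseteq> S4 \<inter> {1..N}"
    proof
      fix m assume "m \<in> \<phi> ` T"
      then obtain a n where an: "a \<in> norms" "1 \<le> a" "a \<le> H" "n \<le> M" "m = a + 2 ^ n\<^sup>2"
        by (auto simp: T_def \<phi>_def)
      obtain b1 b2 where "a = b1\<^sup>2 + b2\<^sup>2" using norms_sum_two_squares an(1) by blast
      hence "m \<in> S4" unfolding S4_def an(5) by blast
      moreover have "(2::nat) ^ n\<^sup>2 \<le> 2 ^ M\<^sup>2" using an by (intro power_increasing power_mono) auto
      hence "m \<le> N" using an M(1) H by linarith
      ultimately show "m \<in> S4 \<inter> {1..N}" using an by simp
    qed
    have cs: "t\<^sup>2 \<le> real (card (S4 \<inter> {1..N})) * real (card E)"
      unfolding t_def E_def by (rule card_image_squared_le[OF _ sub]) (auto simp: T_def)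
    have E_le: "real (card E) \<le> t + 8 * C * real H"
    proof -
      have "card E \<le> card T + 2 * (\<Sum>(k, n)\<in>index_pairs M. card {a \<in> {1..H}. a \<in> norms \<and> a + (2 ^ n\<^sup>2 - 2 ^ k\<^sup>2) \<in> norms})"
        unfolding E_def T_def \<phi>_def by (rule card_collisions_le)
      hence "real (card E) \<le> t + 2 * real (\<Sum>(k, n)\<in>index_pairs M. card {a \<in> {1..H}. a \<in> norms \<and> a + (2 ^ n\<^sup>2 - 2 ^ k\<^sup>2) \<in> norms})"
        unfolding t_def by linarith
      also have "\<dots> \<le> t + 2 * (C * (real H / ln (real H)) * (real M)\<^sup>2)"
        using pairs_le[OF H(2), of M] by linarith
      \<comment> \<open>The number of index pairs, of order
        \<open>M\<^sup>2 \<le> 2 * ln N \<le> 4 * ln H\<close>, cancels exactly the logarithm saved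
        by the sieve.\<close>
      also have "C * (real H / ln (real H)) * (real M)\<^sup>2 \<le> C * (real H / ln (real H)) * (4 * ln (real H))"
        using M(2) lnN lnH C by (intro mult_left_mono) auto
      also have "C * (real H / ln (real H)) * (4 * ln (real H)) = 4 * C * real H"
        using lnH by simp
      finally show ?thesis by simp
    qed
    have t_ge: "c / 2 * real H \<le> t"
    proof -
      have "c / 2 * real H = c * real H / sqrt (ln (real H)) * (sqrt (ln (real H)) / 2)"
        using lnH by simp
      also have "\<dots> \<le> real (card (norms \<inter> {1..H})) * real (M + 1)"
      proof (rule mult_mono)
        have "sqrt (ln (real H)) \<le> sqrt (ln (real N))" using lnHN by (rule real_sqrt_le_mono)
        from order_trans[OF this M(3)] show "sqrt (ln (real H)) / 2 \<le> real (M + 1)" by simp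
      qed (use norms_ge[OF H(1)] lnH in auto)
      also have "\<dots> = t" by (simp add: t_def T_def card_cartesian_product algebra_simps)
      finally show ?thesis .
    qed
    have pos: "c / 2 * real H > 0" using c H by simp
    have K: "8 * C * real H \<ge> 0" using C by simp
    have "\<delta> * real N \<le> \<delta> * (3 * real H)"
    proof (intro mult_left_mono)
      have "real N \<le> real (3 * H)" using H(4) by (simp only: of_nat_le_iff)
      thus "real N \<le> 3 * real H" by simp
    qed (use \<delta> in auto)
    also have "\<delta> * (3 * real H) = (c / 2 * real H)\<^sup>2 / (c / 2 * real H + 8 * C * real H)"
    proof -
      have eq: "c / 2 * real H + 8 * C * real H = (c / 2 + 8 * C) * real H"
        "(c / 2 * real H)\<^sup>2 = (c / 2)\<^sup>2 * real H * real H"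
        by (simp_all add: distrib_right power2_eq_square)
      have cancel: "X / Y / 3 * (3 * h) = X * h * h / (Y * h)" if "h \<noteq> 0" for X Y h :: real
        using that by simp
      have "real H \<noteq> 0" using H(3) by simp
      thus ?thesis unfolding \<delta>_def eq by (rule cancel)
    qed
    also have "\<dots> \<le> t\<^sup>2 / (t + 8 * C * real H)" using pos t_ge K by (rule square_div_add_mono)
    also have "\<dots> \<le> real (card (S4 \<inter> {1..N}))"
    proof -
      have "t\<^sup>2 \<le> real (card (S4 \<inter> {1..N})) * (t + 8 * C * real H)"
        using cs E_le by (meson mult_left_mono of_nat_0_le_iff order_trans)
      moreover have "t + 8 * C * real H > 0" using pos t_ge K by linarith
      ultimately show ?thesis by (simp add: divide_le_eq)
    qed
    finally show ?thesis .
  qed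
  thus ?thesis using \<delta> by blast
qed

lemma lower_density_S4_pos: "lower_density S4 > 0"
proof -
  obtain \<delta> N0 where \<delta>: "\<delta> > 0" "\<And>N. N \<ge> N0 \<Longrightarrow> \<delta> * real N \<le> real (card (S4 \<inter> {1..N}))"
    using card_S4_ge by blast
  have "eventually (\<lambda>N. ereal \<delta> \<le> ereal (real (card (S4 \<inter> {1..N})) / real N)) sequentially"
    using eventually_ge_at_top[of "max N0 1"]
  proof eventually_elim
    case (elim N)
    thus ?case using \<delta>(2)[of N] by (simp add: le_divide_eq)
  qed
  hence "ereal \<delta> \<le> lower_density S4"
    unfolding lower_density_def by (rule Liminf_bounded)
  moreover have "0 < ereal \<delta>" using \<delta>(1) by simp
  ultimately show ?thesis by (rule less_le_trans[rotated])
qed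

theorem theorem4:
  shows "lower_density S4 > 0 \<and>
    (\<exists>(M::int) (\<alpha>::int). M > 0 \<and> odd M \<and>
       {x::int. [x = \<alpha>] (mod M)} \<inter> int ` S4 = {})"
  using lower_density_S4_pos residue_class_avoiding_S4 by (rule conjI)

end
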